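(* Let $\mathcal H_A,\mathcal H_B$ be complex Hilbert spaces and $\mathbf A=\mathcal B(\mathcal H_A)$, $\mathbf B=\mathcal B(\mathcal H_B)$. (a) For every quantum register $F:\mathbf A\to\mathbf B$ there exist a complex Hilbert space $\mathcal H_C$ and a quantum register $G:\mathcal B(\mathcal H_C)\to\mathbf B$ such that $F$ and $G$ are complements. (b) If $F:\mathbf A\to\mathbf B$, $G:\mathbf C\to\mathbf B$, $H:\mathbf D\to\mathbf B$ are quantum registers (with $\mathbf C=\mathcal B(\mathcal H_C)$, $\mathbf D=\mathcal B(\mathcal H_D)$) such that $F,G$ are complements and $F,H$ are complements, then $G$ and $H$ are equivalent. (In the paper's terminology: the quantum register category has complements.)
   Context: All Hilbert spaces are complex, possibly infinite-dimensional. For a Hilbert space $\mathcal H_X$ write $\mathbf X:=\mathcal B(\mathcal H_X)$ for the space of bounded operators. A quantum register $F:\mathbf A\to\mathbf B$ is a map $\mathcal B(\mathcal H_A)\to\mathcal B(\mathcal H_B)$ that is linear, continuous with respect to the weak*-topologies (i.e., normal), unital ($F(1)=1$), multiplicative ($F(ab)=F(a)F(b)$) and satisfies $F(a^* )=F(a)^*$. We write $\mathbf A\otimes\mathbf B:=\mathcal B(\mathcal H_A\otimes\mathcal H_B)$, and $a\otimes b$ for the usual tensor product of operators. An iso-register is a register $F$ for which there exists a register $G$ with $F\circ G=\mathrm{id}$ and $G\circ F=\mathrm{id}$. Registers $F:\mathbf A\to\mathbf C$ and $G:\mathbf B\to\mathbf C$ are compatible if $F(a)G(b)=G(b)F(a)$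 for all $a\in\mathbf A,b\in\mathbf B$; in that case there is a unique register $(F;G):\mathbf A\otimes\mathbf B\to\mathbf C$ with $(F;G)(a\otimes b)=F(a)G(b)$. $F,G$ are called complements if they are compatible and $(F;G)$ is an iso-register. Registers $G:\mathbf C\to\mathbf B$ and $H:\mathbf D\to\mathbf B$ are equivalent if there is an iso-register $I:\mathbf D\to\mathbf C$ with $G\circ I=H$.
   Formalization: Part (b) is proved for H_A ≠ 0; it fails for H_A = 0, since then H_B = 0 and, for example, H_C = ℂ and H_D = ℂ² both carry complements of F although B(ℂ) and B(ℂ²) are not isomorphic. *)

theory Defs
  imports "HOL-Analysis.Analysis"
begin

section \<open>Complex Hilbert spaces\<close>

text \<open>
  The inner product is antilinear in its first argument. Building the class on \<^class>\<open>real_inner\<close>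
  makes the norm the one induced by \<open>cinner\<close>: \<open>(norm x)\<^sup>2 = inner x x = Re (cinner x x)\<close>,
  and \<open>cinner x x\<close> is real by \<open>cinner_commute\<close>.
\<close>

class chilbert_space = real_inner + complete_space +
  fixes scaleC :: "complex \<Rightarrow> 'a \<Rightarrow> 'a" (infixr \<open>*\<^sub>C\<close> 75)
    and cinner :: "'a \<Rightarrow> 'a \<Rightarrow> complex"
  assumes scaleC_add_right: "c *\<^sub>C (x + y) = c *\<^sub>C x + c *\<^sub>C y"
    and scaleC_add_left: "(c + d) *\<^sub>C x = c *\<^sub>C x + d *\<^sub>C x"
    and scaleC_scaleC: "c *\<^sub>C (d *\<^sub>C x) = (c * d) *\<^sub>C x"
    and scaleR_scaleC: "r *\<^sub>R x = complex_of_real r *\<^sub>C x"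
    and cinner_commute: "cinner x y = cnj (cinner y x)"
    and cinner_add_right: "cinner x (y + z) = cinner x y + cinner x z"
    and cinner_scaleC_right: "cinner x (c *\<^sub>C y) = c * cinner x y"
    and inner_eq_Re_cinner: "inner x y = Re (cinner x y)"

text \<open>
  Hilbert spaces are rendered as closed complex subspaces of a type of class \<open>chilbert_space\<close>
  (the whole type being one of them), so that Hilbert spaces can be quantified over existentially.
\<close>

definition closed_csubspace :: "'a::chilbert_space set \<Rightarrow> bool" where
  "closed_csubspace S \<longleftrightarrow>
     0 \<in> S \<and> (\<forall>x\<in>S. \<forall>y\<in>S. x + y \<in> S) \<and> (\<forall>c. \<forall>x\<in>S. c *\<^sub>C x \<in> S) \<and> closed S"

definition is_onb :: "'a::chilbert_space set \<Rightarrow> 'a set \<Rightarrow> bool" where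
  "is_onb S E \<longleftrightarrow> E \<subseteq> S \<and> (\<forall>e\<in>E. norm e = 1) \<and> (\<forall>e\<in>E. \<forall>f\<in>E. e \<noteq> f \<longrightarrow> cinner e f = 0)
     \<and> (\<forall>x\<in>S. (\<forall>e\<in>E. cinner e x = 0) \<longrightarrow> x = 0)"

definition some_onb :: "'a::chilbert_space set \<Rightarrow> 'a set" where
  "some_onb S = (SOME E. is_onb S E)"

section \<open>The space of square-summable families\<close>

typedef 'i ell2 = "{f :: 'i \<Rightarrow> complex. (\<lambda>i. (cmod (f i))\<^sup>2) summable_on UNIV}"
  morphisms ell2_nth Abs_ell2
  by (rule exI[of _ "\<lambda>_. 0"]) simp

setup_lifting type_definition_ell2

lemma ell2_product_abs_summable:
  fixes f g :: "'i \<Rightarrow> complex"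
  assumes "(\<lambda>i. (cmod (f i))\<^sup>2) summable_on UNIV" "(\<lambda>i. (cmod (g i))\<^sup>2) summable_on UNIV"
  shows "(\<lambda>i. cmod (f i) * cmod (g i)) summable_on UNIV"
proof (rule summable_on_comparison_test)
  show "(\<lambda>i. (cmod (f i))\<^sup>2 + (cmod (g i))\<^sup>2) summable_on UNIV"
    by (intro summable_on_add assms)
  fix i
  show "cmod (f i) * cmod (g i) \<le> (cmod (f i))\<^sup>2 + (cmod (g i))\<^sup>2"
    using sum_squares_bound[of "cmod (f i)" "cmod (g i)"]
      mult_nonneg_nonneg[of "cmod (f i)" "cmod (g i)"] norm_ge_zero[of "f i"] norm_ge_zero[of "g i"]
    by linarith
qed auto

lemma ell2_product_summable:
  fixes f g :: "'i \<Rightarrow> complex"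
  assumes "(\<lambda>i. (cmod (f i))\<^sup>2) summable_on UNIV" "(\<lambda>i. (cmod (g i))\<^sup>2) summable_on UNIV"
  shows "(\<lambda>i. cnj (f i) * g i) summable_on UNIV"
  using ell2_product_abs_summable[OF assms]
  by - (rule abs_summable_summable, simp add: norm_mult)

lemma ell2_add_summable:
  fixes f g :: "'i \<Rightarrow> complex"
  assumes "(\<lambda>i. (cmod (f i))\<^sup>2) summable_on UNIV" "(\<lambda>i. (cmod (g i))\<^sup>2) summable_on UNIV"
  shows "(\<lambda>i. (cmod (f i + g i))\<^sup>2) summable_on UNIV"
proof (rule summable_on_comparison_test)
  show "(\<lambda>i. (cmod (f i))\<^sup>2 + (cmod (g i))\<^sup>2 + 2 * (cmod (f i) * cmod (g i))) summable_on UNIV"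
    by (intro summable_on_add summable_on_cmult_right assms ell2_product_abs_summable)
  fix i
  have "(cmod (f i + g i))\<^sup>2 \<le> (cmod (f i) + cmod (g i))\<^sup>2"
    by (intro power_mono norm_triangle_ineq) auto
  then show "(cmod (f i + g i))\<^sup>2 \<le> (cmod (f i))\<^sup>2 + (cmod (g i))\<^sup>2 + 2 * (cmod (f i) * cmod (g i))"
    by (simp add: power2_sum)
qed auto

lemma ell2_scale_summable:
  fixes f :: "'i \<Rightarrow> complex"
  assumes "(\<lambda>i. (cmod (f i))\<^sup>2) summable_on UNIV"
  shows "(\<lambda>i. (cmod (c * f i))\<^sup>2) summable_on UNIV"
  using summable_on_cmult_right[OF assms, of "(cmod c)\<^sup>2"]
  by (simp add: norm_mult power_mult_distrib)

instantiation ell2 :: (type) real_vector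
begin

lift_definition zero_ell2 :: "'a ell2" is "\<lambda>_. 0" by simp

lift_definition plus_ell2 :: "'a ell2 \<Rightarrow> 'a ell2 \<Rightarrow> 'a ell2" is "\<lambda>f g i. f i + g i"
  by (rule ell2_add_summable)

lift_definition uminus_ell2 :: "'a ell2 \<Rightarrow> 'a ell2" is "\<lambda>f i. - f i" by simp

lift_definition minus_ell2 :: "'a ell2 \<Rightarrow> 'a ell2 \<Rightarrow> 'a ell2" is "\<lambda>f g i. f i - g i"
  subgoal for f g using ell2_add_summable[of f "\<lambda>i. - g i"] by simp
  done

lift_definition scaleR_ell2 :: "real \<Rightarrow> 'a ell2 \<Rightarrow> 'a ell2" is "\<lambda>r f i. complex_of_real r * f i"
  by (rule ell2_scale_summable)

instance
proof
  fix x y z :: "'a ell2" and r s :: real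
  show "x + y + z = x + (y + z)" by transfer (simp add: add.assoc)
  show "x + y = y + x" by transfer (simp add: add.commute)
  show "0 + x = x" by transfer simp
  show "- x + x = 0" by transfer simp
  show "x - y = x + - y" by transfer simp
  show "r *\<^sub>R (x + y) = r *\<^sub>R x + r *\<^sub>R y" by transfer (simp add: algebra_simps)
  show "(r + s) *\<^sub>R x = r *\<^sub>R x + s *\<^sub>R x" by transfer (simp add: algebra_simps)
  show "r *\<^sub>R s *\<^sub>R x = (r * s) *\<^sub>R x" by transfer (simp add: algebra_simps)
  show "1 *\<^sub>R x = x" by transfer simp
qed

end

instantiation ell2 :: (type) real_inner
begin

definition inner_ell2 :: "'a ell2 \<Rightarrow> 'a ell2 \<Rightarrow> real" where
  "inner_ell2 x y = Re (\<Sum>\<^sub>\<infinity>i. cnj (ell2_nth x i) * ell2_nth y i)"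

definition norm_ell2 :: "'a ell2 \<Rightarrow> real" where
  "norm_ell2 x = sqrt (inner x x)"

definition dist_ell2 :: "'a ell2 \<Rightarrow> 'a ell2 \<Rightarrow> real" where
  "dist_ell2 x y = norm (x - y)"

definition sgn_ell2 :: "'a ell2 \<Rightarrow> 'a ell2" where
  "sgn_ell2 x = x /\<^sub>R norm x"

definition uniformity_ell2 :: "('a ell2 \<times> 'a ell2) filter" where
  "uniformity_ell2 = (INF e\<in>{0 <..}. principal {(x, y). dist x y < e})"

definition open_ell2 :: "'a ell2 set \<Rightarrow> bool" where
  "open_ell2 U \<longleftrightarrow> (\<forall>x\<in>U. \<forall>\<^sub>F (x', y) in uniformity. x' = x \<longrightarrow> y \<in> U)"

lemma ell2_nth_summable: "(\<lambda>i. (cmod (ell2_nth x i))\<^sup>2) summable_on UNIV"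
  using ell2_nth[of x] by simp

lemma ell2_inner_self: "inner x x = (\<Sum>\<^sub>\<infinity>i. (cmod (ell2_nth x i))\<^sup>2)" for x :: "'a ell2"
proof -
  have "Re (\<Sum>\<^sub>\<infinity>i. cnj (ell2_nth x i) * ell2_nth x i)
      = (\<Sum>\<^sub>\<infinity>i. Re (cnj (ell2_nth x i) * ell2_nth x i))"
    by (intro infsum_Re[symmetric] ell2_product_summable ell2_nth_summable)
  also have "\<dots> = (\<Sum>\<^sub>\<infinity>i. (cmod (ell2_nth x i))\<^sup>2)"
    by (intro infsum_cong) (simp only: cmod_power2, simp add: power2_eq_square)
  finally show ?thesis by (simp add: inner_ell2_def)
qed

instance
proof
  fix x y z :: "'a ell2" and r :: real
  show "sgn x = x /\<^sub>R norm x" by (rule sgn_ell2_def)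
  show "dist x y = norm (x - y)" by (rule dist_ell2_def)
  show "norm x = sqrt (inner x x)" by (rule norm_ell2_def)
  show "(uniformity :: ('a ell2 \<times> 'a ell2) filter) = (INF e\<in>{0 <..}. principal {(x, y). dist x y < e})"
    by (rule uniformity_ell2_def)
  show "open U \<longleftrightarrow> (\<forall>x\<in>U. \<forall>\<^sub>F (x', y) in uniformity. x' = x \<longrightarrow> y \<in> U)" for U :: "'a ell2 set"
    by (rule open_ell2_def)
  note prod = ell2_product_summable[OF ell2_nth_summable ell2_nth_summable]
  have "(\<Sum>\<^sub>\<infinity>i. cnj (ell2_nth x i) * ell2_nth y i) = cnj (\<Sum>\<^sub>\<infinity>i. cnj (ell2_nth y i) * ell2_nth x i)"
    by (simp add: mult.commute flip: infsum_cnj)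
  then show "inner x y = inner y x" by (simp add: inner_ell2_def)
  show "inner (x + y) z = inner x z + inner y z"
    unfolding inner_ell2_def plus_ell2.rep_eq
    by (simp add: ring_distribs infsum_add prod)
  show "inner (r *\<^sub>R x) y = r * inner x y"
    unfolding inner_ell2_def scaleR_ell2.rep_eq
    by (simp add: mult.assoc infsum_cmult_right')
  show "0 \<le> inner x x" by (simp add: ell2_inner_self infsum_nonneg)
  show "(inner x x = 0) = (x = 0)"
  proof
    assume "inner x x = 0"
    then have "(cmod (ell2_nth x i))\<^sup>2 = 0" for i
      using nonneg_infsum_le_0D[OF _ ell2_nth_summable[of x], of i] by (simp add: ell2_inner_self)
    then show "x = 0" by transfer auto
  qed (simp add: ell2_inner_self zero_ell2.rep_eq)
qed

end

lemma ell2_norm_square: "(norm x)\<^sup>2 = (\<Sum>\<^sub>\<infinity>i. (cmod (ell2_nth x i))\<^sup>2)"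
  by (simp add: power2_norm_eq_inner ell2_inner_self)

lemma ell2_nth_finite_sum_le: "finite M \<Longrightarrow> (\<Sum>i\<in>M. (cmod (ell2_nth x i))\<^sup>2) \<le> (norm x)\<^sup>2"
  unfolding ell2_norm_square by (intro finite_sum_le_infsum ell2_nth_summable) auto

lemma ell2_nth_le_norm: "cmod (ell2_nth x i) \<le> norm x"
  using ell2_nth_finite_sum_le[of "{i}" x] by (simp add: power2_le_iff_abs_le)

instance ell2 :: (type) complete_space
proof
  fix X :: "nat \<Rightarrow> 'a ell2"
  assume X: "Cauchy X"
  have "Cauchy (\<lambda>n. ell2_nth (X n) i)" for i
  proof (rule CauchyI)
    fix e :: real assume "0 < e"
    then obtain N where "\<forall>m\<ge>N. \<forall>n\<ge>N. norm (X m - X n) < e" using CauchyD[OF X] by blast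
    then show "\<exists>N. \<forall>m\<ge>N. \<forall>n\<ge>N. norm (ell2_nth (X m) i - ell2_nth (X n) i) < e"
      using ell2_nth_le_norm[where i = i] by (metis le_less_trans minus_ell2.rep_eq)
  qed
  then have "(\<lambda>n. ell2_nth (X n) i) \<longlonglongrightarrow> lim (\<lambda>n. ell2_nth (X n) i)" for i
    by (simp add: Cauchy_convergent_iff convergent_LIMSEQ_iff)
  then obtain f where f: "\<And>i. (\<lambda>n. ell2_nth (X n) i) \<longlonglongrightarrow> f i"
    by (rule that)
  have tail: "\<exists>N. \<forall>n\<ge>N. \<forall>M. finite M \<longrightarrow> (\<Sum>i\<in>M. (cmod (f i - ell2_nth (X n) i))\<^sup>2) \<le> e\<^sup>2"
    if "0 < e" for e :: real
  proof -
    obtain N where N: "\<And>m n. m \<ge> N \<Longrightarrow> n \<ge> N \<Longrightarrow> norm (X m - X n) < e"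
      using CauchyD[OF X \<open>0 < e\<close>] by blast
    have "(\<Sum>i\<in>M. (cmod (f i - ell2_nth (X n) i))\<^sup>2) \<le> e\<^sup>2" if "n \<ge> N" "finite M" for n M
    proof (rule LIMSEQ_le_const2)
      show "(\<lambda>m. \<Sum>i\<in>M. (cmod (ell2_nth (X m) i - ell2_nth (X n) i))\<^sup>2)
              \<longlonglongrightarrow> (\<Sum>i\<in>M. (cmod (f i - ell2_nth (X n) i))\<^sup>2)"
        by (intro tendsto_intros f)
      have "(\<Sum>i\<in>M. (cmod (ell2_nth (X m) i - ell2_nth (X n) i))\<^sup>2) \<le> e\<^sup>2" if "m \<ge> N" for m
      proof -
        have "(\<Sum>i\<in>M. (cmod (ell2_nth (X m - X n) i))\<^sup>2) \<le> (norm (X m - X n))\<^sup>2"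
          by (rule ell2_nth_finite_sum_le) fact
        also have "\<dots> \<le> e\<^sup>2"
          using N[OF that \<open>n \<ge> N\<close>] by (intro power_mono) auto
        finally show ?thesis by (simp add: minus_ell2.rep_eq)
      qed
      then show "\<exists>N. \<forall>m\<ge>N. (\<Sum>i\<in>M. (cmod (ell2_nth (X m) i - ell2_nth (X n) i))\<^sup>2) \<le> e\<^sup>2"
        by blast
    qed
    then show ?thesis by blast
  qed
  have diff: "(\<lambda>i. (cmod (f i - ell2_nth (X n) i))\<^sup>2) summable_on UNIV"
    if "\<forall>M. finite M \<longrightarrow> (\<Sum>i\<in>M. (cmod (f i - ell2_nth (X n) i))\<^sup>2) \<le> e\<^sup>2" for n and e :: real
    using that by (intro nonneg_bdd_above_summable_on) (auto intro!: bdd_aboveI2[where M = "e\<^sup>2"])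
  obtain N where "\<forall>M. finite M \<longrightarrow> (\<Sum>i\<in>M. (cmod (f i - ell2_nth (X N) i))\<^sup>2) \<le> 1\<^sup>2"
    using tail[of 1] by auto
  from ell2_add_summable[OF diff[OF this] ell2_nth_summable[of "X N"]]
  have "(\<lambda>i. (cmod (f i))\<^sup>2) summable_on UNIV" by simp
  then have Y: "ell2_nth (Abs_ell2 f) = f" by (simp add: Abs_ell2_inverse)
  have "X \<longlonglongrightarrow> Abs_ell2 f"
  proof (rule LIMSEQ_I)
    fix e :: real assume "0 < e"
    then obtain N where N: "\<forall>n\<ge>N. \<forall>M. finite M \<longrightarrow> (\<Sum>i\<in>M. (cmod (f i - ell2_nth (X n) i))\<^sup>2) \<le> (e/2)\<^sup>2"
      using tail[of "e/2"] by auto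
    have "norm (X n - Abs_ell2 f) < e" if "n \<ge> N" for n
    proof -
      have "(norm (Abs_ell2 f - X n))\<^sup>2 \<le> (e/2)\<^sup>2"
        unfolding ell2_norm_square minus_ell2.rep_eq Y
        using N that by (intro infsum_le_finite_sums diff[where e = "e/2"]) auto
      then have "norm (Abs_ell2 f - X n) \<le> e/2"
        by (rule power2_le_imp_le) (use \<open>0 < e\<close> in auto)
      then show ?thesis using \<open>0 < e\<close> by (simp add: norm_minus_commute)
    qed
    then show "\<exists>N. \<forall>n\<ge>N. norm (X n - Abs_ell2 f) < e" by blast
  qed
  then show "convergent X" by (rule convergentI)
qed

instantiation ell2 :: (type) chilbert_space
begin

lift_definition scaleC_ell2 :: "complex \<Rightarrow> 'a ell2 \<Rightarrow> 'a ell2" is "\<lambda>c f i. c * f i"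
  by (rule ell2_scale_summable)

definition cinner_ell2 :: "'a ell2 \<Rightarrow> 'a ell2 \<Rightarrow> complex" where
  "cinner_ell2 x y = (\<Sum>\<^sub>\<infinity>i. cnj (ell2_nth x i) * ell2_nth y i)"

instance
proof
  fix x y z :: "'a ell2" and c d :: complex and r :: real
  show "c *\<^sub>C (x + y) = c *\<^sub>C x + c *\<^sub>C y" by transfer (simp add: algebra_simps)
  show "(c + d) *\<^sub>C x = c *\<^sub>C x + d *\<^sub>C x" by transfer (simp add: algebra_simps)
  show "c *\<^sub>C d *\<^sub>C x = (c * d) *\<^sub>C x" by transfer (simp add: algebra_simps)
  show "r *\<^sub>R x = complex_of_real r *\<^sub>C x" by transfer simp
  show "cinner x y = cnj (cinner y x)"
    unfolding cinner_ell2_def by (simp add: mult.commute flip: infsum_cnj)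
  show "cinner x (y + z) = cinner x y + cinner x z"
    unfolding cinner_ell2_def plus_ell2.rep_eq
    by (simp add: ring_distribs infsum_add ell2_product_summable[OF ell2_nth_summable ell2_nth_summable])
  show "cinner x (c *\<^sub>C y) = c * cinner x y"
    unfolding cinner_ell2_def scaleC_ell2.rep_eq
    by (simp add: mult.left_commute infsum_cmult_right')
  show "inner x y = Re (cinner x y)" by (simp add: cinner_ell2_def inner_ell2_def)
qed

end

section \<open>Tensor products of Hilbert spaces\<close>

text \<open>
  With orthonormal bases of the two ambient spaces chosen once and for all, the vector \<open>x \<otimes> y\<close> is
  given by its coordinates (square-summable by Bessel), so that by Parseval
  \<open>cinner (x \<otimes> y) (x' \<otimes> y') = cinner x x' * cinner y y'\<close>. The Hilbert space tensor product of
  \<open>S\<close> and \<open>T\<close> is the closed linear span of their elementary tensors.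
\<close>

definition tensor_vec :: "'a::chilbert_space \<Rightarrow> 'b::chilbert_space \<Rightarrow> ('a \<times> 'b) ell2" where
  "tensor_vec x y = Abs_ell2 (\<lambda>(e, f).
     if e \<in> some_onb UNIV \<and> f \<in> some_onb UNIV then cinner e x * cinner f y else 0)"

definition tensor_space ::
    "'a::chilbert_space set \<Rightarrow> 'b::chilbert_space set \<Rightarrow> ('a \<times> 'b) ell2 set" where
  "tensor_space S T = closed_csubspace hull {tensor_vec x y | x y. x \<in> S \<and> y \<in> T}"

section \<open>Bounded operators\<close>

text \<open>
  Operators on the Hilbert space \<open>S\<close> are functions on \<open>S\<close>, made \<open>undefined\<close> outside \<open>S\<close>.
  Hence the identity is \<open>\<lambda>x\<in>S. x\<close> and the product of \<open>a\<close> and \<open>b\<close> is \<open>compose S a b\<close>.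
\<close>

definition bounded_op :: "'a::chilbert_space set \<Rightarrow> ('a \<Rightarrow> 'a) set" where
  "bounded_op S = {a \<in> S \<rightarrow>\<^sub>E S.
     (\<forall>x\<in>S. \<forall>y\<in>S. a (x + y) = a x + a y) \<and> (\<forall>c. \<forall>x\<in>S. a (c *\<^sub>C x) = c *\<^sub>C a x) \<and>
     (\<exists>K. \<forall>x\<in>S. norm (a x) \<le> K * norm x)}"

definition adj_op :: "'a::chilbert_space set \<Rightarrow> ('a \<Rightarrow> 'a) \<Rightarrow> ('a \<Rightarrow> 'a)" where
  "adj_op S a = (THE b. b \<in> bounded_op S \<and> (\<forall>x\<in>S. \<forall>y\<in>S. cinner (b x) y = cinner x (a y)))"

definition tensor_op ::
    "'a::chilbert_space set \<Rightarrow> 'b::chilbert_space set \<Rightarrow> ('a \<Rightarrow> 'a) \<Rightarrow> ('b \<Rightarrow> 'b) \<Rightarrow>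
     (('a \<times> 'b) ell2 \<Rightarrow> ('a \<times> 'b) ell2)" where
  "tensor_op S T a b = (THE c. c \<in> bounded_op (tensor_space S T) \<and>
     (\<forall>x\<in>S. \<forall>y\<in>T. c (tensor_vec x y) = tensor_vec (a x) (b y)))"

section \<open>The weak* topology\<close>

text \<open>
  The space of bounded operators on \<open>S\<close> is the dual of the trace class operators under the pairing
  \<open>(t, a) \<mapsto> tr (t a)\<close>. Trace class operators are the products of two Hilbert-Schmidt operators.
\<close>

definition hilbert_schmidt :: "'a::chilbert_space set \<Rightarrow> ('a \<Rightarrow> 'a) set" where
  "hilbert_schmidt S = {a \<in> bounded_op S. (\<lambda>e. (norm (a e))\<^sup>2) summable_on some_onb S}"

definition trace_class :: "'a::chilbert_space set \<Rightarrow> ('a \<Rightarrow> 'a) set" where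
  "trace_class S = {compose S a b | a b. a \<in> hilbert_schmidt S \<and> b \<in> hilbert_schmidt S}"

definition trace :: "'a::chilbert_space set \<Rightarrow> ('a \<Rightarrow> 'a) \<Rightarrow> complex" where
  "trace S t = (\<Sum>\<^sub>\<infinity>e\<in>some_onb S. cinner e (t e))"

definition weak_star_topology :: "'a::chilbert_space set \<Rightarrow> ('a \<Rightarrow> 'a) topology" where
  "weak_star_topology S = topology_generated_by
     {{a \<in> bounded_op S. trace S (compose S t a) \<in> U} | t U. t \<in> trace_class S \<and> open U}"

section \<open>Quantum registers\<close>

definition register ::
    "'a::chilbert_space set \<Rightarrow> 'b::chilbert_space set \<Rightarrow> (('a \<Rightarrow> 'a) \<Rightarrow> ('b \<Rightarrow> 'b)) \<Rightarrow> bool" where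
  "register A B F \<longleftrightarrow>
     F \<in> bounded_op A \<rightarrow> bounded_op B \<and>
     (\<forall>a\<in>bounded_op A. \<forall>b\<in>bounded_op A. F (\<lambda>x\<in>A. a x + b x) = (\<lambda>y\<in>B. F a y + F b y)) \<and>
     (\<forall>c. \<forall>a\<in>bounded_op A. F (\<lambda>x\<in>A. c *\<^sub>C a x) = (\<lambda>y\<in>B. c *\<^sub>C F a y)) \<and>
     continuous_map (weak_star_topology A) (weak_star_topology B) F \<and>
     F (\<lambda>x\<in>A. x) = (\<lambda>y\<in>B. y) \<and>
     (\<forall>a\<in>bounded_op A. \<forall>b\<in>bounded_op A. F (compose A a b) = compose B (F a) (F b)) \<and>
     (\<forall>a\<in>bounded_op A. F (adj_op A a) = adj_op B (F a))"

definition iso_register ::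
    "'a::chilbert_space set \<Rightarrow> 'b::chilbert_space set \<Rightarrow> (('a \<Rightarrow> 'a) \<Rightarrow> ('b \<Rightarrow> 'b)) \<Rightarrow> bool" where
  "iso_register A B F \<longleftrightarrow> register A B F \<and>
     (\<exists>G. register B A G \<and> (\<forall>b\<in>bounded_op B. F (G b) = b) \<and> (\<forall>a\<in>bounded_op A. G (F a) = a))"

definition compatible ::
    "'a::chilbert_space set \<Rightarrow> 'b::chilbert_space set \<Rightarrow> 'c::chilbert_space set \<Rightarrow>
     (('a \<Rightarrow> 'a) \<Rightarrow> ('c \<Rightarrow> 'c)) \<Rightarrow> (('b \<Rightarrow> 'b) \<Rightarrow> ('c \<Rightarrow> 'c)) \<Rightarrow> bool" where
  "compatible A B C F G \<longleftrightarrow> register A C F \<and> register B C G \<and>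
     (\<forall>a\<in>bounded_op A. \<forall>b\<in>bounded_op B. compose C (F a) (G b) = compose C (G b) (F a))"

definition is_pair ::
    "'a::chilbert_space set \<Rightarrow> 'b::chilbert_space set \<Rightarrow> 'c::chilbert_space set \<Rightarrow>
     (('a \<Rightarrow> 'a) \<Rightarrow> ('c \<Rightarrow> 'c)) \<Rightarrow> (('b \<Rightarrow> 'b) \<Rightarrow> ('c \<Rightarrow> 'c)) \<Rightarrow>
     ((('a \<times> 'b) ell2 \<Rightarrow> ('a \<times> 'b) ell2) \<Rightarrow> ('c \<Rightarrow> 'c)) \<Rightarrow> bool" where
  "is_pair A B C F G P \<longleftrightarrow> register (tensor_space A B) C P \<and>
     (\<forall>a\<in>bounded_op A. \<forall>b\<in>bounded_op B. P (tensor_op A B a b) = compose C (F a) (G b))"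

text \<open>
  The definite description of the pair \<open>(F; G)\<close> is spelled out: \<open>P\<close> is the only register
  (as a map on bounded operators) with the pairing property.
\<close>

definition complements ::
    "'a::chilbert_space set \<Rightarrow> 'b::chilbert_space set \<Rightarrow> 'c::chilbert_space set \<Rightarrow>
     (('a \<Rightarrow> 'a) \<Rightarrow> ('c \<Rightarrow> 'c)) \<Rightarrow> (('b \<Rightarrow> 'b) \<Rightarrow> ('c \<Rightarrow> 'c)) \<Rightarrow> bool" where
  "complements A B C F G \<longleftrightarrow> compatible A B C F G \<and>
     (\<exists>P. is_pair A B C F G P \<and>
        (\<forall>Q. is_pair A B C F G Q \<longrightarrow> (\<forall>x\<in>bounded_op (tensor_space A B). Q x = P x)) \<and>
        iso_register (tensor_space A B) C P)"

definition equivalent_registers ::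
    "'c::chilbert_space set \<Rightarrow> 'd::chilbert_space set \<Rightarrow>
     (('c \<Rightarrow> 'c) \<Rightarrow> ('b \<Rightarrow> 'b)) \<Rightarrow> (('d \<Rightarrow> 'd) \<Rightarrow> ('b \<Rightarrow> 'b)) \<Rightarrow> bool" where
  "equivalent_registers C D G H \<longleftrightarrow>
     (\<exists>I. iso_register D C I \<and> (\<forall>d\<in>bounded_op D. G (I d) = H d))"

end

theory Submission
  imports Defs
begin

text \<open>
  A register \<open>F\<close> turns the matrix units \<open>|x\<rangle>\<langle>e|\<close> of \<open>A\<close>, for a fixed unit vector \<open>e\<close>, into operators on
  \<open>B\<close>. With \<open>C\<close> the range of the projection \<open>F |e\<rangle>\<langle>e|\<close>, the map \<open>x \<otimes> c \<mapsto> F |x\<rangle>\<langle>e| c\<close> is isometric, and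
  normality of \<open>F\<close> makes its range total, because the finite partial sums of the diagonal matrix
  units converge weak* to the identity. Under the resulting unitary \<open>A \<otimes> C \<cong> B\<close> the register \<open>F\<close> becomes
  \<open>a \<mapsto> a \<otimes> 1\<close>, so \<open>c \<mapsto> 1 \<otimes> c\<close> is a complement. Conversely, the range of any complement of \<open>F\<close> is the
  commutant of the range of \<open>F\<close>, so two complements \<open>G\<close> and \<open>H\<close> differ by \<open>G\<^sup>-\<^sup>1 \<circ> H\<close>.
\<close>

section \<open>Hilbert spaces\<close>

text \<open>The obstacle throughout is normality: each map constructed as a register, including the
  equivalence in the uniqueness part, has to be shown weak* continuous. This rests on one
  description: the functionals in play are
  \<open>a \<mapsto> \<Sum>n. \<langle>u n, a (v n)\<rangle>\<close> for square-summable families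
  \<open>u\<close> and \<open>v\<close>, and a map is normal as soon as it pulls such a functional
  back to one of the same form. Hence maps are given by explicit formulas that act on the vectors of
  a family, and \<open>G\<^sup>-\<^sup>1 \<circ> H\<close> is written as a compression of
  \<open>(F;G)\<^sup>-\<^sup>1 \<circ> H\<close>, a composite of normal maps. The tensor product
  enters only through an axiomatic description, a total family of vectors whose inner products
  factorise. The concrete tensor product and the vectors \<open>F |x\<rangle>\<langle>e| c\<close>
  both satisfy it, and any two such descriptions are joined by a unitary.\<close>

instance chilbert_space \<subseteq> banach ..

section \<open>Scalar multiplication and the inner product\<close>

lemma scaleC_one [simp]: "1 *\<^sub>C x = x"
  using scaleR_scaleC[of 1 x] by simp

lemma scaleC_zero_left [simp]: "0 *\<^sub>C x = 0"
  using scaleR_scaleC[of 0 x] by simp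

lemma scaleC_zero_right [simp]: "c *\<^sub>C 0 = 0"
  using scaleC_add_right[of c 0 0] by simp

lemma scaleC_minus_one [simp]: "(-1) *\<^sub>C x = - x"
  using scaleR_scaleC[of "-1" x] by simp

lemma scaleC_minus_right: "c *\<^sub>C (- x) = - (c *\<^sub>C x)"
  using scaleC_add_right[of c x "- x"] by (simp add: eq_neg_iff_add_eq_0 add.commute)

lemma scaleC_diff_right: "c *\<^sub>C (x - y) = c *\<^sub>C x - c *\<^sub>C y"
  using scaleC_add_right[of c x "- y"] by (simp add: scaleC_minus_right)

lemma cinner_add_left: "cinner (x + y) z = cinner x z + cinner y z"
  by (metis cinner_commute cinner_add_right complex_cnj_add)

lemma cinner_scaleC_left: "cinner (c *\<^sub>C x) y = cnj c * cinner x y"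
  by (metis cinner_commute cinner_scaleC_right complex_cnj_mult)

lemma cinner_zero_right [simp]: "cinner x 0 = 0"
  using cinner_scaleC_right[of x 0 0] by simp

lemma cinner_zero_left [simp]: "cinner 0 x = 0"
  using cinner_scaleC_left[of 0 0 x] by simp

lemma cinner_minus_right: "cinner x (- y) = - cinner x y"
  using cinner_scaleC_right[of x "-1" y] by simp

lemma cinner_minus_left: "cinner (- x) y = - cinner x y"
  using cinner_scaleC_left[of "-1" x y] by simp

lemma cinner_diff_right: "cinner x (y - z) = cinner x y - cinner x z"
  using cinner_add_right[of x y "- z"] by (simp add: cinner_minus_right)

lemma cinner_diff_left: "cinner (x - y) z = cinner x z - cinner y z"
  using cinner_add_left[of x "- y" z] by (simp add: cinner_minus_left)

lemmas cinner_simps = cinner_add_left cinner_add_right cinner_scaleC_left cinner_scaleC_right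
  cinner_diff_left cinner_diff_right cinner_minus_left cinner_minus_right

lemma cinner_self: "cinner x x = complex_of_real ((norm x)\<^sup>2)"
proof (rule complex_eqI)
  show "Re (cinner x x) = Re (complex_of_real ((norm x)\<^sup>2))"
    by (simp only: Re_complex_of_real power2_norm_eq_inner inner_eq_Re_cinner)
  have "Im (cinner x x) = Im (cnj (cinner x x))"
    using cinner_commute[of x x] by simp
  then show "Im (cinner x x) = Im (complex_of_real ((norm x)\<^sup>2))" by simp
qed

lemma cinner_self_eq_0 [simp]: "cinner x x = 0 \<longleftrightarrow> x = 0"
  by (simp add: cinner_self)

lemma cinner_eq_flip: "cinner x y = cinner x' y' \<longleftrightarrow> cinner y x = cinner y' x'"
  by (metis cinner_commute)

lemma cinner_eq_0_flip: "cinner x y = 0 \<longleftrightarrow> cinner y x = 0"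
  by (metis cinner_commute complex_cnj_zero_iff)

text \<open>Passes to the real notion of orthogonality, for which
  \<open>norm_sum_Pythagorean\<close> is stated.\<close>

lemma orthogonal_if_cinner: "cinner x y = 0 \<Longrightarrow> orthogonal x y"
  by (simp add: orthogonal_def inner_eq_Re_cinner)

lemma cmod_cinner_flip: "cmod (cinner x y) = cmod (cinner y x)"
  by (metis cinner_commute complex_mod_cnj)

lemma norm_scaleC [simp]: "norm (c *\<^sub>C x) = cmod c * norm x"
proof -
  have "complex_of_real ((norm (c *\<^sub>C x))\<^sup>2) = (cnj c * c) * cinner x x"
    by (simp only: cinner_self[symmetric] cinner_scaleC_left cinner_scaleC_right mult.assoc mult.left_commute)
  also have "\<dots> = complex_of_real ((cmod c * norm x)\<^sup>2)"
    by (simp only: cinner_self complex_norm_square[of c] power_mult_distrib of_real_mult mult.commute[of "cnj c"])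
  finally have "(norm (c *\<^sub>C x))\<^sup>2 = (cmod c * norm x)\<^sup>2"
    by (simp only: of_real_eq_iff)
  then show ?thesis by (simp add: power2_eq_iff_nonneg)
qed

lemma cmod_cinner_le: "cmod (cinner x y) \<le> norm x * norm y"
proof (cases "cinner x y = 0")
  case False
  \<comment> \<open>The phase that makes \<open>c * cinner x y\<close> real and nonnegative, so that
    the real Cauchy-Schwarz inequality for \<open>inner\<close> applies to \<open>x\<close> and
    \<open>c *\<^sub>C y\<close>.\<close>
  define c where "c = cnj (sgn (cinner x y))"
  have c: "cmod c = 1" using False by (simp add: c_def norm_sgn)
  have "c * cinner x y = cmod (cinner x y)"
    using False
    by (simp add: c_def sgn_eq complex_norm_square[symmetric] power2_eq_square mult.commute)
  then have "cmod (cinner x y) = Re (cinner x (c *\<^sub>C y))"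
    by (simp add: cinner_simps)
  also have "\<dots> \<le> norm x * norm (c *\<^sub>C y)"
    using norm_cauchy_schwarz[of x "c *\<^sub>C y"] by (simp only: inner_eq_Re_cinner)
  finally show ?thesis using c by simp
qed simp

lemma bounded_linear_cinner_right: "bounded_linear (cinner x)"
  by (rule bounded_linear_intro[where K = "norm x"])
    (simp_all add: cinner_simps scaleR_scaleC scaleR_conv_of_real cmod_cinner_le mult.commute[of _ "norm x"])

lemma bounded_linear_cinner_left: "bounded_linear (\<lambda>x. cinner x y)"
  by (rule bounded_linear_intro[where K = "norm y"])
    (simp_all add: cinner_simps scaleR_scaleC scaleR_conv_of_real cmod_cinner_le)

lemmas has_sum_cinner_right = has_sum_bounded_linear[OF bounded_linear_cinner_right]
lemmas has_sum_cinner_left = has_sum_bounded_linear[OF bounded_linear_cinner_left]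

lemma cinner_sum_left: "cinner (sum f I) x = (\<Sum>i\<in>I. cinner (f i) x)"
  by (rule linear_sum) (rule bounded_linear.linear[OF bounded_linear_cinner_left])

section \<open>Closed complex subspaces\<close>

lemma closed_csubspace_zero: "closed_csubspace S \<Longrightarrow> 0 \<in> S"
  and closed_csubspace_add: "closed_csubspace S \<Longrightarrow> x \<in> S \<Longrightarrow> y \<in> S \<Longrightarrow> x + y \<in> S"
  and closed_csubspace_scaleC: "closed_csubspace S \<Longrightarrow> x \<in> S \<Longrightarrow> c *\<^sub>C x \<in> S"
  and closed_csubspace_closed: "closed_csubspace S \<Longrightarrow> closed S"
  by (auto simp: closed_csubspace_def)

lemma closed_csubspace_minus: "closed_csubspace S \<Longrightarrow> x \<in> S \<Longrightarrow> - x \<in> S"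
  using closed_csubspace_scaleC[of S x "-1"] by simp

lemma closed_csubspace_diff: "closed_csubspace S \<Longrightarrow> x \<in> S \<Longrightarrow> y \<in> S \<Longrightarrow> x - y \<in> S"
  using closed_csubspace_add[of S x "- y"] closed_csubspace_minus[of S y] by simp

lemma closed_csubspace_sum:
  "closed_csubspace S \<Longrightarrow> (\<And>i. i \<in> I \<Longrightarrow> f i \<in> S) \<Longrightarrow> sum f I \<in> S"
  by (induction I rule: infinite_finite_induct)
    (auto simp: closed_csubspace_zero closed_csubspace_add)

lemmas csubspace_intros = closed_csubspace_zero closed_csubspace_add closed_csubspace_scaleC
  closed_csubspace_minus closed_csubspace_diff closed_csubspace_sum

lemma closed_csubspace_UNIV: "closed_csubspace UNIV"
  by (simp add: closed_csubspace_def)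

lemma closed_csubspace_has_sum:
  assumes "closed_csubspace S" "(f has_sum x) I" "\<And>i. i \<in> I \<Longrightarrow> f i \<in> S"
  shows "x \<in> S"
proof (rule Lim_in_closed_set)
  show "(sum f \<longlongrightarrow> x) (finite_subsets_at_top I)" using assms(2) by (simp add: has_sum_def)
  show "\<forall>\<^sub>F F in finite_subsets_at_top I. sum f F \<in> S"
    by (rule eventually_finite_subsets_at_top_weakI) (use assms in \<open>auto intro!: csubspace_intros\<close>)
qed (use assms in \<open>auto simp: closed_csubspace_closed\<close>)

section \<open>Orthogonal series\<close>

lemma orthogonal_summable:
  fixes z :: "'i \<Rightarrow> 'a::chilbert_space"
  assumes orth: "\<And>i j. i \<in> I \<Longrightarrow> j \<in> I \<Longrightarrow> i \<noteq> j \<Longrightarrow> cinner (z i) (z j) = 0"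
    and sum: "(\<lambda>i. (norm (z i))\<^sup>2) summable_on I"
  shows "z summable_on I"
proof -
  let ?q = "\<lambda>F. \<Sum>i\<in>F. (norm (z i))\<^sup>2"
  have pyth: "(norm (sum z F))\<^sup>2 = ?q F" if "finite F" "F \<subseteq> I" for F
    by (rule norm_sum_Pythagorean) (use that orth in \<open>auto simp: pairwise_def subset_iff intro!: orthogonal_if_cinner\<close>)
  obtain s where s: "(?q \<longlongrightarrow> s) (finite_subsets_at_top I)"
    using sum unfolding summable_on_def has_sum_def by blast
  have "\<exists>P. eventually P (finite_subsets_at_top I) \<and>
           (\<forall>F F'. P F \<and> P F' \<longrightarrow> dist (sum z F) (sum z F') < e)" if "e > 0" for e
  proof -
    \<comment> \<open>By Pythagoras the squared distance of two nested partial sums is the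
      difference of their values of \<open>?q\<close>. Two values within
      \<open>(e/2)\<^sup>2 / 2\<close> of \<open>s\<close> differ by less than
      \<open>(e/2)\<^sup>2\<close>, so the partial sum over \<open>F\<close> lies within
      \<open>e/2\<close> of that over \<open>F0\<close>, and two such sums within \<open>e\<close>
      of each other.\<close>
    have "\<forall>\<^sub>F F in finite_subsets_at_top I. dist (?q F) s < (e/2)\<^sup>2 / 2"
      by (rule tendstoD[OF s]) (use \<open>e > 0\<close> in simp)
    then obtain F0 where F0: "finite F0" "F0 \<subseteq> I"
      and close: "\<And>F. finite F \<Longrightarrow> F0 \<subseteq> F \<Longrightarrow> F \<subseteq> I \<Longrightarrow> dist (?q F) s < (e/2)\<^sup>2 / 2"
      unfolding eventually_finite_subsets_at_top by metis
    have near: "dist (sum z F) (sum z F0) < e/2" if "finite F" "F0 \<subseteq> F" "F \<subseteq> I" for F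
    proof -
      have "dist (?q F) (?q F0) < (e/2)\<^sup>2"
        using dist_triangle_half_l[of "?q F" s "(e/2)\<^sup>2" "?q F0"] close[of F] close[of F0] that F0
        by (simp add: dist_commute)
      moreover have "?q (F - F0) = ?q F - ?q F0"
        using that by (simp add: sum_diff)
      moreover have "(norm (sum z F - sum z F0))\<^sup>2 = ?q (F - F0)"
        using pyth[of "F - F0"] that by (simp add: sum_diff subset_iff)
      ultimately have "(norm (sum z F - sum z F0))\<^sup>2 < (e/2)\<^sup>2"
        unfolding dist_real_def by linarith
      then show ?thesis
        unfolding dist_norm by (rule power2_less_imp_less) (use \<open>e > 0\<close> in simp)
    qed
    show ?thesis
    proof (intro exI conjI allI impI)
      show "\<forall>\<^sub>F F in finite_subsets_at_top I. finite F \<and> F0 \<subseteq> F \<and> F \<subseteq> I"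
        unfolding eventually_finite_subsets_at_top using F0 by (intro exI[of _ F0]) simp
      fix F F' assume "(finite F \<and> F0 \<subseteq> F \<and> F \<subseteq> I) \<and> finite F' \<and> F0 \<subseteq> F' \<and> F' \<subseteq> I"
      then show "dist (sum z F) (sum z F') < e"
        using near[of F] near[of F'] dist_triangle_half_l[of "sum z F" "sum z F0" e "sum z F'"]
        by (simp add: dist_commute)
    qed
  qed
  then have "cauchy_filter (filtermap (sum z) (finite_subsets_at_top I))"
    by (simp add: cauchy_filter_metric_filtermap)
  moreover have "complete (UNIV :: 'a set)"
    by (meson Cauchy_convergent UNIV_I complete_def convergent_def)
  ultimately obtain l where "(sum z \<longlongrightarrow> l) (finite_subsets_at_top I)"
    using complete_uniform[where S = "UNIV :: 'a set"] by (force simp add: filterlim_def)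
  then show ?thesis
    using summable_on_def has_sum_def by blast
qed

text \<open>Pythagoras for finite partial sums passes to the limit by continuity of the norm.
  Parseval's identity comes from here, both for bases and for slices.\<close>

lemma has_sum_norm_orthogonal:
  fixes z :: "'i \<Rightarrow> 'a::chilbert_space"
  assumes orth: "\<And>i j. i \<in> I \<Longrightarrow> j \<in> I \<Longrightarrow> i \<noteq> j \<Longrightarrow> cinner (z i) (z j) = 0"
    and sum: "(z has_sum y) I"
  shows "((\<lambda>i. (norm (z i))\<^sup>2) has_sum (norm y)\<^sup>2) I"
proof -
  have "((\<lambda>F. (norm (sum z F))\<^sup>2) \<longlongrightarrow> (norm y)\<^sup>2) (finite_subsets_at_top I)"
    using sum unfolding has_sum_def by (intro tendsto_intros)
  moreover have "\<forall>\<^sub>F F in finite_subsets_at_top I. (norm (sum z F))\<^sup>2 = (\<Sum>i\<in>F. (norm (z i))\<^sup>2)"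
    by (intro eventually_finite_subsets_at_top_weakI norm_sum_Pythagorean)
      (use orth in \<open>auto simp: pairwise_def subset_iff intro!: orthogonal_if_cinner\<close>)
  ultimately show ?thesis
    unfolding has_sum_def by (rule Lim_transform_eventually)
qed

section \<open>Orthonormal bases, Bessel and Parseval\<close>

lemma is_onb_exists:
  assumes S: "closed_csubspace S"
  shows "\<exists>E. is_onb S E"
proof -
  define \<A> where "\<A> = {E. E \<subseteq> S \<and> (\<forall>e\<in>E. norm e = 1) \<and> (\<forall>e\<in>E. \<forall>f\<in>E. e \<noteq> f \<longrightarrow> cinner e f = 0)}"
  have "\<exists>M\<in>\<A>. \<forall>X\<in>\<A>. M \<subseteq> X \<longrightarrow> X = M"
  proof (rule subset_Zorn')
    fix \<C> assume "subset.chain \<A> \<C>"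
    then have C: "\<And>X. X \<in> \<C> \<Longrightarrow> X \<in> \<A>" and tot: "\<And>X Y. X \<in> \<C> \<Longrightarrow> Y \<in> \<C> \<Longrightarrow> X \<subseteq> Y \<or> Y \<subseteq> X"
      by (auto simp: subset_chain_def)
    have "cinner e f = 0" if "e \<in> X" "X \<in> \<C>" "f \<in> Y" "Y \<in> \<C>" "e \<noteq> f" for e f X Y
      using tot[of X Y] C[of X] C[of Y] that by (auto simp: \<A>_def)
    moreover have "X \<subseteq> S" "\<forall>e\<in>X. norm e = 1" if "X \<in> \<C>" for X
      using C[OF that] by (auto simp: \<A>_def)
    ultimately show "\<Union>\<C> \<in> \<A>" unfolding \<A>_def by blast
  qed
  then obtain M where M: "M \<in> \<A>" and max: "\<And>X. X \<in> \<A> \<Longrightarrow> M \<subseteq> X \<Longrightarrow> X = M"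
    by (elim bexE) blast
  \<comment> \<open>Totality is maximality: a nonzero vector orthogonal to \<open>M\<close> could be
    normalised and added to \<open>M\<close>.\<close>
  have "x = 0" if x: "x \<in> S" "\<forall>e\<in>M. cinner e x = 0" for x
  proof (rule ccontr)
    assume "x \<noteq> 0"
    define y where "y = complex_of_real (inverse (norm x)) *\<^sub>C x"
    have y1: "y \<in> S" unfolding y_def by (rule closed_csubspace_scaleC[OF S x(1)])
    have y2: "norm y = 1" using \<open>x \<noteq> 0\<close> by (simp only: y_def norm_scaleC norm_of_real) simp
    have y3: "\<forall>e\<in>M. cinner e y = 0" using x(2) by (simp add: y_def cinner_scaleC_right)
    have "\<And>e. e \<in> M \<Longrightarrow> cinner y e = 0" using y3 cinner_commute by (metis complex_cnj_zero)
    then have "insert y M \<in> \<A>"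
      using M y1 y2 y3 by (auto simp: \<A>_def)
    then have "y \<in> M" using max[of "insert y M"] by auto
    then have "y = 0" using y3 by auto
    then show False using y2 by simp
  qed
  then have "is_onb S M" using M by (auto simp: is_onb_def \<A>_def)
  then show ?thesis ..
qed

lemma is_onb_some_onb: "closed_csubspace S \<Longrightarrow> is_onb S (some_onb S)"
  unfolding some_onb_def by (rule someI_ex) (rule is_onb_exists)

lemma is_onb_subset: "is_onb S E \<Longrightarrow> e \<in> E \<Longrightarrow> e \<in> S"
  and is_onb_norm: "is_onb S E \<Longrightarrow> e \<in> E \<Longrightarrow> norm e = 1"
  and is_onb_total: "is_onb S E \<Longrightarrow> x \<in> S \<Longrightarrow> (\<And>e. e \<in> E \<Longrightarrow> cinner e x = 0) \<Longrightarrow> x = 0"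
  by (auto simp: is_onb_def)

lemma is_onb_cinner: "is_onb S E \<Longrightarrow> e \<in> E \<Longrightarrow> f \<in> E \<Longrightarrow> cinner e f = (if e = f then 1 else 0)"
  by (auto simp: is_onb_def cinner_self)

lemma is_onb_eqI:
  assumes "is_onb S E" "closed_csubspace S" "x \<in> S" "y \<in> S"
    and "\<And>e. e \<in> E \<Longrightarrow> cinner e x = cinner e y"
  shows "x = y"
  using is_onb_total[of S E "x - y"] assms by (simp add: cinner_simps csubspace_intros)

text \<open>The projection \<open>y\<close> of \<open>x\<close> onto the span of \<open>M\<close>
  satisfies \<open>(norm y)\<^sup>2 = cinner y x\<close>, and Cauchy-Schwarz then gives
  \<open>norm y \<le> norm x\<close>. The same argument with coefficients in \<open>C\<close> proves
  \<open>slice_bessel\<close>.\<close>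

lemma bessel:
  assumes E: "is_onb S E" and M: "finite M" "M \<subseteq> E"
  shows "(\<Sum>e\<in>M. (cmod (cinner e x))\<^sup>2) \<le> (norm x)\<^sup>2"
proof -
  define y where "y = (\<Sum>e\<in>M. cinner e x *\<^sub>C e)"
  let ?s = "\<Sum>e\<in>M. (cmod (cinner e x))\<^sup>2"
  have "(norm y)\<^sup>2 = (\<Sum>e\<in>M. (norm (cinner e x *\<^sub>C e))\<^sup>2)"
    unfolding y_def
    by (rule norm_sum_Pythagorean)
      (use M in \<open>auto simp: pairwise_def subset_iff cinner_simps is_onb_cinner[OF E]
        intro!: orthogonal_if_cinner\<close>)
  then have ny: "(norm y)\<^sup>2 = ?s"
    using M by (auto simp: is_onb_norm[OF E] subset_iff intro!: sum.cong)
  have "cinner y x = (\<Sum>e\<in>M. cnj (cinner e x) * cinner e x)"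
    by (simp add: y_def cinner_sum_left cinner_simps)
  also have "\<dots> = complex_of_real ?s"
    unfolding of_real_sum by (simp only: complex_norm_square mult.commute)
  finally have yx: "cinner y x = complex_of_real ?s" .
  have "(norm y)\<^sup>2 = cmod (complex_of_real ((norm y)\<^sup>2))"
    by (simp add: norm_power)
  also have "\<dots> = cmod (cinner y x)" by (simp only: yx ny)
  also have "\<dots> \<le> norm y * norm x" by (rule cmod_cinner_le)
  finally have "norm y * norm y \<le> norm y * norm x" by (simp add: power2_eq_square)
  then have "norm y \<le> norm x" by (cases "y = 0") auto
  then have "(norm y)\<^sup>2 \<le> (norm x)\<^sup>2" by (simp add: power_mono)
  with ny show ?thesis by simp
qed

lemma bessel_summable:
  "is_onb S E \<Longrightarrow> (\<lambda>e. (cmod (cinner e x))\<^sup>2) summable_on E"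
  by (rule nonneg_bdd_above_summable_on)
    (auto intro!: bdd_aboveI2[where M = "(norm x)\<^sup>2"] bessel)

lemma onb_series_summable:
  assumes E: "is_onb S E" and sum: "(\<lambda>e. (cmod (c e))\<^sup>2) summable_on E"
  shows "(\<lambda>e. c e *\<^sub>C e) summable_on E"
proof (rule orthogonal_summable)
  show "(\<lambda>e. (norm (c e *\<^sub>C e))\<^sup>2) summable_on E"
    using sum by (rule summable_on_cong[THEN iffD1, rotated]) (simp add: is_onb_norm[OF E])
qed (simp add: cinner_simps is_onb_cinner[OF E])

lemma onb_series_coeff:
  assumes E: "is_onb S E" and "e \<in> E" and sum: "((\<lambda>e. c e *\<^sub>C e) has_sum y) E"
  shows "cinner e y = c e"
proof -
  have "((\<lambda>f. cinner e (c f *\<^sub>C f)) has_sum cinner e y) E"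
    by (rule has_sum_cinner_right[OF sum])
  moreover have "((\<lambda>f. cinner e (c f *\<^sub>C f)) has_sum c e) E"
    by (rule has_sum_finite_neutralI[of "{e}"])
      (use \<open>e \<in> E\<close> in \<open>auto simp: cinner_simps is_onb_cinner[OF E]\<close>)
  ultimately show ?thesis by (rule has_sum_unique)
qed

text \<open>Bessel makes the series converge to some vector of \<open>S\<close>; that vector has the
  same coefficients as \<open>x\<close>, so the two agree by totality.\<close>

lemma onb_expansion:
  assumes S: "closed_csubspace S" and E: "is_onb S E" and x: "x \<in> S"
  shows "((\<lambda>e. cinner e x *\<^sub>C e) has_sum x) E"
proof -
  obtain y where y: "((\<lambda>e. cinner e x *\<^sub>C e) has_sum y) E"
    using onb_series_summable[OF E bessel_summable[OF E, of x]] by (auto simp: summable_on_def)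
  have "y \<in> S"
    by (rule closed_csubspace_has_sum[OF S y]) (simp add: S csubspace_intros is_onb_subset[OF E])
  then have "y = x"
    using onb_series_coeff[OF E _ y] x by (intro is_onb_eqI[OF E S]) auto
  with y show ?thesis by simp
qed

lemma parseval_cinner:
  assumes S: "closed_csubspace S" and E: "is_onb S E" and x: "x \<in> S"
  shows "((\<lambda>e. cinner y e * cinner e x) has_sum cinner y x) E"
  using has_sum_cinner_right[OF onb_expansion[OF assms], of y]
  by (simp add: cinner_simps mult.commute)

lemma parseval:
  assumes S: "closed_csubspace S" and E: "is_onb S E" and x: "x \<in> S"
  shows "((\<lambda>e. (cmod (cinner e x))\<^sup>2) has_sum (norm x)\<^sup>2) E"
  using has_sum_norm_orthogonal[OF _ onb_expansion[OF assms]] 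
  by (rule has_sum_cong[THEN iffD1, rotated])
    (auto simp: is_onb_norm[OF E] is_onb_cinner[OF E] cinner_simps)

section \<open>Bounded operators\<close>

text \<open>Unlike \<open>bounded_op\<close>, this allows different source and target and prescribes
  nothing outside \<open>S\<close>, as needed for slices, for the intertwining unitaries and for
  composites written as plain functions.\<close>

definition bop :: "'a::chilbert_space set \<Rightarrow> 'b::chilbert_space set \<Rightarrow> ('a \<Rightarrow> 'b) \<Rightarrow> bool" where
  "bop S T a \<longleftrightarrow> (\<forall>x\<in>S. a x \<in> T) \<and> (\<forall>x\<in>S. \<forall>y\<in>S. a (x + y) = a x + a y) \<and>
     (\<forall>c. \<forall>x\<in>S. a (c *\<^sub>C x) = c *\<^sub>C a x) \<and> (\<exists>K. \<forall>x\<in>S. norm (a x) \<le> K * norm x)"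

lemma bopI:
  assumes "\<And>x. x \<in> S \<Longrightarrow> a x \<in> T" "\<And>x y. x \<in> S \<Longrightarrow> y \<in> S \<Longrightarrow> a (x + y) = a x + a y"
    "\<And>c x. x \<in> S \<Longrightarrow> a (c *\<^sub>C x) = c *\<^sub>C a x" "\<And>x. x \<in> S \<Longrightarrow> norm (a x) \<le> K * norm x"
  shows "bop S T a"
  using assms unfolding bop_def by blast

lemma bop_in: "bop S T a \<Longrightarrow> x \<in> S \<Longrightarrow> a x \<in> T"
  and bop_add: "bop S T a \<Longrightarrow> x \<in> S \<Longrightarrow> y \<in> S \<Longrightarrow> a (x + y) = a x + a y"
  and bop_scaleC: "bop S T a \<Longrightarrow> x \<in> S \<Longrightarrow> a (c *\<^sub>C x) = c *\<^sub>C a x"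
  unfolding bop_def by auto

lemma bop_bound:
  assumes "bop S T a"
  shows "\<exists>K\<ge>0. \<forall>x\<in>S. norm (a x) \<le> K * norm x"
proof -
  obtain K where K: "\<forall>x\<in>S. norm (a x) \<le> K * norm x"
    using assms unfolding bop_def by auto
  have "norm (a x) \<le> max K 0 * norm x" if "x \<in> S" for x
    using K that mult_right_mono[of K "max K 0" "norm x"] by force
  then show ?thesis by (intro exI[of _ "max K 0"]) simp
qed

lemma bop_comp:
  assumes a: "bop S T a" and b: "bop R S b"
  shows "bop R T (\<lambda>x. a (b x))"
proof -
  obtain K where K: "K \<ge> 0" "\<forall>x\<in>S. norm (a x) \<le> K * norm x" using bop_bound[OF a] by auto
  obtain L where L: "L \<ge> 0" "\<forall>x\<in>R. norm (b x) \<le> L * norm x" using bop_bound[OF b] by auto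
  show ?thesis
  proof (rule bopI)
    fix x assume x: "x \<in> R"
    have "norm (a (b x)) \<le> K * norm (b x)" using K b x by (simp add: bop_in)
    also have "\<dots> \<le> K * (L * norm x)" using K L x by (simp add: mult_left_mono)
    finally show "norm (a (b x)) \<le> (K * L) * norm x" by (simp add: mult.assoc)
  qed (use bop_in[OF a] bop_in[OF b] bop_add[OF a] bop_add[OF b] bop_scaleC[OF a] bop_scaleC[OF b] in auto)
qed

lemma bop_id: "bop S S (\<lambda>x. x)"
  by (rule bopI[where K = 1]) auto

text \<open>The target is any normed space, so that functionals into the complex numbers in
  \<open>riesz\<close> are covered together with operators.\<close>

lemma has_sum_additive_bounded:
  fixes g :: "'a::chilbert_space \<Rightarrow> 'b::real_normed_vector"
  assumes S: "closed_csubspace S"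
    and add: "\<And>x y. x \<in> S \<Longrightarrow> y \<in> S \<Longrightarrow> g (x + y) = g x + g y"
    and bound: "\<And>x. x \<in> S \<Longrightarrow> norm (g x) \<le> K * norm x"
    and f: "\<And>i. i \<in> I \<Longrightarrow> f i \<in> S" and sum: "(f has_sum x) I"
  shows "((\<lambda>i. g (f i)) has_sum g x) I"
proof -
  have x: "x \<in> S" using closed_csubspace_has_sum[OF S sum f] .
  have g0: "g 0 = 0" using add[of 0 0] closed_csubspace_zero[OF S] by simp
  have gsum: "g (sum f F) = (\<Sum>i\<in>F. g (f i))" if "F \<subseteq> I" for F
    using that
  proof (induction F rule: infinite_finite_induct)
    case (insert i F)
    then have "sum f F \<in> S" using f S by (auto intro!: csubspace_intros)
    with insert f show ?case by (auto simp: add)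
  qed (simp_all add: g0)
  have gdiff: "g y - g z = g (y - z)" if "y \<in> S" "z \<in> S" for y z
    using add[of "y - z" z] that closed_csubspace_diff[OF S] by simp
  have "((\<lambda>F. K * norm (sum f F - x)) \<longlongrightarrow> K * norm (x - x)) (finite_subsets_at_top I)"
    using sum unfolding has_sum_def by (intro tendsto_intros)
  then have "((\<lambda>F. g (sum f F) - g x) \<longlongrightarrow> 0) (finite_subsets_at_top I)"
  proof (rule Lim_null_comparison[rotated, OF tendsto_eq_rhs])
    show "\<forall>\<^sub>F F in finite_subsets_at_top I. norm (g (sum f F) - g x) \<le> K * norm (sum f F - x)"
    proof (rule eventually_finite_subsets_at_top_weakI)
      fix F assume "finite F" "F \<subseteq> I"
      then have "sum f F \<in> S" using f S by (auto intro!: csubspace_intros)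
      then show "norm (g (sum f F) - g x) \<le> K * norm (sum f F - x)"
        using x closed_csubspace_diff[OF S] by (simp add: gdiff bound)
    qed
  qed simp
  then have "((\<lambda>F. g (sum f F)) \<longlongrightarrow> g x) (finite_subsets_at_top I)"
    by (simp add: LIM_zero_iff)
  moreover have "\<forall>\<^sub>F F in finite_subsets_at_top I. g (sum f F) = (\<Sum>i\<in>F. g (f i))"
    by (rule eventually_finite_subsets_at_top_weakI) (rule gsum)
  ultimately show ?thesis unfolding has_sum_def by (rule Lim_transform_eventually)
qed

lemma bop_has_sum:
  assumes "closed_csubspace S" and a: "bop S T a"
    and "\<And>i. i \<in> I \<Longrightarrow> f i \<in> S" and "(f has_sum x) I"
  shows "((\<lambda>i. a (f i)) has_sum a x) I"
proof -
  obtain K where K: "\<forall>x\<in>S. norm (a x) \<le> K * norm x" using bop_bound[OF a] by auto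
  show ?thesis
    by (rule has_sum_additive_bounded[OF assms(1) bop_add[OF a] bspec[OF K] assms(3,4)])
qed

section \<open>Riesz representation and adjoints\<close>

lemma riesz:
  fixes \<phi> :: "'a::chilbert_space \<Rightarrow> complex"
  assumes S: "closed_csubspace S"
    and add: "\<And>x y. x \<in> S \<Longrightarrow> y \<in> S \<Longrightarrow> \<phi> (x + y) = \<phi> x + \<phi> y"
    and scale: "\<And>c x. x \<in> S \<Longrightarrow> \<phi> (c *\<^sub>C x) = c * \<phi> x"
    and bound: "\<And>x. x \<in> S \<Longrightarrow> cmod (\<phi> x) \<le> K * norm x"
  shows "\<exists>z\<in>S. \<forall>x\<in>S. cinner z x = \<phi> x"
proof -
  define E where "E = some_onb S"
  have E: "is_onb S E" unfolding E_def by (rule is_onb_some_onb[OF S])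
  have ES: "e \<in> S" if "e \<in> E" for e using is_onb_subset[OF E that] .
  have "(\<Sum>e\<in>M. (cmod (\<phi> e))\<^sup>2) \<le> K\<^sup>2" if M: "finite M" "M \<subseteq> E" for M
  proof -
    let ?s = "\<Sum>e\<in>M. (cmod (\<phi> e))\<^sup>2"
    \<comment> \<open>A truncation of the representing vector, used to test \<phi> itself:
      \<open>\<phi> x\<close> equals \<open>(norm x)\<^sup>2\<close>, so the bound on \<phi> forces
      \<open>norm x \<le> \<bar>K\<bar>\<close> uniformly in \<open>M\<close>. The absolute value
      appears because \<open>K\<close> may have any sign.\<close>
    define x where "x = (\<Sum>e\<in>M. cnj (\<phi> e) *\<^sub>C e)"
    have "x \<in> S" unfolding x_def using M ES S by (auto intro!: csubspace_intros)
    have "(norm x)\<^sup>2 = (\<Sum>e\<in>M. (norm (cnj (\<phi> e) *\<^sub>C e))\<^sup>2)"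
      unfolding x_def
      by (rule norm_sum_Pythagorean)
        (use M in \<open>auto simp: pairwise_def subset_iff cinner_simps is_onb_cinner[OF E]
          intro!: orthogonal_if_cinner\<close>)
    then have nx: "(norm x)\<^sup>2 = ?s"
      using M by (auto simp: is_onb_norm[OF E] subset_iff intro!: sum.cong)
    have "((\<lambda>e. cnj (\<phi> e) *\<^sub>C e) has_sum x) M"
      unfolding x_def using M by (simp add: has_sum_finiteI)
    then have "((\<lambda>e. \<phi> (cnj (\<phi> e) *\<^sub>C e)) has_sum \<phi> x) M"
      using has_sum_additive_bounded[OF S add bound, of M "\<lambda>e. cnj (\<phi> e) *\<^sub>C e" x] M ES
      by (auto intro: closed_csubspace_scaleC[OF S])
    then have "\<phi> x = (\<Sum>e\<in>M. \<phi> (cnj (\<phi> e) *\<^sub>C e))"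
      using M by (simp add: has_sum_finite_iff)
    also have "\<dots> = (\<Sum>e\<in>M. complex_of_real ((cmod (\<phi> e))\<^sup>2))"
      using M ES by (intro sum.cong) (auto simp only: scale complex_norm_square mult.commute)
    finally have "cmod (\<phi> x) = cmod (complex_of_real ?s)" by simp
    then have "?s \<le> K * norm x"
      using bound[OF \<open>x \<in> S\<close>] sum_nonneg[of M "\<lambda>e. (cmod (\<phi> e))\<^sup>2"] by (simp only: norm_of_real)
    then have "norm x * norm x \<le> K * norm x" using nx by (simp add: power2_eq_square)
    then have "norm x \<le> \<bar>K\<bar>" by (cases "x = 0") auto
    then have "(norm x)\<^sup>2 \<le> \<bar>K\<bar>\<^sup>2" by (intro power_mono) auto
    then show ?thesis using nx by simp
  qed
  then have "(\<lambda>e. (cmod (cnj (\<phi> e)))\<^sup>2) summable_on E"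
    by (intro nonneg_bdd_above_summable_on) (auto intro!: bdd_aboveI2[where M = "K\<^sup>2"])
  from onb_series_summable[OF E this] obtain z where z: "((\<lambda>e. cnj (\<phi> e) *\<^sub>C e) has_sum z) E"
    by (auto simp: summable_on_def)
  have "z \<in> S"
    by (rule closed_csubspace_has_sum[OF S z]) (simp add: S ES csubspace_intros)
  have ze: "cinner z e = \<phi> e" if "e \<in> E" for e
    using onb_series_coeff[OF E that z] cinner_commute[of z e] by simp
  have "cinner z x = \<phi> x" if x: "x \<in> S" for x
  proof (rule has_sum_unique)
    have "((\<lambda>e. \<phi> (cinner e x *\<^sub>C e)) has_sum \<phi> x) E"
      by (rule has_sum_additive_bounded[OF S add bound _ onb_expansion[OF S E x]])
        (use ES S in \<open>auto intro!: csubspace_intros\<close>)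
    then show "((\<lambda>e. cinner z e * cinner e x) has_sum \<phi> x) E"
      by (rule has_sum_cong[THEN iffD1, rotated]) (simp add: scale ES ze)
    show "((\<lambda>e. cinner z e * cinner e x) has_sum cinner z x) E"
      by (rule parseval_cinner[OF S E x])
  qed
  with \<open>z \<in> S\<close> show ?thesis by blast
qed

lemma subspace_eqI:
  assumes S: "closed_csubspace S" and "x \<in> S" "y \<in> S" and eq: "\<And>z. z \<in> S \<Longrightarrow> cinner z x = cinner z y"
  shows "x = y"
proof -
  have "x - y \<in> S" using assms by (simp add: csubspace_intros)
  from eq[OF this] have "cinner (x - y) (x - y) = 0"
    unfolding cinner_diff_right[of "x - y" x y] by simp
  then show ?thesis by simp
qed

text \<open>Adjoint of an operator between two different spaces, a case outside the scope of
  \<open>adj_op\<close>. The target is not a parameter, since the Riesz vector exists for every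
  \<open>y\<close> of the ambient type.\<close>

definition hadj :: "'a::chilbert_space set \<Rightarrow> ('a \<Rightarrow> 'b::chilbert_space) \<Rightarrow> 'b \<Rightarrow> 'a" where
  "hadj S a y = (SOME z. z \<in> S \<and> (\<forall>x\<in>S. cinner z x = cinner y (a x)))"

lemma
  assumes S: "closed_csubspace S" and a: "bop S T a"
  shows hadj_in: "hadj S a y \<in> S"
    and hadj_left: "x \<in> S \<Longrightarrow> cinner (hadj S a y) x = cinner y (a x)"
proof -
  obtain K where K: "K \<ge> 0" "\<forall>x\<in>S. norm (a x) \<le> K * norm x" using bop_bound[OF a] by auto
  have "\<exists>z\<in>S. \<forall>x\<in>S. cinner z x = cinner y (a x)"
  proof (rule riesz[OF S])
    fix x assume x: "x \<in> S"
    have "cmod (cinner y (a x)) \<le> norm y * norm (a x)" by (rule cmod_cinner_le)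
    also have "\<dots> \<le> norm y * (K * norm x)" by (rule mult_left_mono) (use K x in auto)
    finally show "cmod (cinner y (a x)) \<le> (norm y * K) * norm x" by (simp add: mult.assoc)
  qed (simp_all add: bop_add[OF a] bop_scaleC[OF a] cinner_simps)
  then have "\<exists>z. z \<in> S \<and> (\<forall>x\<in>S. cinner z x = cinner y (a x))" by blast
  then have *: "hadj S a y \<in> S \<and> (\<forall>x\<in>S. cinner (hadj S a y) x = cinner y (a x))"
    unfolding hadj_def by (rule someI_ex)
  show "hadj S a y \<in> S" using * by blast
  show "x \<in> S \<Longrightarrow> cinner (hadj S a y) x = cinner y (a x)" using * by blast
qed

lemma hadj_right:
  assumes "closed_csubspace S" "bop S T a" "x \<in> S"
  shows "cinner x (hadj S a y) = cinner (a x) y"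
  using hadj_left[OF assms] by (subst cinner_eq_flip)

lemma bop_hadj:
  assumes S: "closed_csubspace S" and a: "bop S T a"
  shows "bop T S (hadj S a)"
proof -
  note h = hadj_in[OF S a] hadj_right[OF S a]
  obtain K where K: "K \<ge> 0" "\<forall>x\<in>S. norm (a x) \<le> K * norm x" using bop_bound[OF a] by auto
  show ?thesis
  proof (rule bopI)
    fix y
    let ?z = "hadj S a y"
    have "(norm ?z)\<^sup>2 = cmod (complex_of_real ((norm ?z)\<^sup>2))" by (simp add: norm_power)
    also have "\<dots> = cmod (cinner (a ?z) y)" by (simp only: cinner_self[symmetric] h)
    also have "\<dots> \<le> norm (a ?z) * norm y" by (rule cmod_cinner_le)
    also have "\<dots> \<le> (K * norm ?z) * norm y" by (rule mult_right_mono) (use K h in auto)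
    finally have "norm ?z * norm ?z \<le> norm ?z * (K * norm y)" by (simp add: power2_eq_square mult_ac)
    then show "norm ?z \<le> K * norm y" using K by (cases "norm ?z = 0") auto
  next
    fix x y show "hadj S a (x + y) = hadj S a x + hadj S a y"
      by (rule subspace_eqI[OF S]) (simp_all add: h cinner_simps closed_csubspace_add[OF S])
  next
    fix c x show "hadj S a (c *\<^sub>C x) = c *\<^sub>C hadj S a x"
      by (rule subspace_eqI[OF S]) (simp_all add: h cinner_simps closed_csubspace_scaleC[OF S])
  qed (rule h)
qed

section \<open>The algebra of bounded operators on a subspace\<close>

lemma bounded_op_iff: "a \<in> bounded_op S \<longleftrightarrow> bop S S a \<and> a \<in> extensional S"
  by (auto simp: bounded_op_def bop_def PiE_def Pi_def)

lemma bounded_op_bop: "a \<in> bounded_op S \<Longrightarrow> bop S S a"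
  by (simp add: bounded_op_iff)

lemma bop_cong:
  assumes S: "closed_csubspace S" and "bop S T a" and eq: "\<And>x. x \<in> S \<Longrightarrow> b x = a x"
  shows "bop S T b"
  using assms(2) closed_csubspace_add[OF S] closed_csubspace_scaleC[OF S]
  unfolding bop_def by (simp add: eq)

lemma restrict_bounded_op:
  "closed_csubspace S \<Longrightarrow> bop S S a \<Longrightarrow> (\<lambda>x\<in>S. a x) \<in> bounded_op S"
  unfolding bounded_op_iff by (auto intro: bop_cong[of S S a "\<lambda>x\<in>S. a x"])

lemma bounded_op_eqI:
  "a \<in> bounded_op S \<Longrightarrow> b \<in> bounded_op S \<Longrightarrow> (\<And>x. x \<in> S \<Longrightarrow> a x = b x) \<Longrightarrow> a = b"
  by (auto simp: bounded_op_iff intro: extensionalityI)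

lemma bounded_op_id: "closed_csubspace S \<Longrightarrow> (\<lambda>x\<in>S. x) \<in> bounded_op S"
  by (rule restrict_bounded_op[OF _ bop_id])

lemma bounded_op_compose:
  "closed_csubspace S \<Longrightarrow> a \<in> bounded_op S \<Longrightarrow> b \<in> bounded_op S \<Longrightarrow> compose S a b \<in> bounded_op S"
  unfolding compose_def by (rule restrict_bounded_op) (auto intro: bop_comp[of S S a S b] bounded_op_bop)

lemma bop_plus:
  assumes T: "closed_csubspace T" and a: "bop S T a" and b: "bop S T b"
  shows "bop S T (\<lambda>x. a x + b x)"
proof -
  obtain K where K: "\<forall>x\<in>S. norm (a x) \<le> K * norm x" using bop_bound[OF a] by auto
  obtain L where L: "\<forall>x\<in>S. norm (b x) \<le> L * norm x" using bop_bound[OF b] by auto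
  show ?thesis
  proof (rule bopI)
    fix x assume x: "x \<in> S"
    show "norm (a x + b x) \<le> (K + L) * norm x"
      using norm_triangle_ineq[of "a x" "b x"] bspec[OF K x] bspec[OF L x] by (simp add: algebra_simps)
  qed (use T in \<open>auto simp: bop_in[OF a] bop_in[OF b] bop_add[OF a] bop_add[OF b] bop_scaleC[OF a]
    bop_scaleC[OF b] scaleC_add_right csubspace_intros\<close>)
qed

lemma bop_cmult:
  assumes T: "closed_csubspace T" and a: "bop S T a"
  shows "bop S T (\<lambda>x. c *\<^sub>C a x)"
proof -
  obtain K where K: "\<forall>x\<in>S. norm (a x) \<le> K * norm x" using bop_bound[OF a] by auto
  show ?thesis
  proof (rule bopI)
    fix x assume x: "x \<in> S"
    show "norm (c *\<^sub>C a x) \<le> (cmod c * K) * norm x"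
      using mult_left_mono[OF bspec[OF K x], of "cmod c"] by (simp add: mult.assoc)
  qed (use T in \<open>auto simp: bop_in[OF a] bop_add[OF a] bop_scaleC[OF a]
    scaleC_add_right csubspace_intros scaleC_scaleC mult.commute\<close>)
qed

lemma bounded_op_plus:
  "closed_csubspace S \<Longrightarrow> a \<in> bounded_op S \<Longrightarrow> b \<in> bounded_op S \<Longrightarrow> (\<lambda>x\<in>S. a x + b x) \<in> bounded_op S"
  by (intro restrict_bounded_op bop_plus) (auto dest: bounded_op_bop)

lemma bounded_op_cmult:
  "closed_csubspace S \<Longrightarrow> a \<in> bounded_op S \<Longrightarrow> (\<lambda>x\<in>S. c *\<^sub>C a x) \<in> bounded_op S"
  by (intro restrict_bounded_op bop_cmult) (auto dest: bounded_op_bop)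

lemma adj_op_eqI:
  assumes S: "closed_csubspace S" and b: "b \<in> bounded_op S"
    and eq: "\<And>x y. x \<in> S \<Longrightarrow> y \<in> S \<Longrightarrow> cinner (b x) y = cinner x (a y)"
  shows "adj_op S a = b"
  unfolding adj_op_def
proof (rule the_equality)
  fix b' assume b': "b' \<in> bounded_op S \<and> (\<forall>x\<in>S. \<forall>y\<in>S. cinner (b' x) y = cinner x (a y))"
  show "b' = b"
  proof (rule bounded_op_eqI[of _ S])
    fix x assume x: "x \<in> S"
    show "b' x = b x"
    proof (rule subspace_eqI[OF S])
      show "cinner z (b' x) = cinner z (b x)" if "z \<in> S" for z
        using b' eq[OF x that] x that by (subst cinner_eq_flip) auto
    qed (use b b' x in \<open>auto dest: bounded_op_bop intro: bop_in\<close>)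
  qed (use b b' in auto)
qed (use b eq in auto)

lemma
  assumes S: "closed_csubspace S" and a: "a \<in> bounded_op S"
  shows adj_op_in: "adj_op S a \<in> bounded_op S"
    and adj_op_left: "x \<in> S \<Longrightarrow> y \<in> S \<Longrightarrow> cinner (adj_op S a x) y = cinner x (a y)"
proof -
  note a' = bounded_op_bop[OF a]
  have "(\<lambda>x\<in>S. hadj S a x) \<in> bounded_op S" by (intro restrict_bounded_op S bop_hadj[OF S a'])
  then have "adj_op S a = (\<lambda>x\<in>S. hadj S a x)"
    by (rule adj_op_eqI[OF S]) (simp add: hadj_left[OF S a'])
  then show "adj_op S a \<in> bounded_op S" "x \<in> S \<Longrightarrow> y \<in> S \<Longrightarrow> cinner (adj_op S a x) y = cinner x (a y)"
    using \<open>(\<lambda>x\<in>S. hadj S a x) \<in> bounded_op S\<close> by (auto simp: hadj_left[OF S a'])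
qed

lemma adj_op_right:
  assumes "closed_csubspace S" "a \<in> bounded_op S" "x \<in> S" "y \<in> S"
  shows "cinner x (adj_op S a y) = cinner (a x) y"
  using adj_op_left[OF assms(1,2,4,3)] by (subst cinner_eq_flip)

section \<open>Rank-one operators\<close>

definition ketbra :: "'a::chilbert_space set \<Rightarrow> 'a \<Rightarrow> 'a \<Rightarrow> 'a \<Rightarrow> 'a" where
  "ketbra S x y = (\<lambda>z\<in>S. cinner y z *\<^sub>C x)"

lemma ketbra_apply: "z \<in> S \<Longrightarrow> ketbra S x y z = cinner y z *\<^sub>C x"
  by (simp add: ketbra_def)

lemma ketbra_in:
  assumes S: "closed_csubspace S" and x: "x \<in> S"
  shows "ketbra S x y \<in> bounded_op S"
  unfolding ketbra_def
proof (rule restrict_bounded_op[OF S])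
  show "bop S S (\<lambda>z. cinner y z *\<^sub>C x)"
  proof (rule bopI)
    fix z
    have "cmod (cinner y z) * norm x \<le> (norm y * norm z) * norm x"
      by (rule mult_right_mono[OF cmod_cinner_le]) simp
    then show "norm (cinner y z *\<^sub>C x) \<le> (norm y * norm x) * norm z" by (simp add: mult_ac)
  qed (use S x in \<open>auto simp: csubspace_intros cinner_simps scaleC_add_left scaleC_scaleC\<close>)
qed

lemma adj_op_ketbra:
  assumes S: "closed_csubspace S" and x: "x \<in> S" and y: "y \<in> S"
  shows "adj_op S (ketbra S x y) = ketbra S y x"
proof (rule adj_op_eqI[OF S ketbra_in[OF S y]])
  fix z w assume "z \<in> S" "w \<in> S"
  then show "cinner (ketbra S y x z) w = cinner z (ketbra S x y w)"
    using cinner_commute[of x z] by (simp add: ketbra_apply cinner_simps)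
qed

lemma compose_ketbra:
  assumes S: "closed_csubspace S" and a: "a \<in> bounded_op S" and x: "x \<in> S"
  shows "compose S a (ketbra S x y) = ketbra S (a x) y"
  unfolding compose_def ketbra_def
  by (rule restrict_ext) (simp add: x bop_scaleC[OF bounded_op_bop[OF a]])

lemma compose_ketbra_ketbra:
  assumes S: "closed_csubspace S" and z: "z \<in> S"
  shows "compose S (ketbra S x y) (ketbra S z w) = (\<lambda>u\<in>S. cinner y z *\<^sub>C ketbra S x w u)"
  unfolding compose_def
  by (rule restrict_ext)
    (simp add: ketbra_def z closed_csubspace_scaleC[OF S] scaleC_scaleC cinner_simps mult.commute)

section \<open>Tensor decompositions\<close>

text \<open>The bounded operator with \<open>T x c \<mapsto> T' x (b c)\<close>, as an orthogonal series over a basis of \<open>A\<close>;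
  the adjoint \<open>hadj C (T e)\<close> takes the \<open>e\<close>-component of a vector.\<close>

definition amp :: "'a::chilbert_space set \<Rightarrow> 'c::chilbert_space set \<Rightarrow> ('a \<Rightarrow> 'c \<Rightarrow> 'b::chilbert_space) \<Rightarrow>
    ('a \<Rightarrow> 'd::chilbert_space \<Rightarrow> 'e::chilbert_space) \<Rightarrow> ('c \<Rightarrow> 'd) \<Rightarrow> 'b \<Rightarrow> 'e" where
  "amp A C T T' b y = (\<Sum>\<^sub>\<infinity>e\<in>some_onb A. T' e (b (hadj C (T e) y)))"

text \<open>An abstract presentation of \<open>B\<close> as the Hilbert space tensor product of
  \<open>A\<close> and \<open>C\<close>. The Gram identity and totality fix it up to a unitary and
  already imply that \<open>T\<close> is bilinear. Instances are \<open>tensor_vec\<close> and the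
  map sending \<open>x\<close>, \<open>c\<close> to
  \<open>F |x\<rangle>\<langle>e| c\<close>.\<close>

locale tensor_decomp =
  fixes A :: "'a::chilbert_space set" and C :: "'c::chilbert_space set"
    and B :: "'b::chilbert_space set" and T :: "'a \<Rightarrow> 'c \<Rightarrow> 'b"
  assumes A: "closed_csubspace A" and C: "closed_csubspace C" and B: "closed_csubspace B"
    and T_in: "x \<in> A \<Longrightarrow> c \<in> C \<Longrightarrow> T x c \<in> B"
    and gram: "x \<in> A \<Longrightarrow> c \<in> C \<Longrightarrow> z \<in> A \<Longrightarrow> d \<in> C \<Longrightarrow>
      cinner (T x c) (T z d) = cinner x z * cinner c d"
    and total: "y \<in> B \<Longrightarrow> (\<And>x c. x \<in> A \<Longrightarrow> c \<in> C \<Longrightarrow> cinner (T x c) y = 0) \<Longrightarrow> y = 0"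
begin

text \<open>The axioms are symmetric in the two factors; every fact about the right factor is
  thereby available for the left one, in particular \<open>lift_left\<close>.\<close>

lemma flip: "tensor_decomp C A B (\<lambda>c x. T x c)"
  by unfold_locales (use A C B T_in gram total in \<open>auto simp: mult.commute\<close>)

lemma vec_eqI:
  assumes "y \<in> B" "y' \<in> B" "\<And>x c. x \<in> A \<Longrightarrow> c \<in> C \<Longrightarrow> cinner (T x c) y = cinner (T x c) y'"
  shows "y = y'"
  using total[of "y - y'"] assms by (simp add: cinner_simps closed_csubspace_diff[OF B])

text \<open>By \<open>gram\<close> both sides have the same inner products with all elementary
  vectors, and these are total.\<close>

lemma T_add_right: "x \<in> A \<Longrightarrow> c \<in> C \<Longrightarrow> d \<in> C \<Longrightarrow> T x (c + d) = T x c + T x d"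
  by (rule vec_eqI)
    (simp_all add: gram T_in cinner_simps algebra_simps closed_csubspace_add[OF B] closed_csubspace_add[OF C])

lemma T_scaleC_right: "x \<in> A \<Longrightarrow> c \<in> C \<Longrightarrow> T x (k *\<^sub>C c) = k *\<^sub>C T x c"
  by (rule vec_eqI)
    (simp_all add: gram T_in cinner_simps closed_csubspace_scaleC[OF B] closed_csubspace_scaleC[OF C])

lemma T_scaleC_left: "x \<in> A \<Longrightarrow> c \<in> C \<Longrightarrow> T (k *\<^sub>C x) c = k *\<^sub>C T x c"
  using tensor_decomp.T_scaleC_right[OF flip] .

lemma norm_T: "x \<in> A \<Longrightarrow> c \<in> C \<Longrightarrow> norm (T x c) = norm x * norm c"
proof -
  assume "x \<in> A" "c \<in> C"
  then have "complex_of_real ((norm (T x c))\<^sup>2) = complex_of_real ((norm x * norm c)\<^sup>2)"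
    by (simp only: cinner_self[symmetric] gram power_mult_distrib of_real_mult)
  then show ?thesis by (simp only: of_real_eq_iff) (simp add: power2_eq_iff_nonneg)
qed

lemma bop_T: "x \<in> A \<Longrightarrow> bop C B (T x)"
  by (rule bopI[where K = "norm x"]) (simp_all add: T_in T_add_right T_scaleC_right norm_T)

text \<open>On \<open>B\<close> this is the operator \<open>\<langle>x| \<otimes> 1\<close>, a
  partial inner product. Along a basis of \<open>A\<close> the slices of \<open>y\<close> are its
  coordinates in a direct sum of copies of \<open>C\<close>.\<close>

abbreviation slice :: "'a \<Rightarrow> 'b \<Rightarrow> 'c" where "slice x \<equiv> hadj C (T x)"

lemma slice_in: "x \<in> A \<Longrightarrow> slice x y \<in> C"
  and slice_left: "x \<in> A \<Longrightarrow> c \<in> C \<Longrightarrow> cinner (slice x y) c = cinner y (T x c)"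
  and slice_right: "x \<in> A \<Longrightarrow> c \<in> C \<Longrightarrow> cinner c (slice x y) = cinner (T x c) y"
  and bop_slice: "x \<in> A \<Longrightarrow> bop B C (slice x)"
  using hadj_in[OF C bop_T] hadj_left[OF C bop_T] hadj_right[OF C bop_T] bop_hadj[OF C bop_T]
  by blast+

lemma slice_T: "x \<in> A \<Longrightarrow> z \<in> A \<Longrightarrow> d \<in> C \<Longrightarrow> slice x (T z d) = cinner x z *\<^sub>C d"
  by (rule subspace_eqI[OF C])
    (simp_all add: slice_in slice_right gram cinner_simps closed_csubspace_scaleC[OF C])

lemma some_onb_A: "is_onb A (some_onb A)" "e \<in> some_onb A \<Longrightarrow> e \<in> A"
  using is_onb_some_onb[OF A] by (auto intro: is_onb_subset)

text \<open>Only basis vectors of \<open>A\<close> are tested. A general \<open>x\<close> is reached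
  through the opposite slice \<open>f.slice c y\<close>, a vector of \<open>A\<close> whose basis
  coefficients are the inner products of \<open>T e c\<close> with \<open>y\<close>.\<close>

lemma slice_eqI:
  assumes "y \<in> B" "y' \<in> B" and eq: "\<And>e. e \<in> some_onb A \<Longrightarrow> slice e y = slice e y'"
  shows "y = y'"
proof (rule vec_eqI[OF assms(1,2)])
  fix x c assume "x \<in> A" "c \<in> C"
  interpret f: tensor_decomp C A B "\<lambda>c x. T x c" by (rule flip)
  have "f.slice c y = f.slice c y'"
  proof (rule is_onb_eqI[OF some_onb_A(1) A f.slice_in f.slice_in])
    fix e assume "e \<in> some_onb A"
    then show "cinner e (f.slice c y) = cinner e (f.slice c y')"
      using eq[of e] slice_right[of e c y] slice_right[of e c y'] \<open>c \<in> C\<close>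
      by (simp add: f.slice_right some_onb_A(2))
  qed fact+
  then show "cinner (T x c) y = cinner (T x c) y'"
    using f.slice_right[of c x] \<open>x \<in> A\<close> \<open>c \<in> C\<close> by metis
qed

lemma orthogonal_T:
  assumes "e \<in> some_onb A" "f \<in> some_onb A" "e \<noteq> f" "c \<in> C" "d \<in> C"
  shows "cinner (T e c) (T f d) = 0"
  using assms by (simp add: gram some_onb_A(2) is_onb_cinner[OF some_onb_A(1)])

lemma norm_T_onb: "e \<in> some_onb A \<Longrightarrow> c \<in> C \<Longrightarrow> norm (T e c) = norm c"
  by (simp add: norm_T some_onb_A(2) is_onb_norm[OF some_onb_A(1)])

lemma slice_bessel:
  assumes M: "finite M" "M \<subseteq> some_onb A" and y: "y \<in> B"
  shows "(\<Sum>e\<in>M. (norm (slice e y))\<^sup>2) \<le> (norm y)\<^sup>2"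
proof -
  let ?s = "\<Sum>e\<in>M. (norm (slice e y))\<^sup>2"
  define z where "z = (\<Sum>e\<in>M. T e (slice e y))"
  have MA: "e \<in> A" if "e \<in> M" for e using M that some_onb_A(2) by auto
  have "(norm z)\<^sup>2 = (\<Sum>e\<in>M. (norm (T e (slice e y)))\<^sup>2)"
    unfolding z_def
    by (rule norm_sum_Pythagorean)
      (use M MA in \<open>auto simp: pairwise_def subset_iff slice_in intro!: orthogonal_if_cinner orthogonal_T\<close>)
  also have "\<dots> = ?s" using M MA by (intro sum.cong) (auto simp: norm_T_onb subset_iff slice_in)
  finally have nz: "(norm z)\<^sup>2 = ?s" .
  have "cinner z y = (\<Sum>e\<in>M. complex_of_real ((norm (slice e y))\<^sup>2))"
    unfolding z_def cinner_sum_left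
    by (intro sum.cong refl) (simp only: slice_right[symmetric] slice_in MA cinner_self)
  then have "cinner z y = complex_of_real ?s" by simp
  then have "?s = cmod (cinner z y)" by (simp only: norm_of_real) (simp add: sum_nonneg)
  also have "\<dots> \<le> norm z * norm y" by (rule cmod_cinner_le)
  finally have "norm z * norm z \<le> norm z * norm y" using nz by (simp add: power2_eq_square)
  then have "norm z \<le> norm y" by (cases "z = 0") auto
  then have "(norm z)\<^sup>2 \<le> (norm y)\<^sup>2" by (simp add: power_mono)
  with nz show ?thesis by simp
qed

lemma slice_norm_summable:
  assumes y: "y \<in> B"
  shows "(\<lambda>e. (norm (slice e y))\<^sup>2) summable_on some_onb A"
  by (rule nonneg_bdd_above_summable_on)
    (auto intro!: bdd_aboveI2[where M = "(norm y)\<^sup>2"] slice_bessel y)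

lemma slice_norm_le:
  assumes y: "y \<in> B"
  shows "(\<Sum>\<^sub>\<infinity>e\<in>some_onb A. (norm (slice e y))\<^sup>2) \<le> (norm y)\<^sup>2"
  by (rule infsum_le_finite_sums[OF slice_norm_summable[OF y] slice_bessel[OF _ _ y]])

section \<open>Operators 1 \<otimes> b between two decompositions with the same left factor\<close>

context
  fixes C' :: "'d::chilbert_space set" and B' :: "'e::chilbert_space set" and T' b
  assumes T': "tensor_decomp A C' B' T'" and b: "bop C C' b"
begin

interpretation T': tensor_decomp A C' B' T' by (rule T')

text \<open>Terms for distinct basis vectors are orthogonal, and their norms are at most
  \<open>K\<close> times those of the slices, which are square-summable by the Bessel inequality for
  slices.\<close>

lemma amp_has_sum:
  assumes y: "y \<in> B"
  shows "((\<lambda>e. T' e (b (slice e y))) has_sum amp A C T T' b y) (some_onb A)"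
proof -
  obtain K where K: "K \<ge> 0" "\<forall>x\<in>C. norm (b x) \<le> K * norm x" using bop_bound[OF b] by auto
  have "(\<lambda>e. T' e (b (slice e y))) summable_on some_onb A"
  proof (rule orthogonal_summable)
    show "(\<lambda>e. (norm (T' e (b (slice e y))))\<^sup>2) summable_on some_onb A"
    proof (rule summable_on_comparison_test)
      show "(\<lambda>e. K\<^sup>2 * (norm (slice e y))\<^sup>2) summable_on some_onb A"
        by (intro summable_on_cmult_right slice_norm_summable y)
      fix e assume e: "e \<in> some_onb A"
      have "norm (T' e (b (slice e y))) \<le> K * norm (slice e y)"
        using e K by (simp add: T'.norm_T_onb bop_in[OF b] slice_in some_onb_A(2))
      then show "(norm (T' e (b (slice e y))))\<^sup>2 \<le> K\<^sup>2 * (norm (slice e y))\<^sup>2"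
        using power_mono[of _ _ 2] by (fastforce simp flip: power_mult_distrib)
    qed simp
  qed (simp add: T'.orthogonal_T bop_in[OF b] slice_in some_onb_A(2))
  then show ?thesis unfolding amp_def by simp
qed

lemma amp_in: "y \<in> B \<Longrightarrow> amp A C T T' b y \<in> B'"
  by (rule closed_csubspace_has_sum[OF T'.B amp_has_sum])
    (simp_all add: T'.T_in bop_in[OF b] slice_in some_onb_A(2))

text \<open>Since slices determine a vector, this formula is what linearity of \<open>amp\<close>
  and its values on elementary vectors are checked against.\<close>

lemma slice_amp:
  assumes y: "y \<in> B" and e: "e \<in> some_onb A"
  shows "T'.slice e (amp A C T T' b y) = b (slice e y)"
proof (rule has_sum_unique)
  have eA: "e \<in> A" using e by (rule some_onb_A(2))
  show "((\<lambda>f. T'.slice e (T' f (b (slice f y)))) has_sum T'.slice e (amp A C T T' b y)) (some_onb A)"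
    by (rule bop_has_sum[OF T'.B T'.bop_slice _ amp_has_sum[OF y]])
      (simp_all add: T'.T_in bop_in[OF b] slice_in some_onb_A(2) e)
  show "((\<lambda>f. T'.slice e (T' f (b (slice f y)))) has_sum b (slice e y)) (some_onb A)"
    by (rule has_sum_finite_neutralI[of "{e}"])
      (use e in \<open>auto simp: T'.slice_T bop_in[OF b] slice_in some_onb_A(2)
        is_onb_cinner[OF some_onb_A(1)]\<close>)
qed

lemma amp_norm:
  assumes y: "y \<in> B" and K: "K \<ge> 0" "\<And>x. x \<in> C \<Longrightarrow> norm (b x) \<le> K * norm x"
  shows "norm (amp A C T T' b y) \<le> K * norm y"
proof -
  have "((\<lambda>e. (norm (T' e (b (slice e y))))\<^sup>2) has_sum (norm (amp A C T T' b y))\<^sup>2) (some_onb A)"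
    by (rule has_sum_norm_orthogonal[OF _ amp_has_sum[OF y]])
      (simp add: T'.orthogonal_T bop_in[OF b] slice_in some_onb_A(2))
  moreover have "((\<lambda>e. K\<^sup>2 * (norm (slice e y))\<^sup>2) has_sum
      K\<^sup>2 * (\<Sum>\<^sub>\<infinity>e\<in>some_onb A. (norm (slice e y))\<^sup>2)) (some_onb A)"
    by (intro has_sum_cmult_right has_sum_infsum slice_norm_summable y)
  ultimately have "(norm (amp A C T T' b y))\<^sup>2 \<le> K\<^sup>2 * (\<Sum>\<^sub>\<infinity>e\<in>some_onb A. (norm (slice e y))\<^sup>2)"
  proof (rule has_sum_mono)
    fix e assume e: "e \<in> some_onb A"
    have "norm (T' e (b (slice e y))) \<le> K * norm (slice e y)"
      using e K by (simp add: T'.norm_T_onb bop_in[OF b] slice_in some_onb_A(2))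
    then show "(norm (T' e (b (slice e y))))\<^sup>2 \<le> K\<^sup>2 * (norm (slice e y))\<^sup>2"
      using power_mono[of _ _ 2] by (fastforce simp flip: power_mult_distrib)
  qed
  also have "\<dots> \<le> K\<^sup>2 * (norm y)\<^sup>2" by (rule mult_left_mono[OF slice_norm_le[OF y]]) simp
  finally have "(norm (amp A C T T' b y))\<^sup>2 \<le> (K * norm y)\<^sup>2" by (simp add: power_mult_distrib)
  then show ?thesis by (rule power2_le_imp_le) (use K in simp)
qed

lemma bop_amp: "bop B B' (amp A C T T' b)"
proof -
  obtain K where K: "K \<ge> 0" "\<forall>x\<in>C. norm (b x) \<le> K * norm x" using bop_bound[OF b] by auto
  show ?thesis
  proof (rule bopI[where K = K])
    fix x y assume xy: "x \<in> B" "y \<in> B"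
    then have xy': "x + y \<in> B" using B by (simp add: closed_csubspace_add)
    show "amp A C T T' b (x + y) = amp A C T T' b x + amp A C T T' b y"
    proof (rule T'.slice_eqI)
      fix e assume e: "e \<in> some_onb A"
      then have eA: "e \<in> A" by (rule some_onb_A(2))
      show "T'.slice e (amp A C T T' b (x + y)) = T'.slice e (amp A C T T' b x + amp A C T T' b y)"
        using e eA xy xy'
        by (simp add: slice_amp bop_add[OF T'.bop_slice] bop_add[OF bop_slice] amp_in bop_add[OF b] slice_in)
    qed (use xy xy' in \<open>simp_all add: amp_in closed_csubspace_add[OF T'.B]\<close>)
  next
    fix c x assume x: "x \<in> B"
    then have cx: "c *\<^sub>C x \<in> B" using B by (simp add: closed_csubspace_scaleC)
    show "amp A C T T' b (c *\<^sub>C x) = c *\<^sub>C amp A C T T' b x"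
    proof (rule T'.slice_eqI)
      fix e assume e: "e \<in> some_onb A"
      then have eA: "e \<in> A" by (rule some_onb_A(2))
      show "T'.slice e (amp A C T T' b (c *\<^sub>C x)) = T'.slice e (c *\<^sub>C amp A C T T' b x)"
        using e eA x cx
        by (simp add: slice_amp bop_scaleC[OF T'.bop_slice] bop_scaleC[OF bop_slice] amp_in bop_scaleC[OF b] slice_in)
    qed (use x cx in \<open>simp_all add: amp_in closed_csubspace_scaleC[OF T'.B]\<close>)
  qed (use K in \<open>auto intro: amp_in amp_norm\<close>)
qed

lemma amp_T:
  assumes x: "x \<in> A" and c: "c \<in> C"
  shows "amp A C T T' b (T x c) = T' x (b c)"
proof (rule T'.slice_eqI)
  fix e assume e: "e \<in> some_onb A"
  then have eA: "e \<in> A" by (rule some_onb_A(2))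
  show "T'.slice e (amp A C T T' b (T x c)) = T'.slice e (T' x (b c))"
    using e eA x c by (simp add: slice_amp T_in slice_T T'.slice_T bop_in[OF b] bop_scaleC[OF b])
qed (use x c in \<open>simp_all add: amp_in T_in T'.T_in bop_in[OF b]\<close>)

text \<open>Writes a matrix coefficient of the amplification as a sum of coefficients of
  \<open>b\<close>. Both the adjoint of the intertwiner and the normality of \<open>lift\<close> are
  read off from it.\<close>

lemma amp_form:
  assumes u: "u \<in> B'" and v: "v \<in> B"
  shows "((\<lambda>e. cinner (T'.slice e u) (b (slice e v))) has_sum cinner u (amp A C T T' b v)) (some_onb A)"
  using has_sum_cinner_right[OF amp_has_sum[OF v], of u]
  by (rule has_sum_cong[THEN iffD1, rotated])
    (simp add: T'.slice_left bop_in[OF b] slice_in some_onb_A(2))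

end

lemma onb_slices: "y \<in> B \<Longrightarrow> ((\<lambda>e. T e (slice e y)) has_sum y) (some_onb A)"
proof -
  assume y: "y \<in> B"
  have "amp A C T T (\<lambda>x. x) y = y"
    by (rule slice_eqI)
      (simp_all add: y amp_in[OF tensor_decomp_axioms bop_id] slice_amp[OF tensor_decomp_axioms bop_id])
  then show ?thesis using amp_has_sum[OF tensor_decomp_axioms bop_id y] by simp
qed

lemma slice_parseval:
  assumes y: "y \<in> B"
  shows "((\<lambda>e. (norm (slice e y))\<^sup>2) has_sum (norm y)\<^sup>2) (some_onb A)"
  using has_sum_norm_orthogonal[OF _ onb_slices[OF y]]
  by (rule has_sum_cong[THEN iffD1, rotated])
    (auto simp: orthogonal_T norm_T_onb slice_in some_onb_A(2))

lemma bop_eqI: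
  assumes g: "bop B S g" and h: "bop B S h" and eq: "\<And>x c. x \<in> A \<Longrightarrow> c \<in> C \<Longrightarrow> g (T x c) = h (T x c)"
    and y: "y \<in> B"
  shows "g y = h y"
proof (rule has_sum_unique)
  have Te: "T e (slice e y) \<in> B" if "e \<in> some_onb A" for e
    using that by (simp add: T_in slice_in some_onb_A(2))
  show "((\<lambda>e. g (T e (slice e y))) has_sum g y) (some_onb A)"
    by (rule bop_has_sum[OF B g Te onb_slices[OF y]])
  have "((\<lambda>e. h (T e (slice e y))) has_sum h y) (some_onb A)"
    by (rule bop_has_sum[OF B h Te onb_slices[OF y]])
  then show "((\<lambda>e. g (T e (slice e y))) has_sum h y) (some_onb A)"
    by (rule has_sum_cong[THEN iffD1, rotated]) (simp add: eq slice_in some_onb_A(2))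
qed

lemma op_eqI:
  assumes g: "g \<in> bounded_op B" and h: "h \<in> bounded_op B"
    and eq: "\<And>x c. x \<in> A \<Longrightarrow> c \<in> C \<Longrightarrow> g (T x c) = h (T x c)"
  shows "g = h"
  using bop_eqI[OF bounded_op_bop[OF g] bounded_op_bop[OF h] eq] by (rule bounded_op_eqI[OF g h])

lemma op_eqI_form:
  assumes g: "g \<in> bounded_op B" and h: "h \<in> bounded_op B"
    and eq: "\<And>x c z d. x \<in> A \<Longrightarrow> c \<in> C \<Longrightarrow> z \<in> A \<Longrightarrow> d \<in> C \<Longrightarrow>
      cinner (T z d) (g (T x c)) = cinner (T z d) (h (T x c))"
  shows "g = h"
proof (rule op_eqI[OF g h])
  fix x c assume "x \<in> A" "c \<in> C"
  then show "g (T x c) = h (T x c)"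
    by (intro vec_eqI) (auto intro: bop_in[OF bounded_op_bop[OF g]] bop_in[OF bounded_op_bop[OF h]] T_in eq)
qed

section \<open>The embedding of operators on C as 1 \<otimes> b\<close>

definition lift :: "('c \<Rightarrow> 'c) \<Rightarrow> 'b \<Rightarrow> 'b" where
  "lift b = (\<lambda>y\<in>B. amp A C T T b y)"

lemma lift_in: "b \<in> bounded_op C \<Longrightarrow> lift b \<in> bounded_op B"
  unfolding lift_def
  by (intro restrict_bounded_op[OF B] bop_amp[OF tensor_decomp_axioms]) (rule bounded_op_bop)

lemma lift_T: "b \<in> bounded_op C \<Longrightarrow> x \<in> A \<Longrightarrow> c \<in> C \<Longrightarrow> lift b (T x c) = T x (b c)"
  unfolding lift_def using amp_T[OF tensor_decomp_axioms bounded_op_bop] by (simp add: T_in)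

lemma lift_form:
  assumes "b \<in> bounded_op C" "u \<in> B" "v \<in> B"
  shows "((\<lambda>e. cinner (slice e u) (b (slice e v))) has_sum cinner u (lift b v)) (some_onb A)"
  unfolding lift_def using amp_form[OF tensor_decomp_axioms bounded_op_bop] assms by simp

text \<open>Elementary vectors determine a bounded operator, so each algebraic law of
  \<open>lift\<close> below reduces to one evaluation at \<open>T x c\<close>.\<close>

lemma lift_eqI:
  assumes "b \<in> bounded_op C" "g \<in> bounded_op B" "\<And>x c. x \<in> A \<Longrightarrow> c \<in> C \<Longrightarrow> g (T x c) = T x (b c)"
  shows "g = lift b"
  by (rule op_eqI) (simp_all add: assms lift_in lift_T)

lemma op_T_in: "g \<in> bounded_op B \<Longrightarrow> x \<in> A \<Longrightarrow> c \<in> C \<Longrightarrow> g (T x c) \<in> B"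
  and op_C_in: "b \<in> bounded_op C \<Longrightarrow> c \<in> C \<Longrightarrow> b c \<in> C"
  and op_A_in: "a \<in> bounded_op A \<Longrightarrow> x \<in> A \<Longrightarrow> a x \<in> A"
  by (auto intro: bop_in[OF bounded_op_bop] T_in)

lemma lift_plus:
  assumes "a \<in> bounded_op C" "b \<in> bounded_op C"
  shows "lift (\<lambda>x\<in>C. a x + b x) = (\<lambda>y\<in>B. lift a y + lift b y)"
  by (rule lift_eqI[symmetric])
    (use assms in \<open>simp_all add: bounded_op_plus B C lift_in lift_T T_in T_add_right op_C_in\<close>)

lemma lift_scaleC:
  assumes "a \<in> bounded_op C"
  shows "lift (\<lambda>x\<in>C. c *\<^sub>C a x) = (\<lambda>y\<in>B. c *\<^sub>C lift a y)"
  by (rule lift_eqI[symmetric])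
    (use assms in \<open>simp_all add: bounded_op_cmult B C lift_in lift_T T_in T_scaleC_right op_C_in\<close>)

lemma lift_id: "lift (\<lambda>x\<in>C. x) = (\<lambda>y\<in>B. y)"
  by (rule lift_eqI[symmetric]) (simp_all add: bounded_op_id B C T_in)

lemma lift_compose:
  assumes "a \<in> bounded_op C" "b \<in> bounded_op C"
  shows "lift (compose C a b) = compose B (lift a) (lift b)"
  by (rule lift_eqI[symmetric])
    (use assms in \<open>simp_all add: bounded_op_compose B C lift_in lift_T T_in op_C_in compose_eq\<close>)

lemma lift_adj:
  assumes a: "a \<in> bounded_op C"
  shows "lift (adj_op C a) = adj_op B (lift a)"
proof (rule op_eqI_form)
  fix x c z d assume "x \<in> A" "c \<in> C" "z \<in> A" "d \<in> C"
  then show "cinner (T z d) (lift (adj_op C a) (T x c)) = cinner (T z d) (adj_op B (lift a) (T x c))"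
    using a by (simp add: adj_op_right[OF B] lift_in T_in lift_T adj_op_in C gram op_C_in
      adj_op_right[OF C])
qed (simp_all add: a lift_in adj_op_in B C)

text \<open>Slicing \<open>T x (a c)\<close> with a nonzero \<open>x\<close> returns a nonzero
  multiple of \<open>a c\<close>. If \<open>A\<close> is \<open>{0}\<close>, then \<open>B\<close>
  is \<open>{0}\<close> as well and all lifts coincide.\<close>

lemma lift_inject:
  assumes "A \<noteq> {0}" "a \<in> bounded_op C" "b \<in> bounded_op C" "lift a = lift b"
  shows "a = b"
proof -
  obtain x where x: "x \<in> A" "x \<noteq> 0" using assms(1) closed_csubspace_zero[OF A] by auto
  show ?thesis
  proof (rule bounded_op_eqI[OF assms(2,3)])
    fix c assume c: "c \<in> C"
    have "T x (a c) = T x (b c)" using assms x c by (metis lift_T)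
    then have "slice x (T x (a c)) = slice x (T x (b c))" by simp
    then have "cinner x x *\<^sub>C (a c - b c) = 0"
      using assms x c by (simp add: slice_T op_C_in scaleC_diff_right)
    then have "norm (cinner x x *\<^sub>C (a c - b c)) = 0" by simp
    then show "a c = b c" using x by simp
  qed
qed

text \<open>The diagonal block of \<open>g\<close> at \<open>e\<close>, that is
  \<open>(\<langle>e| \<otimes> 1) g (|e\<rangle> \<otimes> 1)\<close>. For a unit vector
  \<open>e\<close> it is a left inverse of \<open>lift\<close>.\<close>

definition compress :: "'a \<Rightarrow> ('b \<Rightarrow> 'b) \<Rightarrow> 'c \<Rightarrow> 'c" where
  "compress e g = (\<lambda>c\<in>C. slice e (g (T e c)))"

lemma compress_in: "e \<in> A \<Longrightarrow> g \<in> bounded_op B \<Longrightarrow> compress e g \<in> bounded_op C"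
  unfolding compress_def
  by (rule restrict_bounded_op[OF C bop_comp[OF bop_slice bop_comp[OF bounded_op_bop bop_T]]])

lemma compress_form:
  "e \<in> A \<Longrightarrow> u \<in> C \<Longrightarrow> v \<in> C \<Longrightarrow> cinner u (compress e g v) = cinner (T e u) (g (T e v))"
  by (simp add: compress_def slice_right)

abbreviation lift_left :: "('a \<Rightarrow> 'a) \<Rightarrow> 'b \<Rightarrow> 'b" where
  "lift_left \<equiv> tensor_decomp.lift C A B (\<lambda>c x. T x c)"

lemmas lift_left_in = tensor_decomp.lift_in[OF flip]
  and lift_left_T = tensor_decomp.lift_T[OF flip]
  and lift_left_eqI = tensor_decomp.lift_eqI[OF flip]
  and lift_left_id = tensor_decomp.lift_id[OF flip]

lemma lift_commute:
  assumes "a \<in> bounded_op A" "b \<in> bounded_op C"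
  shows "compose B (lift_left a) (lift b) = compose B (lift b) (lift_left a)"
  by (rule op_eqI)
    (use assms in \<open>simp_all add: bounded_op_compose B compose_eq T_in lift_in lift_left_in
      lift_T lift_left_T op_C_in op_A_in\<close>)

lemma lift_left_ketbra:
  assumes x: "x \<in> A" and e: "e \<in> A" and y: "y \<in> B"
  shows "lift_left (ketbra A x e) y = T x (slice e y)"
proof (rule bop_eqI[OF bounded_op_bop _ _ y])
  show "lift_left (ketbra A x e) \<in> bounded_op B" by (rule lift_left_in[OF ketbra_in[OF A x]])
  show "bop B B (\<lambda>y. T x (slice e y))" by (rule bop_comp[OF bop_T[OF x] bop_slice[OF e]])
  fix z c assume "z \<in> A" "c \<in> C"
  then show "lift_left (ketbra A x e) (T z c) = T x (slice e (T z c))"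
    using x e
    by (simp add: lift_left_T ketbra_in A ketbra_apply slice_T T_scaleC_left T_scaleC_right)
qed

text \<open>Shows that a rank-one operator between elementary vectors is an elementary tensor of
  operators; its image under a pair is therefore prescribed.\<close>

lemma lift_ketbra_ketbra:
  assumes "x \<in> A" "z \<in> A" "c \<in> C" "d \<in> C"
  shows "compose B (lift_left (ketbra A x z)) (lift (ketbra C c d)) = ketbra B (T x c) (T z d)"
proof (rule op_eqI)
  fix w v assume "w \<in> A" "v \<in> C"
  then show "compose B (lift_left (ketbra A x z)) (lift (ketbra C c d)) (T w v) =
      ketbra B (T x c) (T z d) (T w v)"
    using assms
    by (simp add: compose_eq T_in lift_T lift_left_T ketbra_in A C ketbra_apply gram T_scaleC_left
      T_scaleC_right bop_scaleC[OF bounded_op_bop[OF lift_left_in[OF ketbra_in[OF A]]]]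
      closed_csubspace_scaleC[OF C] scaleC_scaleC mult.commute)
qed (use assms in \<open>simp_all add: bounded_op_compose lift_in lift_left_in ketbra_in A B C T_in\<close>)

text \<open>Because \<open>e\<close> is a unit vector, \<open>T x c\<close> is the image of
  \<open>T e c\<close> under \<open>|x\<rangle>\<langle>e| \<otimes> 1\<close>. Moving
  \<open>g\<close> past this operator leaves \<open>T x\<close> applied to the slice of
  \<open>g (T e c)\<close>. The outcome is a formula for the operator on \<open>C\<close>, which
  later makes its continuous dependence on \<open>g\<close> visible.\<close>

lemma commutant:
  assumes e: "e \<in> A" "norm e = 1" and g: "g \<in> bounded_op B"
    and comm: "\<And>x. x \<in> A \<Longrightarrow>
      compose B (lift_left (ketbra A x e)) g = compose B g (lift_left (ketbra A x e))"
  shows "g = lift (compress e g)"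
proof (rule lift_eqI[OF compress_in[OF e(1) g] g])
  fix x c assume x: "x \<in> A" and c: "c \<in> C"
  have Te: "T e c \<in> B" using e c by (simp add: T_in)
  have "g (T x c) = g (lift_left (ketbra A x e) (T e c))"
    using x c e by (simp add: lift_left_ketbra T_in slice_T cinner_self)
  also have "\<dots> = lift_left (ketbra A x e) (g (T e c))"
    using fun_cong[OF comm[OF x], of "T e c"] Te by (simp add: compose_eq)
  also have "\<dots> = T x (compress e g c)"
    using x c e g by (simp add: lift_left_ketbra op_T_in compress_def)
  finally show "g (T x c) = T x (compress e g c)" .
qed

end

text \<open>For the identity on \<open>C\<close>, \<open>amp\<close> is the unitary taking
  \<open>T x c\<close> to \<open>T' x c\<close>. The inverse is checked on elementary vectors. The
  adjoint relation compares the two instances of \<open>amp_form\<close>, whose summands are complex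
  conjugates.\<close>

lemma
  assumes T: "tensor_decomp A C B T" and T': "tensor_decomp A C B' T'"
  shows amp_inverse: "y \<in> B \<Longrightarrow> amp A C T' T (\<lambda>x. x) (amp A C T T' (\<lambda>x. x) y) = y"
    and amp_adjoint: "u \<in> B' \<Longrightarrow> v \<in> B \<Longrightarrow>
      cinner (amp A C T' T (\<lambda>x. x) u) v = cinner u (amp A C T T' (\<lambda>x. x) v)"
proof -
  interpret T: tensor_decomp A C B T by (rule T)
  interpret T': tensor_decomp A C B' T' by (rule T')
  show "amp A C T' T (\<lambda>x. x) (amp A C T T' (\<lambda>x. x) y) = y" if y: "y \<in> B"
    by (rule T.bop_eqI[OF bop_comp[OF T'.bop_amp[OF T bop_id] T.bop_amp[OF T' bop_id]] bop_id _ y])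
      (simp add: T.amp_T[OF T' bop_id] T'.amp_T[OF T bop_id])
  assume u: "u \<in> B'" and v: "v \<in> B"
  have "((\<lambda>e. cinner (T.slice e v) (T'.slice e u)) has_sum cinner v (amp A C T' T (\<lambda>x. x) u)) (some_onb A)"
    by (rule T'.amp_form[OF T bop_id v u])
  then have "((\<lambda>e. cnj (cinner (T.slice e v) (T'.slice e u))) has_sum
      cnj (cinner v (amp A C T' T (\<lambda>x. x) u))) (some_onb A)"
    by simp
  then have "((\<lambda>e. cinner (T'.slice e u) (T.slice e v)) has_sum
      cinner (amp A C T' T (\<lambda>x. x) u) v) (some_onb A)"
    by (simp flip: cinner_commute)
  then show "cinner (amp A C T' T (\<lambda>x. x) u) v = cinner u (amp A C T T' (\<lambda>x. x) v)"
    using T.amp_form[OF T' bop_id u v] by (rule has_sum_unique)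
qed

section \<open>The concrete tensor product\<close>

lemma tensor_vec_nth:
  fixes x :: "'a::chilbert_space" and y :: "'b::chilbert_space"
  shows "ell2_nth (tensor_vec x y) (e, f) =
    (if e \<in> some_onb UNIV \<and> f \<in> some_onb UNIV then cinner e x * cinner f y else 0)"
proof -
  let ?E = "some_onb (UNIV :: 'a set)" and ?F = "some_onb (UNIV :: 'b set)"
  let ?f = "\<lambda>(e, f). if e \<in> ?E \<and> f \<in> ?F then cinner e x * cinner f y else 0"
  note E = is_onb_some_onb[OF closed_csubspace_UNIV]
  \<comment> \<open>\<open>Abs_ell2\<close> can be inverted only on square-summable families.
    Parseval in the second variable and Bessel in the first provide this.\<close>
  have "(\<lambda>(e, f). (cmod (cinner e x))\<^sup>2 * (cmod (cinner f y))\<^sup>2) summable_on ?E \<times> ?F"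
  proof (rule summable_on_SigmaI)
    show "((\<lambda>f. case (e, f) of (e, f) \<Rightarrow> (cmod (cinner e x))\<^sup>2 * (cmod (cinner f y))\<^sup>2) has_sum
        (cmod (cinner e x))\<^sup>2 * (norm y)\<^sup>2) ?F" for e
      using has_sum_cmult_right[OF parseval[OF closed_csubspace_UNIV E, of y]] by simp
    show "(\<lambda>e. (cmod (cinner e x))\<^sup>2 * (norm y)\<^sup>2) summable_on ?E"
      by (intro summable_on_cmult_left bessel_summable[OF E])
  qed auto
  then have "(\<lambda>i. (cmod (?f i))\<^sup>2) summable_on UNIV"
    by (rule summable_on_cong_neutral[THEN iffD1, rotated -1])
      (auto simp: norm_mult power_mult_distrib split: if_splits)
  then show ?thesis unfolding tensor_vec_def by (simp add: Abs_ell2_inverse)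
qed

text \<open>The double series of coordinates is summed with Parseval over the second basis and then
  over the first; outside the two bases all coordinates vanish.\<close>

lemma cinner_tensor_vec:
  fixes x x' :: "'a::chilbert_space" and y y' :: "'b::chilbert_space"
  shows "cinner (tensor_vec x y) (tensor_vec x' y') = cinner x x' * cinner y y'"
proof -
  let ?E = "some_onb (UNIV :: 'a set)" and ?F = "some_onb (UNIV :: 'b set)"
  note E = is_onb_some_onb[OF closed_csubspace_UNIV]
  let ?g = "\<lambda>i. cnj (ell2_nth (tensor_vec x y) i) * ell2_nth (tensor_vec x' y') i"
  have "?g summable_on UNIV" by (rule ell2_product_summable[OF ell2_nth_summable ell2_nth_summable])
  then have "(?g has_sum cinner (tensor_vec x y) (tensor_vec x' y')) UNIV"
    unfolding cinner_ell2_def by simp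
  then have "(?g has_sum cinner (tensor_vec x y) (tensor_vec x' y')) (?E \<times> ?F)"
    by (rule has_sum_cong_neutral[THEN iffD1, rotated -1]) (auto simp: tensor_vec_nth split: if_splits)
  then have "((\<lambda>e. cinner x e * cinner e x' * cinner y y') has_sum
      cinner (tensor_vec x y) (tensor_vec x' y')) ?E"
  proof (rule has_sum_SigmaD)
    fix e assume e: "e \<in> ?E"
    have "((\<lambda>f. (cinner x e * cinner e x') * (cinner y f * cinner f y')) has_sum
        (cinner x e * cinner e x') * cinner y y') ?F"
      by (rule has_sum_cmult_right[OF parseval_cinner[OF closed_csubspace_UNIV E UNIV_I]])
    then show "((\<lambda>f. ?g (e, f)) has_sum cinner x e * cinner e x' * cinner y y') ?F"
      by (rule has_sum_cong[THEN iffD1, rotated])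
        (simp add: tensor_vec_nth e mult_ac flip: cinner_commute)
  qed
  moreover have "((\<lambda>e. cinner x e * cinner e x' * cinner y y') has_sum cinner x x' * cinner y y') ?E"
    by (rule has_sum_cmult_left[OF parseval_cinner[OF closed_csubspace_UNIV E UNIV_I]])
  ultimately show ?thesis by (rule has_sum_unique)
qed

lemma closed_csubspace_Inter: "(\<And>S. S \<in> F \<Longrightarrow> closed_csubspace S) \<Longrightarrow> closed_csubspace (\<Inter>F)"
  by (auto simp: closed_csubspace_def)

lemma closed_csubspace_orthogonal: "closed_csubspace {z. cinner z y = 0}"
proof -
  have "closed {z. cinner z y = 0}"
    by (intro closed_Collect_eq continuous_intros
      bounded_linear.continuous_on[OF bounded_linear_cinner_left])
  then show ?thesis by (simp add: closed_csubspace_def cinner_simps)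
qed

text \<open>For totality, the vectors orthogonal to \<open>y\<close> form a closed subspace. If it
  contains all elementary tensors, it contains their hull and hence \<open>y\<close> itself.\<close>

lemma tensor_decomp_tensor_space:
  assumes A: "closed_csubspace A" and C: "closed_csubspace C"
  shows "tensor_decomp A C (tensor_space A C) tensor_vec"
proof
  let ?X = "{tensor_vec x y | x y. x \<in> A \<and> y \<in> C}"
  show "closed_csubspace (tensor_space A C)"
    unfolding tensor_space_def by (rule hull_in) (auto intro: closed_csubspace_Inter)
  show in_space: "tensor_vec x c \<in> tensor_space A C" if "x \<in> A" "c \<in> C" for x c
    unfolding tensor_space_def by (rule hull_inc) (use that in blast)
  fix y assume y: "y \<in> tensor_space A C" and orth: "\<And>x c. x \<in> A \<Longrightarrow> c \<in> C \<Longrightarrow> cinner (tensor_vec x c) y = 0"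
  have "tensor_space A C \<subseteq> {z. cinner z y = 0}"
    unfolding tensor_space_def
    by (rule hull_minimal) (use orth in \<open>auto simp: closed_csubspace_orthogonal\<close>)
  then have "cinner y y = 0" using y by blast
  then show "y = 0" by simp
qed (auto simp: A C cinner_tensor_vec)

text \<open>Resolves the definite description: \<open>(a \<otimes> 1)(1 \<otimes> b)\<close> exists
  as a product of lifts, and elementary tensors leave no other choice.\<close>

lemma tensor_op_eq:
  assumes A: "closed_csubspace A" and C: "closed_csubspace C"
    and a: "a \<in> bounded_op A" and b: "b \<in> bounded_op C"
  shows "tensor_op A C a b = compose (tensor_space A C)
    (tensor_decomp.lift C A (tensor_space A C) (\<lambda>c x. tensor_vec x c) a)
    (tensor_decomp.lift A C (tensor_space A C) tensor_vec b)"
proof -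
  interpret tensor_decomp A C "tensor_space A C" tensor_vec by (rule tensor_decomp_tensor_space[OF A C])
  have in_op: "compose (tensor_space A C) (lift_left a) (lift b) \<in> bounded_op (tensor_space A C)"
    by (intro bounded_op_compose B lift_left_in lift_in a b)
  have on_T: "compose (tensor_space A C) (lift_left a) (lift b) (tensor_vec x c) = tensor_vec (a x) (b c)"
    if "x \<in> A" "c \<in> C" for x c
    using that a b by (simp add: compose_eq T_in lift_T lift_left_T op_C_in)
  show ?thesis
    unfolding tensor_op_def
  proof (rule the_equality)
    fix g assume g: "g \<in> bounded_op (tensor_space A C) \<and>
      (\<forall>x\<in>A. \<forall>y\<in>C. g (tensor_vec x y) = tensor_vec (a x) (b y))"
    then show "g = compose (tensor_space A C) (lift_left a) (lift b)"
      using in_op by (intro op_eqI) (auto simp: on_T)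
  qed (use in_op on_T in auto)
qed

section \<open>The weak* topology\<close>

text \<open>Two such families represent the functional
  \<open>a \<mapsto> \<Sum>n. \<langle>u n, a (v n)\<rangle>\<close>. The index set is arbitrary
  because pulling a functional back along a lift produces families indexed by pairs.\<close>

definition sq_summable :: "'a::chilbert_space set \<Rightarrow> 'i set \<Rightarrow> ('i \<Rightarrow> 'a) \<Rightarrow> bool" where
  "sq_summable S N u \<longleftrightarrow> (\<forall>n\<in>N. u n \<in> S) \<and> (\<lambda>n. (norm (u n))\<^sup>2) summable_on N"

lemma sq_summable_in: "sq_summable S N u \<Longrightarrow> n \<in> N \<Longrightarrow> u n \<in> S"
  and sq_summable_summable: "sq_summable S N u \<Longrightarrow> (\<lambda>n. (norm (u n))\<^sup>2) summable_on N"
  by (auto simp: sq_summable_def)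

lemma mult_le_sum_squares: "x * y \<le> x\<^sup>2 + y\<^sup>2" for x y :: real
proof -
  have "0 \<le> (x - y)\<^sup>2 + x\<^sup>2 + y\<^sup>2" by simp
  then show ?thesis by (simp add: power2_diff)
qed

lemma sq_summable_mult:
  fixes f g :: "'i \<Rightarrow> real"
  assumes "(\<lambda>n. (f n)\<^sup>2) summable_on N" "(\<lambda>n. (g n)\<^sup>2) summable_on N" "\<And>n. n \<in> N \<Longrightarrow> f n * g n \<ge> 0"
  shows "(\<lambda>n. f n * g n) summable_on N"
  by (rule summable_on_comparison_test[OF summable_on_add[OF assms(1,2)]])
    (auto simp: mult_le_sum_squares assms(3))

lemma sq_summable_bop:
  assumes a: "bop S T a" and u: "sq_summable S N u"
  shows "sq_summable T N (\<lambda>n. a (u n))"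
proof -
  obtain K where K: "K \<ge> 0" "\<forall>x\<in>S. norm (a x) \<le> K * norm x" using bop_bound[OF a] by auto
  have "(\<lambda>n. (norm (a (u n)))\<^sup>2) summable_on N"
  proof (rule summable_on_comparison_test)
    show "(\<lambda>n. K\<^sup>2 * (norm (u n))\<^sup>2) summable_on N"
      by (rule summable_on_cmult_right[OF sq_summable_summable[OF u]])
    fix n assume "n \<in> N"
    then have "norm (a (u n)) \<le> K * norm (u n)" using K sq_summable_in[OF u] by simp
    then show "(norm (a (u n)))\<^sup>2 \<le> K\<^sup>2 * (norm (u n))\<^sup>2"
      using power_mono[of _ _ 2] by (fastforce simp flip: power_mult_distrib)
  qed simp
  then show ?thesis using sq_summable_in[OF u] bop_in[OF a] by (auto simp: sq_summable_def)
qed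

lemma sq_summable_cinner:
  assumes u: "sq_summable S N u" and v: "sq_summable S N v"
  shows "(\<lambda>n. cinner (u n) (v n)) summable_on N"
proof (rule abs_summable_summable, rule summable_on_comparison_test)
  show "(\<lambda>n. norm (u n) * norm (v n)) summable_on N"
    by (rule sq_summable_mult[OF sq_summable_summable[OF u] sq_summable_summable[OF v]]) simp
qed (simp_all add: cmod_cinner_le)

lemma sq_summable_form:
  assumes "sq_summable S N u" "sq_summable T N v" "bop T S a"
  shows "(\<lambda>n. cinner (u n) (a (v n))) summable_on N"
  by (rule sq_summable_cinner[OF assms(1) sq_summable_bop[OF assms(3,2)]])

lemma sq_summable_coeff:
  assumes S: "closed_csubspace S" and u: "sq_summable S N u"
  shows "(\<lambda>(n, e). (cmod (cinner e (u n)))\<^sup>2) summable_on N \<times> some_onb S"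
proof (rule summable_on_SigmaI[OF _ sq_summable_summable[OF u]])
  fix n assume "n \<in> N"
  then show "((\<lambda>e. case (n, e) of (n, e) \<Rightarrow> (cmod (cinner e (u n)))\<^sup>2) has_sum (norm (u n))\<^sup>2) (some_onb S)"
    using parseval[OF S is_onb_some_onb[OF S] sq_summable_in[OF u]] by simp
qed auto

section \<open>Functionals given by trace class operators\<close>

lemma hilbert_schmidt_iff:
  assumes S: "closed_csubspace S"
  shows "h \<in> hilbert_schmidt S \<longleftrightarrow> h \<in> bounded_op S \<and> sq_summable S (some_onb S) h"
  using is_onb_subset[OF is_onb_some_onb[OF S]] bop_in[OF bounded_op_bop]
  by (auto simp: hilbert_schmidt_def sq_summable_def)

text \<open>The matrix of the adjoint is the conjugate transpose, so exchanging the order of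
  summation shows that both have the same sum of squared entries.\<close>

lemma sq_summable_adj:
  assumes S: "closed_csubspace S" and h: "h \<in> bounded_op S" and u: "sq_summable S (some_onb S) h"
  shows "sq_summable S (some_onb S) (adj_op S h)"
proof -
  let ?E = "some_onb S"
  note E = is_onb_some_onb[OF S]
  have ES: "e \<in> S" if "e \<in> ?E" for e using is_onb_subset[OF E that] .
  have h': "adj_op S h e \<in> S" if "e \<in> ?E" for e
    using bop_in[OF bounded_op_bop[OF adj_op_in[OF S h]]] ES that by blast
  have "(\<lambda>(e, f). (cmod (cinner e (h f)))\<^sup>2) summable_on ?E \<times> ?E"
    using summable_on_swap[THEN iffD1, OF sq_summable_coeff[OF S u]] by simp
  then have "(\<lambda>(e, f). (cmod (cinner f (adj_op S h e)))\<^sup>2) summable_on ?E \<times> ?E"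
    by (rule summable_on_cong[THEN iffD1, rotated])
      (auto simp: adj_op_right[OF S h] ES cmod_cinner_flip)
  then have "(\<lambda>e. \<Sum>\<^sub>\<infinity>f\<in>?E. (cmod (cinner f (adj_op S h e)))\<^sup>2) summable_on ?E"
    using summable_on_Sigma_banach[where f = "\<lambda>e f. (cmod (cinner f (adj_op S h e)))\<^sup>2" and B = "\<lambda>_. ?E"] by simp
  then have "(\<lambda>e. (norm (adj_op S h e))\<^sup>2) summable_on ?E"
    by (rule summable_on_cong[THEN iffD1, rotated]) (simp add: infsumI[OF parseval[OF S E h']])
  then show ?thesis using h' by (simp add: sq_summable_def)
qed

text \<open>An instance of cyclicity, \<open>tr (h k a) = tr (k a h)\<close>. Both sides are the
  double sum of \<open>?G\<close> in the two possible orders, and the exchange is justified by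
  absolute summability.\<close>

lemma trace_product:
  assumes S: "closed_csubspace S" and h: "h \<in> hilbert_schmidt S" and k: "k \<in> hilbert_schmidt S"
    and a: "a \<in> bounded_op S"
  shows "trace S (compose S (compose S h k) a) = (\<Sum>\<^sub>\<infinity>f\<in>some_onb S. cinner (adj_op S k f) (a (h f)))"
proof -
  let ?E = "some_onb S"
  note E = is_onb_some_onb[OF S]
  have ES: "e \<in> S" if "e \<in> ?E" for e using is_onb_subset[OF E that] .
  have hb: "h \<in> bounded_op S" and hs: "sq_summable S ?E h" using h by (simp_all add: hilbert_schmidt_iff[OF S])
  have kb: "k \<in> bounded_op S" and ks: "sq_summable S ?E k" using k by (simp_all add: hilbert_schmidt_iff[OF S])
  note in_S = bop_in[OF bounded_op_bop]
  note adj_in = adj_op_in[OF S]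
  \<comment> \<open>Absorbing \<open>a\<close> and \<open>k\<close> into one square-summable family
    turns \<open>?G\<close> into a product of the entries of two square-summable matrices.\<close>
  let ?g = "\<lambda>f. adj_op S a (adj_op S k f)"
  have g: "sq_summable S ?E ?g"
    by (rule sq_summable_bop[OF bounded_op_bop[OF adj_in[OF a]] sq_summable_adj[OF S kb ks]])
  have gS: "?g f \<in> S" if "f \<in> ?E" for f using sq_summable_in[OF g that] .
  let ?G = "\<lambda>e f. cinner e (h f) * cinner (?g f) e"
  have "(\<lambda>(f, e). cmod (cinner e (h f)) * cmod (cinner e (?g f))) summable_on ?E \<times> ?E"
    using sq_summable_mult[of "\<lambda>(f, e). cmod (cinner e (h f))" "?E \<times> ?E" "\<lambda>(f, e). cmod (cinner e (?g f))"]
      sq_summable_coeff[OF S hs] sq_summable_coeff[OF S g] by (simp add: case_prod_unfold)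
  then have "(\<lambda>i. norm (case i of (f, e) \<Rightarrow> ?G e f)) summable_on ?E \<times> ?E"
    by (rule summable_on_cong[THEN iffD1, rotated]) (auto simp: norm_mult cmod_cinner_flip)
  then have "(\<lambda>(f, e). ?G e f) summable_on ?E \<times> ?E"
    by (rule abs_summable_summable)
  from infsum_swap_banach[OF this]
  have swap: "(\<Sum>\<^sub>\<infinity>f\<in>?E. \<Sum>\<^sub>\<infinity>e\<in>?E. ?G e f) = (\<Sum>\<^sub>\<infinity>e\<in>?E. \<Sum>\<^sub>\<infinity>f\<in>?E. ?G e f)" .
  have "cinner (adj_op S k f) (a (h f)) = (\<Sum>\<^sub>\<infinity>e\<in>?E. ?G e f)" if "f \<in> ?E" for f
    using infsumI[OF parseval_cinner[OF S E, of "h f" "?g f"]] ES[OF that]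
    by (simp add: in_S[OF hb] adj_op_left[OF S a] in_S[OF adj_in[OF kb]] mult.commute)
  moreover have "cinner e (compose S (compose S h k) a e) = (\<Sum>\<^sub>\<infinity>f\<in>?E. ?G e f)" if e: "e \<in> ?E" for e
  proof -
    have ke: "k (a e) \<in> S" "a e \<in> S" using ES[OF e] in_S[OF kb] in_S[OF a] by auto
    have "cinner e (compose S (compose S h k) a e) = cinner (adj_op S h e) (k (a e))"
      using e ES ke by (simp add: compose_eq adj_op_left[OF S hb])
    also have "\<dots> = (\<Sum>\<^sub>\<infinity>f\<in>?E. cinner (adj_op S h e) f * cinner f (k (a e)))"
      using infsumI[OF parseval_cinner[OF S E ke(1)]] by simp
    also have "\<dots> = (\<Sum>\<^sub>\<infinity>f\<in>?E. ?G e f)"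
      by (rule infsum_cong)
        (simp add: adj_op_left[OF S] a hb kb ES e in_S[OF a] in_S[OF adj_in[OF kb]])
    finally show ?thesis .
  qed
  ultimately show ?thesis
    unfolding trace_def using swap by (simp cong: infsum_cong)
qed

text \<open>For \<open>t\<close> a product of Hilbert-Schmidt operators \<open>h\<close> and
  \<open>k\<close>, \<open>trace_product\<close> gives \<open>v = h\<close>, with the adjoint of
  \<open>k\<close> as \<open>u\<close>.\<close>

lemma trace_class_form:
  assumes S: "closed_csubspace S" and t: "t \<in> trace_class S"
  shows "\<exists>u v. sq_summable S (some_onb S) u \<and> sq_summable S (some_onb S) v \<and>
    (\<forall>a\<in>bounded_op S. trace S (compose S t a) = (\<Sum>\<^sub>\<infinity>n\<in>some_onb S. cinner (u n) (a (v n))))"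
proof -
  obtain h k where "t = compose S h k" "h \<in> hilbert_schmidt S" "k \<in> hilbert_schmidt S"
    using t unfolding trace_class_def by blast
  then show ?thesis
    using sq_summable_adj[OF S, of k] trace_product[OF S, of h k]
    by (intro exI[of _ "adj_op S k"] exI[of _ h]) (simp add: hilbert_schmidt_iff[OF S])
qed

text \<open>Since \<open>w\<close> need not be orthogonal, the operator sending \<open>e\<close> to \<open>w e\<close> is obtained as the adjoint of
  \<open>y \<mapsto> (\<Sum>e. \<langle>w e, y\<rangle> e)\<close>, whose series is orthogonal.\<close>

lemma sq_summable_operator:
  assumes S: "closed_csubspace S" and w: "sq_summable S (some_onb S) w"
  shows "\<exists>k\<in>bounded_op S. \<forall>e\<in>some_onb S. adj_op S k e = w e"
proof -
  let ?E = "some_onb S"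
  note E = is_onb_some_onb[OF S]
  have ES: "e \<in> S" if "e \<in> ?E" for e using is_onb_subset[OF E that] .
  define k where "k y = (\<Sum>\<^sub>\<infinity>e\<in>?E. cinner (w e) y *\<^sub>C e)" for y
  define W where "W = (\<Sum>\<^sub>\<infinity>e\<in>?E. (norm (w e))\<^sup>2)"
  have W: "((\<lambda>e. (norm (w e))\<^sup>2) has_sum W) ?E"
    unfolding W_def by (rule has_sum_infsum[OF sq_summable_summable[OF w]])
  have W0: "0 \<le> W" unfolding W_def by (rule infsum_nonneg) simp
  have coeff_le: "(cmod (cinner (w e) y))\<^sup>2 \<le> (norm (w e))\<^sup>2 * (norm y)\<^sup>2" for e y
    using power_mono[OF cmod_cinner_le[of "w e" y], of 2] by (simp add: power_mult_distrib)
  have "(\<lambda>e. (cmod (cinner (w e) y))\<^sup>2) summable_on ?E" for y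
    by (rule summable_on_comparison_test[OF summable_on_cmult_left[OF sq_summable_summable[OF w]]])
      (auto intro: coeff_le)
  then have k_sum: "((\<lambda>e. cinner (w e) y *\<^sub>C e) has_sum k y) ?E" for y
    unfolding k_def by (intro has_sum_infsum onb_series_summable[OF E])
  have k_coeff: "cinner e (k y) = cinner (w e) y" if "e \<in> ?E" for e y
    by (rule onb_series_coeff[OF E that k_sum])
  have kS: "k y \<in> S" for y
    by (rule closed_csubspace_has_sum[OF S k_sum]) (rule closed_csubspace_scaleC[OF S ES])
  have "bop S S k"
  proof (rule bopI[where K = "sqrt W"])
    fix y
    have "(norm (k y))\<^sup>2 \<le> W * (norm y)\<^sup>2"
      by (rule has_sum_mono[OF parseval[OF S E kS] has_sum_cmult_left[OF W]])
        (simp add: k_coeff coeff_le)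
    also have "\<dots> = (sqrt W * norm y)\<^sup>2" using W0 by (simp add: power_mult_distrib)
    finally show "norm (k y) \<le> sqrt W * norm y" by (rule power2_le_imp_le) (simp add: W0)
  next
    fix x y show "k (x + y) = k x + k y"
      by (rule is_onb_eqI[OF E S]) (simp_all add: kS closed_csubspace_add[OF S] k_coeff cinner_simps)
  next
    fix c x show "k (c *\<^sub>C x) = c *\<^sub>C k x"
      by (rule is_onb_eqI[OF E S]) (simp_all add: kS closed_csubspace_scaleC[OF S] k_coeff cinner_simps)
  qed (rule kS)
  then have kb: "(\<lambda>y\<in>S. k y) \<in> bounded_op S" by (rule restrict_bounded_op[OF S])
  have "adj_op S (\<lambda>y\<in>S. k y) e = w e" if e: "e \<in> ?E" for e
  proof (rule subspace_eqI[OF S])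
    show "adj_op S (\<lambda>y\<in>S. k y) e \<in> S"
      using bop_in[OF bounded_op_bop[OF adj_op_in[OF S kb]]] ES[OF e] .
    show "w e \<in> S" by (rule sq_summable_in[OF w e])
    fix y assume y: "y \<in> S"
    show "cinner y (adj_op S (\<lambda>y\<in>S. k y) e) = cinner y (w e)"
      using k_coeff[OF e, of y] y ES[OF e] by (simp add: adj_op_right[OF S kb] cinner_eq_flip[of "k y"])
  qed
  with kb show ?thesis by blast
qed

text \<open>Square-summable families over a basis are the columns of Hilbert-Schmidt operators: with
  adjoints of \<open>k\<close> and \<open>l\<close> taking \<open>e\<close> to \<open>u e\<close>
  and \<open>v e\<close>, the product of the adjoint of \<open>l\<close> with \<open>k\<close> is
  the required trace class operator.\<close>

lemma trace_class_form_onb: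
  assumes S: "closed_csubspace S"
    and u: "sq_summable S (some_onb S) u" and v: "sq_summable S (some_onb S) v"
  shows "\<exists>t\<in>trace_class S. \<forall>a\<in>bounded_op S.
    trace S (compose S t a) = (\<Sum>\<^sub>\<infinity>n\<in>some_onb S. cinner (u n) (a (v n)))"
proof -
  let ?E = "some_onb S"
  have ES: "e \<in> S" if "e \<in> ?E" for e using is_onb_subset[OF is_onb_some_onb[OF S] that] .
  obtain k where k: "k \<in> bounded_op S" "\<forall>e\<in>?E. adj_op S k e = u e"
    using sq_summable_operator[OF S u] by blast
  obtain l where l: "l \<in> bounded_op S" "\<forall>e\<in>?E. adj_op S l e = v e"
    using sq_summable_operator[OF S v] by blast
  have cong: "sq_summable S ?E w \<Longrightarrow> \<forall>e\<in>?E. w' e = w e \<Longrightarrow> sq_summable S ?E w'" for w w'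
    by (simp add: sq_summable_def cong: summable_on_cong)
  have h: "adj_op S l \<in> hilbert_schmidt S"
    using adj_op_in[OF S l(1)] cong[OF v l(2)] by (simp add: hilbert_schmidt_iff[OF S])
  have "adj_op S (adj_op S k) = k"
    by (rule adj_op_eqI[OF S k(1)]) (simp add: adj_op_right[OF S k(1)])
  then have "sq_summable S ?E k"
    using sq_summable_adj[OF S adj_op_in[OF S k(1)] cong[OF u k(2)]] by simp
  then have "k \<in> hilbert_schmidt S" using k by (simp add: hilbert_schmidt_iff[OF S])
  then show ?thesis
    using h trace_product[OF S h \<open>k \<in> hilbert_schmidt S\<close>] k(2) l(2)
    unfolding trace_class_def
    by (intro bexI[of _ "compose S (adj_op S l) k"]) (auto cong: infsum_cong)
qed

lemma has_sum_sum:
  fixes f :: "'i \<Rightarrow> 'j \<Rightarrow> 'a::{topological_comm_monoid_add}"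
  assumes "finite F" "\<And>j. j \<in> F \<Longrightarrow> (f j has_sum s j) I"
  shows "((\<lambda>i. \<Sum>j\<in>F. f j i) has_sum (\<Sum>j\<in>F. s j)) I"
  using assms by (induction F) (auto intro: has_sum_add)

text \<open>A trace class operator only yields families indexed by a basis of \<open>S\<close>. An arbitrary index set is moved
  onto the basis by expanding each \<open>v n\<close> if the basis is finite, and by reindexing the countable
  support of \<open>u\<close> and \<open>v\<close> if it is infinite.\<close>

lemma normal_form_trace_class:
  assumes S: "closed_csubspace S" and u: "sq_summable S N u" and v: "sq_summable S N v"
  shows "\<exists>t\<in>trace_class S. \<forall>a\<in>bounded_op S. trace S (compose S t a) = (\<Sum>\<^sub>\<infinity>n\<in>N. cinner (u n) (a (v n)))"
proof (cases "finite (some_onb S)")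
  case True
  let ?E = "some_onb S"
  note E = is_onb_some_onb[OF S]
  have ES: "e \<in> S" if "e \<in> ?E" for e using is_onb_subset[OF E that] .
  \<comment> \<open>Collects all terms that multiply \<open>a e\<close> once \<open>v n\<close> has
    been expanded. The coefficient is \<open>cinner (v n) e\<close>, because the first argument of
    \<open>cinner\<close> is antilinear and conjugates it back to
    \<open>cinner e (v n)\<close>.\<close>
  define u' where "u' e = (\<Sum>\<^sub>\<infinity>n\<in>N. cinner (v n) e *\<^sub>C u n)" for e
  have u': "((\<lambda>n. cinner (v n) e *\<^sub>C u n) has_sum u' e) N" for e
    unfolding u'_def
  proof (rule has_sum_infsum, rule abs_summable_summable, rule summable_on_comparison_test)
    show "(\<lambda>n. norm e * (norm (v n) * norm (u n))) summable_on N"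
      by (intro summable_on_cmult_right sq_summable_mult sq_summable_summable[OF u] sq_summable_summable[OF v]) simp
    show "norm (cinner (v n) e *\<^sub>C u n) \<le> norm e * (norm (v n) * norm (u n))" for n
      using mult_right_mono[OF cmod_cinner_le[of "v n" e], of "norm (u n)"] by (simp add: mult_ac)
  qed simp
  have u'S: "u' e \<in> S" for e
    by (rule closed_csubspace_has_sum[OF S u']) (rule closed_csubspace_scaleC[OF S sq_summable_in[OF u]])
  obtain t where t: "t \<in> trace_class S"
    "\<forall>a\<in>bounded_op S. trace S (compose S t a) = (\<Sum>\<^sub>\<infinity>e\<in>?E. cinner (u' e) (a e))"
    using trace_class_form_onb[OF S, of u' "\<lambda>e. e"] True ES u'S by (auto simp: sq_summable_def)
  have "(\<Sum>\<^sub>\<infinity>n\<in>N. cinner (u n) (a (v n))) = (\<Sum>\<^sub>\<infinity>e\<in>?E. cinner (u' e) (a e))" if a: "a \<in> bounded_op S" for a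
  proof (rule infsumI)
    have "((\<lambda>n. cinner (cinner (v n) e *\<^sub>C u n) (a e)) has_sum cinner (u' e) (a e)) N" for e
      by (rule has_sum_cinner_left[OF u'])
    then have "((\<lambda>n. cinner e (v n) * cinner (u n) (a e)) has_sum cinner (u' e) (a e)) N" for e
      by (simp add: cinner_scaleC_left flip: cinner_commute)
    then have "((\<lambda>n. \<Sum>e\<in>?E. cinner e (v n) * cinner (u n) (a e)) has_sum (\<Sum>e\<in>?E. cinner (u' e) (a e))) N"
      by (intro has_sum_sum True)
    moreover have "cinner (u n) (a (v n)) = (\<Sum>e\<in>?E. cinner e (v n) * cinner (u n) (a e))" if "n \<in> N" for n
    proof -
      have "((\<lambda>e. a (cinner e (v n) *\<^sub>C e)) has_sum a (v n)) ?E"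
        by (rule bop_has_sum[OF S bounded_op_bop[OF a] _ onb_expansion[OF S E sq_summable_in[OF v that]]])
          (rule closed_csubspace_scaleC[OF S ES])
      from has_sum_cinner_right[OF this, of "u n"]
      have "cinner (u n) (a (v n)) = (\<Sum>e\<in>?E. cinner (u n) (a (cinner e (v n) *\<^sub>C e)))"
        using True by (simp add: has_sum_finite_iff)
      then show ?thesis by (simp add: bop_scaleC[OF bounded_op_bop[OF a]] ES cinner_scaleC_right)
    qed
    ultimately show "((\<lambda>n. cinner (u n) (a (v n))) has_sum (\<Sum>\<^sub>\<infinity>e\<in>?E. cinner (u' e) (a e))) N"
      unfolding infsum_finite[OF True]
      by (simp cong: has_sum_cong)
  qed
  then show ?thesis using t by auto
next
  case False
  let ?E = "some_onb S"
  \<comment> \<open>A summable real family has countable support, and an index outside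
    \<open>M\<close> contributes nothing to the functional.\<close>
  define M where "M = {n\<in>N. (norm (u n))\<^sup>2 \<noteq> 0} \<union> {n\<in>N. (norm (v n))\<^sup>2 \<noteq> 0}"
  have "countable M"
    unfolding M_def
    by (intro countable_Un summable_countable_real sq_summable_summable[OF u] sq_summable_summable[OF v])
  obtain f :: "nat \<Rightarrow> 'a" where f: "inj f" "range f \<subseteq> ?E" using infinite_countable_subset[OF False] by blast
  define g where "g = f \<circ> to_nat_on M"
  have g: "inj_on g M" "g ` M \<subseteq> ?E"
    unfolding g_def using f inj_on_to_nat_on[OF \<open>countable M\<close>]
    by (auto intro!: comp_inj_on inj_on_subset[of f UNIV])
  define spread where "spread w e = (if e \<in> g ` M then w (inv_into M g e) else 0)" for w :: "'b \<Rightarrow> 'a" and e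
  have spread_g: "spread w (g n) = w n" if "n \<in> M" for w n
    using that g by (simp add: spread_def)
  have sq: "sq_summable S ?E (spread w)" if w: "sq_summable S N w" for w
  proof -
    have "(\<lambda>n. (norm (w n))\<^sup>2) summable_on M"
      by (rule summable_on_subset_banach[OF sq_summable_summable[OF w]]) (auto simp: M_def)
    then have "(\<lambda>n. (norm (spread w (g n)))\<^sup>2) summable_on M"
      by (rule summable_on_cong[THEN iffD1, rotated]) (simp add: spread_g)
    then have "(\<lambda>e. (norm (spread w e))\<^sup>2) summable_on (g ` M)"
      by (simp add: summable_on_reindex[OF g(1)] o_def)
    then have "(\<lambda>e. (norm (spread w e))\<^sup>2) summable_on ?E"
      by (rule summable_on_cong_neutral[THEN iffD1, rotated -1]) (use g in \<open>auto simp: spread_def\<close>)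
    moreover have "spread w e \<in> S" for e
      using sq_summable_in[OF w] closed_csubspace_zero[OF S] inv_into_into[of e g M]
      by (auto simp: spread_def M_def)
    ultimately show ?thesis by (simp add: sq_summable_def)
  qed
  have "(\<Sum>\<^sub>\<infinity>e\<in>?E. cinner (spread u e) (a (spread v e))) = (\<Sum>\<^sub>\<infinity>n\<in>N. cinner (u n) (a (v n)))"
    if a: "a \<in> bounded_op S" for a
  proof -
    have "(\<Sum>\<^sub>\<infinity>e\<in>?E. cinner (spread u e) (a (spread v e))) = (\<Sum>\<^sub>\<infinity>e\<in>g ` M. cinner (spread u e) (a (spread v e)))"
      by (rule infsum_cong_neutral) (use g in \<open>auto simp: spread_def\<close>)
    also have "\<dots> = (\<Sum>\<^sub>\<infinity>n\<in>M. cinner (u n) (a (v n)))"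
      unfolding infsum_reindex[OF g(1)] by (rule infsum_cong) (simp add: spread_g)
    also have "\<dots> = (\<Sum>\<^sub>\<infinity>n\<in>N. cinner (u n) (a (v n)))"
      by (rule infsum_cong_neutral) (auto simp: M_def)
    finally show ?thesis .
  qed
  then show ?thesis using trace_class_form_onb[OF S sq[OF u] sq[OF v]] by auto
qed

section \<open>A criterion for weak* continuity\<close>

lemma topspace_weak_star:
  assumes S: "closed_csubspace S"
  shows "topspace (weak_star_topology S) = bounded_op S"
proof -
  \<comment> \<open>The carrier of a generated topology is the union of the generating sets. One
    trace class operator, here a representative of the zero functional, contributes all of
    \<open>bounded_op S\<close> through \<open>U = UNIV\<close>.\<close>
  obtain t where "t \<in> trace_class S"
    using normal_form_trace_class[OF S, of "{} :: nat set" "\<lambda>_. 0" "\<lambda>_. 0"] by (auto simp: sq_summable_def)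
  then have "bounded_op S \<in> {{a \<in> bounded_op S. trace S (compose S t a) \<in> U} | t U. t \<in> trace_class S \<and> open U}"
    by (intro CollectI exI[of _ t] exI[of _ UNIV]) simp
  then show ?thesis unfolding weak_star_topology_def topology_generated_by_topspace by blast
qed

text \<open>If functionals pull back to functionals of the same kind, preimages of subbasic sets are
  subbasic. The free index type \<open>'i\<close> lets each application choose its own
  families.\<close>

lemma continuous_weak_star:
  assumes A: "closed_csubspace A" and B: "closed_csubspace B"
    and F: "F \<in> bounded_op A \<rightarrow> bounded_op B"
    and normal: "\<And>u v. sq_summable B (some_onb B) u \<Longrightarrow> sq_summable B (some_onb B) v \<Longrightarrow>
      \<exists>(N :: 'i set) u' v'. sq_summable A N u' \<and> sq_summable A N v' \<and>
        (\<forall>a\<in>bounded_op A. (\<Sum>\<^sub>\<infinity>n\<in>some_onb B. cinner (u n) (F a (v n))) = (\<Sum>\<^sub>\<infinity>n\<in>N. cinner (u' n) (a (v' n))))"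
  shows "continuous_map (weak_star_topology A) (weak_star_topology B) F"
  unfolding weak_star_topology_def[of B]
proof (rule continuous_on_generated_topo, goal_cases)
  case (1 V)
  then obtain t U where V: "V = {b \<in> bounded_op B. trace B (compose B t b) \<in> U}"
    and t: "t \<in> trace_class B" and U: "open U" by blast
  obtain u v where uv: "sq_summable B (some_onb B) u" "sq_summable B (some_onb B) v"
    "\<forall>b\<in>bounded_op B. trace B (compose B t b) = (\<Sum>\<^sub>\<infinity>n\<in>some_onb B. cinner (u n) (b (v n)))"
    using trace_class_form[OF B t] by blast
  obtain N :: "'i set" and u' v' where uv': "sq_summable A N u'" "sq_summable A N v'"
    "\<forall>a\<in>bounded_op A. (\<Sum>\<^sub>\<infinity>n\<in>some_onb B. cinner (u n) (F a (v n))) = (\<Sum>\<^sub>\<infinity>n\<in>N. cinner (u' n) (a (v' n)))"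
    using normal[OF uv(1,2)] by blast
  obtain s where s: "s \<in> trace_class A"
    "\<forall>a\<in>bounded_op A. trace A (compose A s a) = (\<Sum>\<^sub>\<infinity>n\<in>N. cinner (u' n) (a (v' n)))"
    using normal_form_trace_class[OF A uv'(1,2)] by blast
  have "F -` V \<inter> bounded_op A = {a \<in> bounded_op A. trace A (compose A s a) \<in> U}"
    using F uv(3) uv'(3) s(2) unfolding V by (auto simp: Pi_iff)
  moreover have "openin (weak_star_topology A) {a \<in> bounded_op A. trace A (compose A s a) \<in> U}"
    unfolding weak_star_topology_def by (rule topology_generated_by_Basis) (use s U in blast)
  ultimately show ?case by (simp add: topspace_weak_star[OF A])
next
  case 2
  then show ?case
    using F topspace_weak_star[OF A] topspace_weak_star[OF B]
    unfolding weak_star_topology_def[of B] topology_generated_by_topspace by auto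
qed

section \<open>Registers\<close>

lemma register_in: "register A B F \<Longrightarrow> a \<in> bounded_op A \<Longrightarrow> F a \<in> bounded_op B"
  and register_plus: "register A B F \<Longrightarrow> a \<in> bounded_op A \<Longrightarrow> b \<in> bounded_op A \<Longrightarrow>
    F (\<lambda>x\<in>A. a x + b x) = (\<lambda>y\<in>B. F a y + F b y)"
  and register_scaleC: "register A B F \<Longrightarrow> a \<in> bounded_op A \<Longrightarrow>
    F (\<lambda>x\<in>A. c *\<^sub>C a x) = (\<lambda>y\<in>B. c *\<^sub>C F a y)"
  and register_continuous: "register A B F \<Longrightarrow>
    continuous_map (weak_star_topology A) (weak_star_topology B) F"
  and register_id: "register A B F \<Longrightarrow> F (\<lambda>x\<in>A. x) = (\<lambda>y\<in>B. y)"
  and register_compose: "register A B F \<Longrightarrow> a \<in> bounded_op A \<Longrightarrow> b \<in> bounded_op A \<Longrightarrow>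
    F (compose A a b) = compose B (F a) (F b)"
  and register_adj: "register A B F \<Longrightarrow> a \<in> bounded_op A \<Longrightarrow> F (adj_op A a) = adj_op B (F a)"
  by (auto simp: register_def)

lemma compose_id_left: "g \<in> bounded_op S \<Longrightarrow> compose S (\<lambda>x\<in>S. x) g = g"
  by (rule extensionalityI[of _ S])
    (auto simp: bounded_op_iff compose_eq bop_in)

lemma compose_id_right: "g \<in> bounded_op S \<Longrightarrow> compose S g (\<lambda>x\<in>S. x) = g"
  by (rule extensionalityI[of _ S]) (auto simp: bounded_op_iff compose_eq)

lemma bounded_op_zero: "closed_csubspace S \<Longrightarrow> (\<lambda>x\<in>S. 0) \<in> bounded_op S"
  using bounded_op_cmult[OF _ bounded_op_id, of S 0] by (simp cong: restrict_cong)

lemma register_zero: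
  assumes "closed_csubspace A" "register A B F"
  shows "F (\<lambda>x\<in>A. 0) = (\<lambda>y\<in>B. 0)"
  using register_scaleC[OF assms(2) bounded_op_id[OF assms(1)], of 0] by (simp cong: restrict_cong)

lemma bop_zero: "closed_csubspace S \<Longrightarrow> bop S T a \<Longrightarrow> a 0 = 0"
  using bop_scaleC[of S T a 0 0] closed_csubspace_zero[of S] by simp

lemma exists_unit:
  assumes "closed_csubspace A" "A \<noteq> {0}"
  shows "\<exists>e\<in>A. norm e = 1"
proof -
  obtain x where x: "x \<in> A" "x \<noteq> 0" using assms closed_csubspace_zero[of A] by auto
  then have "complex_of_real (inverse (norm x)) *\<^sub>C x \<in> A"
    "norm (complex_of_real (inverse (norm x)) *\<^sub>C x) = 1"
    by (simp_all only: closed_csubspace_scaleC[OF assms(1)] norm_scaleC norm_of_real) simp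
  then show ?thesis by blast
qed

section \<open>Normality of lifts and compressions\<close>

context tensor_decomp
begin

text \<open>By \<open>lift_form\<close> the functional given by \<open>u\<close> and
  \<open>v\<close> pulls back to the one given by their slices, indexed by pairs
  \<open>(n, e)\<close>. These are square-summable because, by \<open>slice_parseval\<close>, the
  slices of a vector carry its whole norm.\<close>

lemma register_lift: "register C B lift"
proof -
  have lift_fun: "lift \<in> bounded_op C \<rightarrow> bounded_op B" using lift_in by blast
  have "continuous_map (weak_star_topology C) (weak_star_topology B) lift"
  proof (rule continuous_weak_star[OF C B lift_fun])
    fix u v assume u: "sq_summable B (some_onb B) u" and v: "sq_summable B (some_onb B) v"
    let ?N = "some_onb B \<times> some_onb A"
    have sq: "sq_summable C ?N (\<lambda>(n, e). slice e (w n))" if w: "sq_summable B (some_onb B) w" for w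
    proof -
      have "(\<lambda>(n, e). (norm (slice e (w n)))\<^sup>2) summable_on ?N"
      proof (rule summable_on_SigmaI[OF _ sq_summable_summable[OF w]])
        fix n assume "n \<in> some_onb B"
        then show "((\<lambda>e. case (n, e) of (n, e) \<Rightarrow> (norm (slice e (w n)))\<^sup>2) has_sum (norm (w n))\<^sup>2) (some_onb A)"
          using slice_parseval[OF sq_summable_in[OF w]] by simp
      qed auto
      then show ?thesis by (auto simp: sq_summable_def case_prod_unfold slice_in some_onb_A(2))
    qed
    have "(\<Sum>\<^sub>\<infinity>n\<in>some_onb B. cinner (u n) (lift b (v n))) =
        (\<Sum>\<^sub>\<infinity>i\<in>?N. cinner ((\<lambda>(n, e). slice e (u n)) i) (b ((\<lambda>(n, e). slice e (v n)) i)))"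
      if b: "b \<in> bounded_op C" for b
    proof -
      have "(\<Sum>\<^sub>\<infinity>i\<in>?N. cinner ((\<lambda>(n, e). slice e (u n)) i) (b ((\<lambda>(n, e). slice e (v n)) i))) =
          (\<Sum>\<^sub>\<infinity>n\<in>some_onb B. \<Sum>\<^sub>\<infinity>e\<in>some_onb A. cinner (slice e (u n)) (b (slice e (v n))))"
        using infsum_Sigma'_banach[where B = "\<lambda>_. some_onb A" and
            f = "\<lambda>n e. cinner (slice e (u n)) (b (slice e (v n)))" and A = "some_onb B"]
          sq_summable_form[OF sq[OF u] sq[OF v] bounded_op_bop[OF b]]
        by (simp add: case_prod_unfold)
      also have "\<dots> = (\<Sum>\<^sub>\<infinity>n\<in>some_onb B. cinner (u n) (lift b (v n)))"
        by (intro infsum_cong infsumI lift_form b sq_summable_in[OF u] sq_summable_in[OF v])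
      finally show ?thesis by simp
    qed
    then show "\<exists>(N :: ('b \<times> 'a) set) u' v'. sq_summable C N u' \<and> sq_summable C N v' \<and>
        (\<forall>b\<in>bounded_op C. (\<Sum>\<^sub>\<infinity>n\<in>some_onb B. cinner (u n) (lift b (v n))) = (\<Sum>\<^sub>\<infinity>n\<in>N. cinner (u' n) (b (v' n))))"
      using sq[OF u] sq[OF v] by blast
  qed
  then show ?thesis
    unfolding register_def
    using lift_fun lift_plus lift_scaleC lift_id lift_compose lift_adj by blast
qed

text \<open>Here the families are pushed forward along \<open>T e\<close>. This supplies the
  continuity of the equivalence between two complements.\<close>

lemma continuous_compress:
  assumes e: "e \<in> A"
  shows "continuous_map (weak_star_topology B) (weak_star_topology C) (compress e)"
proof (rule continuous_weak_star[OF B C])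
  show "compress e \<in> bounded_op B \<rightarrow> bounded_op C" using compress_in[OF e] by blast
  fix u v assume u: "sq_summable C (some_onb C) u" and v: "sq_summable C (some_onb C) v"
  have "(\<Sum>\<^sub>\<infinity>n\<in>some_onb C. cinner (u n) (compress e g (v n))) =
      (\<Sum>\<^sub>\<infinity>n\<in>some_onb C. cinner (T e (u n)) (g (T e (v n))))" for g
    by (intro infsum_cong compress_form e sq_summable_in[OF u] sq_summable_in[OF v])
  then show "\<exists>(N :: 'c set) u' v'. sq_summable B N u' \<and> sq_summable B N v' \<and>
      (\<forall>g\<in>bounded_op B. (\<Sum>\<^sub>\<infinity>n\<in>some_onb C. cinner (u n) (compress e g (v n))) = (\<Sum>\<^sub>\<infinity>n\<in>N. cinner (u' n) (g (v' n))))"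
    using sq_summable_bop[OF bop_T[OF e] u] sq_summable_bop[OF bop_T[OF e] v] by blast
qed

end

section \<open>Conjugation by a unitary\<close>

lemma register_unitary:
  assumes S: "closed_csubspace S" and B: "closed_csubspace B"
    and U: "bop S B U" and V: "bop B S V"
    and VU: "\<And>x. x \<in> S \<Longrightarrow> V (U x) = x" and UV: "\<And>y. y \<in> B \<Longrightarrow> U (V y) = y"
    and adj: "\<And>x y. x \<in> S \<Longrightarrow> y \<in> B \<Longrightarrow> cinner (V y) x = cinner y (U x)"
  shows "register S B (\<lambda>g. \<lambda>y\<in>B. U (g (V y)))" (is "register S B ?P")
proof -
  note Vin = bop_in[OF V] and Uin = bop_in[OF U]
  note in_S = bop_in[OF bounded_op_bop]
  have P_in: "?P g \<in> bounded_op B" if "g \<in> bounded_op S" for g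
    by (rule restrict_bounded_op[OF B bop_comp[OF U bop_comp[OF bounded_op_bop[OF that] V]]])
  have "continuous_map (weak_star_topology S) (weak_star_topology B) ?P"
  proof (rule continuous_weak_star[OF S B])
    show "?P \<in> bounded_op S \<rightarrow> bounded_op B" using P_in by blast
    fix u v assume u: "sq_summable B (some_onb B) u" and v: "sq_summable B (some_onb B) v"
    have "(\<Sum>\<^sub>\<infinity>n\<in>some_onb B. cinner (u n) (?P g (v n))) =
        (\<Sum>\<^sub>\<infinity>n\<in>some_onb B. cinner (V (u n)) (g (V (v n))))" if "g \<in> bounded_op S" for g
      by (rule infsum_cong)
        (simp add: adj sq_summable_in[OF u] sq_summable_in[OF v] in_S[OF that] Vin)
    then show "\<exists>(N :: 'b set) u' v'. sq_summable S N u' \<and> sq_summable S N v' \<and>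
        (\<forall>g\<in>bounded_op S. (\<Sum>\<^sub>\<infinity>n\<in>some_onb B. cinner (u n) (?P g (v n))) = (\<Sum>\<^sub>\<infinity>n\<in>N. cinner (u' n) (g (v' n))))"
      using sq_summable_bop[OF V u] sq_summable_bop[OF V v] by blast
  qed
  moreover have "?P (\<lambda>x\<in>S. a x + b x) = (\<lambda>y\<in>B. ?P a y + ?P b y)"
    if "a \<in> bounded_op S" "b \<in> bounded_op S" for a b
    by (rule restrict_ext) (simp add: Vin bop_add[OF U] in_S that)
  moreover have "?P (\<lambda>x\<in>S. c *\<^sub>C a x) = (\<lambda>y\<in>B. c *\<^sub>C ?P a y)" if "a \<in> bounded_op S" for a c
    by (rule restrict_ext) (simp add: Vin bop_scaleC[OF U] in_S that)
  moreover have "?P (\<lambda>x\<in>S. x) = (\<lambda>y\<in>B. y)"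
    by (rule restrict_ext) (simp add: Vin UV)
  moreover have "?P (compose S a b) = compose B (?P a) (?P b)"
    if "a \<in> bounded_op S" "b \<in> bounded_op S" for a b
    unfolding compose_def by (rule restrict_ext) (simp add: Vin Uin VU in_S that)
  moreover have "?P (adj_op S a) = adj_op B (?P a)" if a: "a \<in> bounded_op S" for a
  proof (rule adj_op_eqI[OF B, symmetric])
    show "?P (adj_op S a) \<in> bounded_op B" by (rule P_in[OF adj_op_in[OF S a]])
    fix x y assume x: "x \<in> B" and y: "y \<in> B"
    have "cinner (U (adj_op S a (V x))) y = cinner (adj_op S a (V x)) (V y)"
      using adj[of "adj_op S a (V x)" y] y in_S[OF adj_op_in[OF S a] Vin[OF x]]
      by (subst cinner_eq_flip) simp
    also have "\<dots> = cinner x (U (a (V y)))"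
      using x y by (simp add: adj_op_left[OF S a] Vin adj in_S[OF a])
    finally show "cinner (?P (adj_op S a) x) y = cinner x (?P a y)" using x y by simp
  qed
  ultimately show ?thesis unfolding register_def using P_in by blast
qed

text \<open>The hypotheses say that \<open>V\<close> is both the inverse and the adjoint of
  \<open>U\<close>; they are symmetric, so the inverse register is conjugation with the two
  exchanged.\<close>

lemma iso_register_unitary:
  assumes S: "closed_csubspace S" and B: "closed_csubspace B"
    and U: "bop S B U" and V: "bop B S V"
    and VU: "\<And>x. x \<in> S \<Longrightarrow> V (U x) = x" and UV: "\<And>y. y \<in> B \<Longrightarrow> U (V y) = y"
    and adj: "\<And>x y. x \<in> S \<Longrightarrow> y \<in> B \<Longrightarrow> cinner (V y) x = cinner y (U x)"
  shows "iso_register S B (\<lambda>g. \<lambda>y\<in>B. U (g (V y)))"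
proof -
  have adj': "cinner (U x) y = cinner x (V y)" if "y \<in> B" "x \<in> S" for x y
    using adj[OF that(2,1)] by (subst cinner_eq_flip) simp
  have "(\<lambda>y\<in>B. U ((\<lambda>x\<in>S. V (b (U x))) (V y))) = b" if "b \<in> bounded_op B" for b
    by (rule extensionalityI[of _ B])
      (use that in \<open>auto simp: bounded_op_iff bop_in[OF V] UV bop_in\<close>)
  moreover have "(\<lambda>x\<in>S. V ((\<lambda>y\<in>B. U (a (V y))) (U x))) = a" if "a \<in> bounded_op S" for a
    by (rule extensionalityI[of _ S])
      (use that in \<open>auto simp: bounded_op_iff bop_in[OF U] VU bop_in\<close>)
  ultimately show ?thesis
    unfolding iso_register_def
    using register_unitary[OF S B U V VU UV adj] register_unitary[OF B S V U UV VU adj']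
    by (intro conjI exI[of _ "\<lambda>b. \<lambda>x\<in>S. V (b (U x))"]) auto
qed

text \<open>Extracts a matrix coefficient of \<open>g\<close> using products and a scalar multiple
  only, operations that every register respects.\<close>

lemma ketbra_sandwich:
  assumes S: "closed_csubspace S" and g: "g \<in> bounded_op S" and v: "v \<in> S" and w: "w \<in> S"
  shows "compose S (ketbra S v v) (compose S g (ketbra S w w)) =
    (\<lambda>u\<in>S. cinner v (g w) *\<^sub>C ketbra S v w u)"
  using compose_ketbra[OF S g w] compose_ketbra_ketbra[OF S bop_in[OF bounded_op_bop[OF g] w]]
  by simp

text \<open>Sandwiching \<open>g\<close> between rank-one operators, which are elementary tensors, determines \<open>R g\<close>. Hence a
  pair is unique even without continuity.\<close>

lemma pair_coefficients:
  assumes D: "tensor_decomp A C B T" and F: "\<And>a. a \<in> bounded_op A \<Longrightarrow> F a = tensor_decomp.lift C A B (\<lambda>c x. T x c) a"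
    and R: "is_pair A C B F (tensor_decomp.lift A C B T) R"
    and g: "g \<in> bounded_op (tensor_space A C)"
    and x: "x \<in> A" and c: "c \<in> C" and z: "z \<in> A" and d: "d \<in> C"
  shows "cinner (T z d) (R g (T x c)) = cinner (tensor_vec z d) (g (tensor_vec x c))"
proof (cases "T z d = 0 \<or> T x c = 0")
  case True
  interpret T: tensor_decomp A C B T by (rule D)
  interpret t: tensor_decomp A C "tensor_space A C" tensor_vec by (rule tensor_decomp_tensor_space[OF T.A T.C])
  have Rg: "R g \<in> bounded_op B" using R g unfolding is_pair_def by (blast intro: register_in)
  \<comment> \<open>A zero vector gives a zero rank-one operator, from which no coefficient can be
    read. In this case both sides vanish, since elementary vectors have equal norms in the two
    decompositions.\<close>
  have "norm (T z d) = norm (tensor_vec z d)" "norm (T x c) = norm (tensor_vec x c)"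
    using x c z d by (simp_all add: T.norm_T t.norm_T)
  then show ?thesis
    using True bop_zero[OF T.B bounded_op_bop[OF Rg]] bop_zero[OF t.B bounded_op_bop[OF g]] by auto
next
  case False
  interpret T: tensor_decomp A C B T by (rule D)
  let ?S = "tensor_space A C"
  interpret t: tensor_decomp A C ?S tensor_vec by (rule tensor_decomp_tensor_space[OF T.A T.C])
  have R_reg: "register ?S B R" using R unfolding is_pair_def by blast
  have R_ketbra: "R (ketbra ?S (tensor_vec z d) (tensor_vec x c)) = ketbra B (T z d) (T x c)"
    if "z \<in> A" "d \<in> C" "x \<in> A" "c \<in> C" for z d x c
  proof -
    have "R (ketbra ?S (tensor_vec z d) (tensor_vec x c)) = R (tensor_op A C (ketbra A z x) (ketbra C d c))"
      using that by (simp add: tensor_op_eq T.A T.C ketbra_in t.lift_ketbra_ketbra)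
    also have "\<dots> = compose B (F (ketbra A z x)) (T.lift (ketbra C d c))"
      using R that unfolding is_pair_def by (simp add: ketbra_in T.A T.C)
    also have "\<dots> = ketbra B (T z d) (T x c)"
      using that by (simp add: F ketbra_in T.A T.lift_ketbra_ketbra)
    finally show ?thesis .
  qed
  let ?zd = "tensor_vec z d" and ?xc = "tensor_vec x c"
  have vecs: "?zd \<in> ?S" "?xc \<in> ?S" "T z d \<in> B" "T x c \<in> B"
    using x c z d by (simp_all add: t.T_in T.T_in)
  have kets: "ketbra ?S v w \<in> bounded_op ?S" if "v \<in> ?S" for v w
    by (rule ketbra_in[OF t.B that])
  have "(\<lambda>u\<in>B. cinner (T z d) (R g (T x c)) *\<^sub>C ketbra B (T z d) (T x c) u) =
      compose B (R (ketbra ?S ?zd ?zd)) (compose B (R g) (R (ketbra ?S ?xc ?xc)))"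
    by (simp add: R_ketbra x c z d vecs ketbra_sandwich[OF T.B register_in[OF R_reg g]])
  also have "\<dots> = R (compose ?S (ketbra ?S ?zd ?zd) (compose ?S g (ketbra ?S ?xc ?xc)))"
    by (simp add: register_compose[OF R_reg] kets vecs g bounded_op_compose[OF t.B])
  also have "\<dots> = R (\<lambda>u\<in>?S. cinner ?zd (g ?xc) *\<^sub>C ketbra ?S ?zd ?xc u)"
    by (simp add: ketbra_sandwich[OF t.B g] vecs)
  also have "\<dots> = (\<lambda>u\<in>B. cinner ?zd (g ?xc) *\<^sub>C ketbra B (T z d) (T x c) u)"
    unfolding register_scaleC[OF R_reg kets[OF vecs(1)]] R_ketbra[OF z d x c] ..
  finally have eq: "(\<lambda>u\<in>B. cinner (T z d) (R g (T x c)) *\<^sub>C ketbra B (T z d) (T x c) u) =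
      (\<lambda>u\<in>B. cinner ?zd (g ?xc) *\<^sub>C ketbra B (T z d) (T x c) u)" .
  have "cinner (T z d) (R g (T x c)) *\<^sub>C ketbra B (T z d) (T x c) (T x c) =
      cinner ?zd (g ?xc) *\<^sub>C ketbra B (T z d) (T x c) (T x c)"
    using fun_cong[OF eq, of "T x c"] by (simp only: restrict_apply' vecs)
  then have "(cinner (T z d) (R g (T x c)) * cinner (T x c) (T x c)) *\<^sub>C T z d =
      (cinner ?zd (g ?xc) * cinner (T x c) (T x c)) *\<^sub>C T z d"
    using vecs by (simp add: ketbra_apply scaleC_scaleC)
  then have "cinner (T z d) ((cinner (T z d) (R g (T x c)) * cinner (T x c) (T x c)) *\<^sub>C T z d) =
      cinner (T z d) ((cinner ?zd (g ?xc) * cinner (T x c) (T x c)) *\<^sub>C T z d)"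
    by simp
  then show ?thesis using False by (simp add: cinner_scaleC_right)
qed

text \<open>The pair is conjugation by the unitary that carries \<open>tensor_vec x c\<close> to
  \<open>T x c\<close>, hence an iso-register. The pairing property is checked on elementary
  vectors, and \<open>pair_coefficients\<close> gives every other pair the same
  coefficients.\<close>

lemma complements_lift:
  assumes D: "tensor_decomp A C B T" and F: "register A B F"
    and FT: "\<And>a x c. a \<in> bounded_op A \<Longrightarrow> x \<in> A \<Longrightarrow> c \<in> C \<Longrightarrow> F a (T x c) = T (a x) c"
  shows "complements A C B F (tensor_decomp.lift A C B T)"
proof -
  interpret T: tensor_decomp A C B T by (rule D)
  let ?S = "tensor_space A C"
  interpret t: tensor_decomp A C ?S tensor_vec by (rule tensor_decomp_tensor_space[OF T.A T.C])
  have F_eq: "F a = T.lift_left a" if "a \<in> bounded_op A" for a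
    using that register_in[OF F that] by (intro T.lift_left_eqI) (simp_all add: FT)
  let ?U = "amp A C tensor_vec T (\<lambda>x. x)" and ?V = "amp A C T tensor_vec (\<lambda>x. x)"
  define P where "P g = (\<lambda>y\<in>B. ?U (g (?V y)))" for g
  note t' = t.tensor_decomp_axioms
  have U: "bop ?S B ?U" by (rule t.bop_amp[OF D bop_id])
  have V: "bop B ?S ?V" by (rule T.bop_amp[OF t' bop_id])
  have iso: "iso_register ?S B P"
    unfolding P_def
    by (rule iso_register_unitary[OF t.B T.B U V]) (rule amp_inverse[OF t' D] amp_inverse[OF D t'] amp_adjoint[OF t' D], assumption+)+
  then have P: "register ?S B P" unfolding iso_register_def by blast
  have pair: "is_pair A C B F T.lift P"
    unfolding is_pair_def
  proof (intro conjI ballI P)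
    fix a b assume a: "a \<in> bounded_op A" and b: "b \<in> bounded_op C"
    let ?ab = "compose ?S (t.lift_left a) (t.lift b)"
    have ab: "?ab \<in> bounded_op ?S"
      by (intro bounded_op_compose t.B t.lift_left_in t.lift_in a b)
    have "P ?ab = compose B (T.lift_left a) (T.lift b)"
    proof (rule T.op_eqI)
      fix x c assume x: "x \<in> A" and c: "c \<in> C"
      then show "P ?ab (T x c) = compose B (T.lift_left a) (T.lift b) (T x c)"
        using a b
        by (simp add: P_def T.T_in T.amp_T[OF t' bop_id] t.amp_T[OF D bop_id] compose_eq t.T_in
          t.lift_T t.lift_left_T T.lift_T T.lift_left_T T.op_C_in T.op_A_in)
    next
      show "P ?ab \<in> bounded_op B" by (rule register_in[OF P ab])
    qed (intro bounded_op_compose T.B T.lift_left_in T.lift_in a b)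
    then show "P (tensor_op A C a b) = compose B (F a) (T.lift b)"
      by (simp add: tensor_op_eq T.A T.C a b F_eq)
  qed
  have "Q g = P g" if Q: "is_pair A C B F T.lift Q" and g: "g \<in> bounded_op ?S" for Q g
  proof (rule T.op_eqI_form)
    show "Q g \<in> bounded_op B" using Q g unfolding is_pair_def by (blast intro: register_in)
    show "P g \<in> bounded_op B" using P g by (rule register_in)
  qed (simp add: pair_coefficients[OF D F_eq Q g] pair_coefficients[OF D F_eq pair g])
  moreover have "compatible A C B F T.lift"
    unfolding compatible_def using F T.register_lift T.lift_commute by (simp add: F_eq)
  ultimately show ?thesis
    unfolding complements_def using pair iso by blast
qed

section \<open>Normality\<close>

lemma trace_class_bounded_op:
  "closed_csubspace S \<Longrightarrow> t \<in> trace_class S \<Longrightarrow> t \<in> bounded_op S"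
  by (auto simp: trace_class_def hilbert_schmidt_def bounded_op_compose)

text \<open>If \<open>f\<close> is not summable, neither is any tail obtained by removing finitely
  many indices, and \<open>infsum\<close> is then 0 by convention. The diagonal of a trace class
  operator can thus be treated without a summability proof.\<close>

lemma infsum_tail_tendsto:
  fixes f :: "'i \<Rightarrow> 'b::banach"
  shows "((\<lambda>M. infsum f (E - M)) \<longlongrightarrow> 0) (finite_subsets_at_top E)"
proof (cases "f summable_on E")
  case True
  have "((\<lambda>M. infsum f E - sum f M) \<longlongrightarrow> infsum f E - infsum f E) (finite_subsets_at_top E)"
    by (intro tendsto_intros infsum_tendsto True)
  moreover have "\<forall>\<^sub>F M in finite_subsets_at_top E. infsum f E - sum f M = infsum f (E - M)"
  proof (rule eventually_finite_subsets_at_top_weakI)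
    fix M assume "finite M" "M \<subseteq> E"
    then show "infsum f E - sum f M = infsum f (E - M)"
      using infsum_Diff[of f E M] True by simp
  qed
  ultimately show ?thesis using Lim_transform_eventually by fastforce
next
  case False
  have "\<not> f summable_on (E - M)" if "finite M" "M \<subseteq> E" for M
    using summable_on_Un_disjoint[of f "E - M" M] False that by (auto simp: Un_absorb2)
  then have "\<forall>\<^sub>F M in finite_subsets_at_top E. 0 = infsum f (E - M)"
    by (intro eventually_finite_subsets_at_top_weakI) (simp add: infsum_not_exists)
  then show ?thesis by (rule Lim_transform_eventually[OF tendsto_const])
qed

text \<open>The identity minus the diagonal matrix units in \<open>M\<close>; weak* convergence of
  their sums to the identity becomes convergence of these tails to 0.\<close>

definition onb_tail :: "'a::chilbert_space set \<Rightarrow> 'a set \<Rightarrow> 'a \<Rightarrow> 'a" where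
  "onb_tail A M = (\<lambda>z\<in>A. z - (\<Sum>e\<in>M. cinner e z *\<^sub>C e))"

text \<open>The nested restrictions and the scalar -1 reproduce the left-hand sides of
  \<open>register_plus\<close> and \<open>register_scaleC\<close>, so a register can be evaluated on
  a tail one basis vector at a time.\<close>

lemma onb_tail_insert:
  assumes "closed_csubspace A" "finite M" "e \<notin> M"
  shows "onb_tail A (insert e M) = (\<lambda>z\<in>A. onb_tail A M z + (\<lambda>w\<in>A. (-1) *\<^sub>C ketbra A e e w) z)"
  unfolding onb_tail_def by (rule restrict_ext) (use assms in \<open>simp add: ketbra_apply\<close>)

lemma onb_tail_empty: "onb_tail A {} = (\<lambda>z\<in>A. z)"
  by (simp add: onb_tail_def)

lemma onb_tail_in:
  assumes A: "closed_csubspace A" and "finite M" "M \<subseteq> A"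
  shows "onb_tail A M \<in> bounded_op A"
  using assms(2,3)
proof (induction M)
  case (insert e M)
  then show ?case
    unfolding onb_tail_insert[OF A insert(1,2)]
    by (intro bounded_op_plus bounded_op_cmult ketbra_in A) auto
qed (simp add: onb_tail_empty bounded_op_id A)

text \<open>Induction over the generation of the open set. In the subbasic case the tail kills the
  vectors of \<open>M\<close> and fixes the other basis vectors, so the trace against
  \<open>t\<close> is a tail of the diagonal sum of \<open>t\<close>.\<close>

lemma eventually_onb_tail:
  assumes A: "closed_csubspace A" and W: "openin (weak_star_topology A) W" and 0: "(\<lambda>x\<in>A. 0) \<in> W"
  shows "\<forall>\<^sub>F M in finite_subsets_at_top (some_onb A). onb_tail A M \<in> W"
  using W 0 unfolding weak_star_topology_def openin_topology_generated_by_iff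
proof (induction rule: generate_topology_on.induct)
  case (Int a b)
  then show ?case by (simp add: eventually_conj)
next
  case (UN K)
  then obtain k where k: "k \<in> K" "(\<lambda>x\<in>A. 0) \<in> k" by blast
  show ?case by (rule eventually_mono[OF UN.IH[OF k]]) (rule UnionI[OF k(1)])
next
  case (Basis s)
  let ?E = "some_onb A"
  note E = is_onb_some_onb[OF A]
  have EA: "e \<in> A" if "e \<in> ?E" for e using is_onb_subset[OF E that] .
  obtain t U where s: "s = {a \<in> bounded_op A. trace A (compose A t a) \<in> U}"
    and t: "t \<in> trace_class A" and U: "open U" using Basis by blast
  have t0: "t 0 = 0" by (rule bop_zero[OF A bounded_op_bop[OF trace_class_bounded_op[OF A t]]])
  have trace_tail: "trace A (compose A t (onb_tail A M)) = (\<Sum>\<^sub>\<infinity>e\<in>?E - M. cinner e (t e))"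
    if M: "finite M" "M \<subseteq> ?E" for M
    unfolding trace_def
  proof (rule infsum_cong_neutral)
    have tail: "onb_tail A M e = (if e \<in> M then 0 else e)" if "e \<in> ?E" for e
    proof -
      have "(\<Sum>f\<in>M. cinner f e *\<^sub>C f) = (\<Sum>f\<in>M. if f = e then e else 0)"
        using M that by (intro sum.cong) (auto simp: is_onb_cinner[OF E])
      then show ?thesis using M EA[OF that] by (simp add: onb_tail_def)
    qed
    show "cinner e (compose A t (onb_tail A M) e) = 0" if "e \<in> ?E - (?E - M)" for e
      using that EA by (simp add: compose_eq tail t0)
    show "cinner e (compose A t (onb_tail A M) e) = cinner e (t e)" if "e \<in> ?E \<inter> (?E - M)" for e
      using that EA by (simp add: compose_eq tail)
  qed auto
  have "trace A (compose A t (\<lambda>x\<in>A. 0)) = 0"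
    unfolding trace_def by (rule infsum_0) (simp add: compose_eq EA t0)
  moreover have "trace A (compose A t (\<lambda>x\<in>A. 0)) \<in> U"
    using Basis(2) unfolding s by (elim CollectE conjE)
  ultimately have "0 \<in> U" by (simp only:)
  have "\<forall>\<^sub>F M in finite_subsets_at_top ?E. (\<Sum>\<^sub>\<infinity>e\<in>?E - M. cinner e (t e)) \<in> U"
    by (rule topological_tendstoD[OF infsum_tail_tendsto U \<open>0 \<in> U\<close>])
  moreover have "\<forall>\<^sub>F M in finite_subsets_at_top ?E. finite M \<and> M \<subseteq> ?E"
    by (rule eventually_finite_subsets_at_top_weakI) simp
  ultimately show ?case
  proof eventually_elim
    case (elim M)
    then show ?case using onb_tail_in[OF A, of M] EA by (auto simp: s trace_tail)
  qed
qed simp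

lemma register_normal:
  assumes A: "closed_csubspace A" and B: "closed_csubspace B" and F: "register A B F"
    and y: "y \<in> B" and orth: "\<And>e. e \<in> some_onb A \<Longrightarrow> cinner y (F (ketbra A e e) y) = 0"
  shows "y = 0"
proof (rule ccontr)
  assume "y \<noteq> 0"
  let ?E = "some_onb A"
  have EA: "e \<in> A" if "e \<in> ?E" for e using is_onb_subset[OF is_onb_some_onb[OF A] that] .
  obtain t where t: "t \<in> trace_class B" "\<forall>b\<in>bounded_op B. trace B (compose B t b) = cinner y (b y)"
    using normal_form_trace_class[OF B, of "{()}" "\<lambda>_. y" "\<lambda>_. y"] y by (auto simp: sq_summable_def)
  \<comment> \<open>The operators \<open>b\<close> with
    \<open>\<langle>y, b y\<rangle> \<noteq> \<langle>y, y\<rangle>\<close>, an open set containing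
    0. By normality \<open>F\<close> eventually maps the tails into it, whereas orthogonality keeps
    their coefficient at \<open>\<langle>y, y\<rangle>\<close>.\<close>
  let ?V = "{b \<in> bounded_op B. trace B (compose B t b) \<in> - {cinner y y}}"
  have "openin (weak_star_topology B) ?V"
    unfolding weak_star_topology_def by (rule topology_generated_by_Basis) (use t in blast)
  then have "openin (weak_star_topology A) {a \<in> topspace (weak_star_topology A). F a \<in> ?V}"
    by (rule openin_continuous_map_preimage[OF register_continuous[OF F]])
  moreover have "(\<lambda>x\<in>A. 0) \<in> {a \<in> topspace (weak_star_topology A). F a \<in> ?V}"
    using y \<open>y \<noteq> 0\<close> t(2) bounded_op_zero[OF A] bounded_op_zero[OF B]
    by (simp add: topspace_weak_star[OF A] register_zero[OF A F])
  ultimately have "\<forall>\<^sub>F M in finite_subsets_at_top ?E.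
      onb_tail A M \<in> {a \<in> topspace (weak_star_topology A). F a \<in> ?V}"
    by (rule eventually_onb_tail[OF A])
  then obtain M where M: "finite M" "M \<subseteq> ?E" "F (onb_tail A M) \<in> ?V"
    unfolding eventually_finite_subsets_at_top by blast
  have "cinner y (F (onb_tail A M) y) = cinner y y"
    using M(1,2)
  proof (induction M)
    case empty
    show ?case unfolding onb_tail_empty register_id[OF F] using y by simp
  next
    case (insert e M)
    then have e: "e \<in> ?E" and tail: "onb_tail A M \<in> bounded_op A" and "M \<subseteq> ?E"
      using EA by (auto intro!: onb_tail_in A)
    have ket: "ketbra A e e \<in> bounded_op A" by (rule ketbra_in[OF A EA[OF e]])
    have "F (onb_tail A (insert e M)) y = F (onb_tail A M) y + (-1) *\<^sub>C F (ketbra A e e) y"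
      unfolding onb_tail_insert[OF A insert(1,2)] register_plus[OF F tail bounded_op_cmult[OF A ket]]
        register_scaleC[OF F ket]
      using y by simp
    then show ?case using insert(3)[OF \<open>M \<subseteq> ?E\<close>] orth[OF e] by (simp add: cinner_simps)
  qed
  then show False using M(3) t(2) by auto
qed

text \<open>For the Gram identity, \<open>F |e\<rangle>\<langle>x|\<close> times
  \<open>F |z\<rangle>\<langle>e|\<close> is \<open>\<langle>x, z\<rangle>\<close> times
  \<open>F |e\<rangle>\<langle>e|\<close>, which fixes the vectors of the subspace. Totality is the
  only axiom that calls for \<open>register_normal\<close>.\<close>

lemma register_decomp:
  assumes A: "closed_csubspace A" and B: "closed_csubspace B" and F: "register A B F"
    and e: "e \<in> A" "norm e = 1"
  shows "tensor_decomp A {c \<in> B. F (ketbra A e e) c = c} B (\<lambda>x c. F (ketbra A x e) c)"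
    (is "tensor_decomp A ?C B ?T")
proof
  note ket = ketbra_in[OF A]
  have Fb: "bop B B (F a)" if "a \<in> bounded_op A" for a
    by (rule bounded_op_bop[OF register_in[OF F that]])
  have Fket_in: "F (ketbra A x w) y \<in> B" if "x \<in> A" "y \<in> B" for x w y
    using bop_in[OF Fb[OF ket]] that by blast
  have Fket_ket: "F (ketbra A x w) (F (ketbra A z v) y) = cinner w z *\<^sub>C F (ketbra A x v) y"
    if "x \<in> A" "z \<in> A" "y \<in> B" for x w z v y
  proof -
    have "F (ketbra A x w) (F (ketbra A z v) y) = F (compose A (ketbra A x w) (ketbra A z v)) y"
      using that by (simp add: register_compose[OF F] ket compose_eq)
    also have "\<dots> = cinner w z *\<^sub>C F (ketbra A x v) y"
      using that by (simp add: compose_ketbra_ketbra[OF A] register_scaleC[OF F] ket)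
    finally show ?thesis .
  qed
  have Fket_adj: "cinner (F (ketbra A x w) y) y' = cinner y (F (ketbra A w x) y')"
    if "x \<in> A" "w \<in> A" "y \<in> B" "y' \<in> B" for x w y y'
    using adj_op_left[OF B register_in[OF F ket], of w y y' x] that
    by (simp add: register_adj[OF F ket, symmetric] adj_op_ketbra[OF A])
  show "closed_csubspace A" "closed_csubspace B" by fact+
  show "closed_csubspace ?C"
  proof -
    have "closed ?C"
    proof (unfold closed_sequential_limits, intro allI impI, elim conjE)
      fix X l assume X: "\<forall>n. X n \<in> ?C" and lim: "X \<longlonglongrightarrow> l"
      have l: "l \<in> B" using closed_csubspace_closed[OF B] X lim by (auto simp: closed_sequential_limits)
      obtain K where K: "\<forall>x\<in>B. norm (F (ketbra A e e) x) \<le> K * norm x"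
        using bop_bound[OF Fb[OF ket[OF e(1)]]] by auto
      have "F (ketbra A e e) (X n) - F (ketbra A e e) l = F (ketbra A e e) (X n - l)" for n
        using bop_add[OF Fb[OF ket[OF e(1)]], of "X n - l" l] X l closed_csubspace_diff[OF B] by simp
      then have bound: "norm (X n - F (ketbra A e e) l) \<le> K * norm (X n - l)" for n
        using K X l closed_csubspace_diff[OF B, of "X n" l] by (metis (mono_tags, lifting) mem_Collect_eq)
      have "(\<lambda>n. K * norm (X n - l)) \<longlonglongrightarrow> K * norm (l - l)"
        by (intro tendsto_intros lim)
      then have "(\<lambda>n. K * norm (X n - l)) \<longlonglongrightarrow> 0" by simp
      then have "(\<lambda>n. X n - F (ketbra A e e) l) \<longlonglongrightarrow> 0"
        by (rule Lim_null_comparison[OF always_eventually[OF allI[OF bound]]])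
      then have "X \<longlonglongrightarrow> F (ketbra A e e) l" by (simp add: LIM_zero_iff)
      then have "F (ketbra A e e) l = l" using lim LIMSEQ_unique by blast
      then show "l \<in> ?C" using l by simp
    qed
    then show ?thesis
      unfolding closed_csubspace_def using B bop_zero[OF B Fb[OF ket[OF e(1)]]]
      by (auto simp: csubspace_intros bop_add[OF Fb[OF ket[OF e(1)]]] bop_scaleC[OF Fb[OF ket[OF e(1)]]])
  qed
  show "F (ketbra A x e) c \<in> B" if "x \<in> A" "c \<in> ?C" for x c using that by (simp add: Fket_in)
  show "cinner (F (ketbra A x e) c) (F (ketbra A z e) d) = cinner x z * cinner c d"
    if "x \<in> A" "c \<in> ?C" "z \<in> A" "d \<in> ?C" for x c z d
    using that e by (simp add: Fket_adj Fket_in Fket_ket cinner_scaleC_right)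
  fix y assume y: "y \<in> B" and orth: "\<And>x c. x \<in> A \<Longrightarrow> c \<in> ?C \<Longrightarrow> cinner (F (ketbra A x e) c) y = 0"
  show "y = 0"
  proof (rule register_normal[OF A B F y])
    fix f assume "f \<in> some_onb A"
    then have f: "f \<in> A" using is_onb_subset[OF is_onb_some_onb[OF A]] by blast
    \<comment> \<open>Since \<open>|f\<rangle>\<langle>f|\<close> is the product of
      \<open>|f\<rangle>\<langle>e|\<close> and \<open>|e\<rangle>\<langle>f|\<close>, the vector
      \<open>F |f\<rangle>\<langle>f| y\<close> is elementary and thus orthogonal to
      \<open>y\<close>.\<close>
    have "F (ketbra A e f) y \<in> ?C"
      using e f y by (simp add: Fket_in Fket_ket cinner_self)
    from orth[OF f this] have "cinner (F (ketbra A f f) y) y = 0"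
      using e f y by (simp add: Fket_ket cinner_self)
    then show "cinner y (F (ketbra A f f) y) = 0" by (simp add: cinner_eq_0_flip[of y])
  qed
qed

text \<open>The complement lives on a subspace of \<open>B\<close>, so its Hilbert space can be
  found within the type \<open>'b\<close>.\<close>

lemma complement_exists:
  fixes A :: "'a::chilbert_space set" and B :: "'b::chilbert_space set"
  assumes A: "closed_csubspace A" and B: "closed_csubspace B" and F: "register A B F"
  shows "\<exists>(C :: 'b set) G. closed_csubspace C \<and> register C B G \<and> complements A C B F G"
proof -
  have "\<exists>(C :: 'b set) T. tensor_decomp A C B T \<and>
    (\<forall>a\<in>bounded_op A. \<forall>x\<in>A. \<forall>c\<in>C. F a (T x c) = T (a x) c)"
  proof (cases "A = {0}")
    \<comment> \<open>No unit vector exists here. The identity of \<open>B\<close> is then the image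
      of 0, which forces \<open>B = {0}\<close>, and the zero map is a decomposition with
      \<open>C = B\<close>.\<close>
    case True
    have "y = 0" if "y \<in> B" for y
    proof -
      have "(\<lambda>x\<in>A. x) = (\<lambda>x\<in>A. 0)" using True by (intro restrict_ext) simp
      then have "(\<lambda>y\<in>B. y) = (\<lambda>y\<in>B. 0)" using register_id[OF F] register_zero[OF A F] by simp
      then show "y = 0" using that by (metis restrict_apply')
    qed
    then have B0: "B = {0}" using closed_csubspace_zero[OF B] by auto
    have "tensor_decomp A B B (\<lambda>_ _. 0)"
      by unfold_locales (use A B True B0 in auto)
    moreover have "F a 0 = 0" if "a \<in> bounded_op A" for a
      by (rule bop_zero[OF B bounded_op_bop[OF register_in[OF F that]]])
    ultimately show ?thesis by (intro exI[of _ B] exI[of _ "\<lambda>_ _. 0"]) simp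
  next
    case False
    then obtain e where e: "e \<in> A" "norm e = 1" using exists_unit[OF A] by blast
    have "F a (F (ketbra A x e) c) = F (ketbra A (a x) e) c"
      if "a \<in> bounded_op A" "x \<in> A" "c \<in> B" for a x c
    proof -
      have "F a (F (ketbra A x e) c) = F (compose A a (ketbra A x e)) c"
        using that by (simp add: register_compose[OF F] ketbra_in A compose_eq)
      then show ?thesis using that by (simp add: compose_ketbra A)
    qed
    then show ?thesis using register_decomp[OF A B F e] by blast
  qed
  then obtain C :: "'b set" and T where D: "tensor_decomp A C B T"
    and FT: "\<And>a x c. a \<in> bounded_op A \<Longrightarrow> x \<in> A \<Longrightarrow> c \<in> C \<Longrightarrow> F a (T x c) = T (a x) c" by blast
  interpret tensor_decomp A C B T by (rule D)
  show ?thesis using C register_lift complements_lift[OF D F FT] by blast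
qed

section \<open>Uniqueness of complements\<close>

text \<open>Under the inverse \<open>R\<close> of the pair, \<open>F a\<close> becomes
  \<open>a \<otimes> 1\<close>. Since \<open>H d\<close> commutes with the range of
  \<open>F\<close>, \<open>R (H d)\<close> commutes with these operators and is
  \<open>1 \<otimes> I d\<close> by \<open>commutant\<close>; applying \<open>P\<close> gives
  \<open>G (I d) = H d\<close>.\<close>

lemma complement_factor:
  assumes A: "closed_csubspace A" "A \<noteq> {0}" and B: "closed_csubspace B"
    and C: "closed_csubspace C" and D: "closed_csubspace D"
    and FG: "complements A C B F G" and FH: "compatible A D B F H"
  shows "inj_on G (bounded_op C)" "\<exists>I. register D C I \<and> (\<forall>d\<in>bounded_op D. G (I d) = H d)"
proof -
  let ?S = "tensor_space A C"
  interpret t: tensor_decomp A C ?S tensor_vec by (rule tensor_decomp_tensor_space[OF A(1) C])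
  obtain e where e: "e \<in> A" "norm e = 1" using exists_unit[OF A] by blast
  have F: "register A B F" and G: "register C B G" using FG by (auto simp: complements_def compatible_def)
  have H: "register D B H" using FH by (simp add: compatible_def)
  obtain P where pair: "is_pair A C B F G P" and "iso_register ?S B P"
    using FG unfolding complements_def by blast
  then obtain R where P: "register ?S B P" and R: "register B ?S R"
    and PR: "\<And>b. b \<in> bounded_op B \<Longrightarrow> P (R b) = b" and RP: "\<And>g. g \<in> bounded_op ?S \<Longrightarrow> R (P g) = g"
    unfolding iso_register_def by blast
  have P_lift: "P (t.lift c) = G c" if c: "c \<in> bounded_op C" for c
  proof -
    have "P (tensor_op A C (\<lambda>x\<in>A. x) c) = compose B (F (\<lambda>x\<in>A. x)) (G c)"
      using pair bounded_op_id[OF A(1)] c unfolding is_pair_def by blast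
    then show ?thesis
      by (simp add: tensor_op_eq A C c bounded_op_id t.lift_left_id register_id[OF F]
        compose_id_left t.lift_in register_in[OF G])
  qed
  have P_lift_left: "P (t.lift_left a) = F a" if a: "a \<in> bounded_op A" for a
  proof -
    have "P (tensor_op A C a (\<lambda>x\<in>C. x)) = compose B (F a) (G (\<lambda>x\<in>C. x))"
      using pair bounded_op_id[OF C] a unfolding is_pair_def by blast
    then show ?thesis
      by (simp add: tensor_op_eq A C a bounded_op_id t.lift_id register_id[OF G]
        compose_id_right t.lift_left_in register_in[OF F])
  qed
  show "inj_on G (bounded_op C)"
  proof (rule inj_onI)
    fix c d assume c: "c \<in> bounded_op C" and d: "d \<in> bounded_op C" and "G c = G d"
    then have "R (P (t.lift c)) = R (P (t.lift d))" by (simp add: P_lift)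
    then have "t.lift c = t.lift d" using c d by (simp add: RP t.lift_in)
    then show "c = d" by (rule t.lift_inject[OF A(2) c d])
  qed
  \<comment> \<open>Compression undoes the lift, so no other choice is possible; the formula also
    exhibits \<open>I\<close> as a composite of three weak* continuous maps.\<close>
  define I where "I d = t.compress e (R (H d))" for d
  have RH: "R (H d) \<in> bounded_op ?S" if "d \<in> bounded_op D" for d
    using that register_in[OF H] register_in[OF R] by blast
  have I_in: "I d \<in> bounded_op C" if "d \<in> bounded_op D" for d
    unfolding I_def by (rule t.compress_in[OF e(1) RH[OF that]])
  have lift_I: "t.lift (I d) = R (H d)" if d: "d \<in> bounded_op D" for d
    unfolding I_def
  proof (rule t.commutant[OF e RH[OF d], symmetric])
    fix x assume "x \<in> A"
    then have k: "ketbra A x e \<in> bounded_op A" by (rule ketbra_in[OF A(1)])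
    have lk: "t.lift_left (ketbra A x e) = R (F (ketbra A x e))"
      using RP[OF t.lift_left_in[OF k]] P_lift_left[OF k] by simp
    have "compose B (F (ketbra A x e)) (H d) = compose B (H d) (F (ketbra A x e))"
      using FH k d unfolding compatible_def by blast
    then show "compose ?S (t.lift_left (ketbra A x e)) (R (H d)) =
        compose ?S (R (H d)) (t.lift_left (ketbra A x e))"
      unfolding lk
      using register_compose[OF R register_in[OF F k] register_in[OF H d]]
        register_compose[OF R register_in[OF H d] register_in[OF F k]] by simp
  qed
  \<comment> \<open>Injectivity of the lift transfers each algebraic law of \<open>I\<close> from
    the same law for \<open>H\<close>, \<open>R\<close> and \<open>t.lift\<close>.\<close>
  have I_eqI: "I d = c" if "d \<in> bounded_op D" "c \<in> bounded_op C" "R (H d) = t.lift c" for d c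
    using that by (intro t.lift_inject[OF A(2)]) (simp_all add: I_in lift_I)
  have "register D C I"
    unfolding register_def
  proof (intro conjI ballI allI)
    show "I \<in> bounded_op D \<rightarrow> bounded_op C" using I_in by blast
    fix a assume a: "a \<in> bounded_op D"
    show "I (\<lambda>x\<in>D. c *\<^sub>C a x) = (\<lambda>y\<in>C. c *\<^sub>C I a y)" for c
      by (rule I_eqI)
        (simp_all add: a bounded_op_cmult C D I_in register_scaleC[OF H] register_scaleC[OF R]
          register_in[OF H] t.lift_scaleC lift_I)
    show "I (adj_op D a) = adj_op C (I a)"
      by (rule I_eqI)
        (simp_all add: a adj_op_in C D I_in register_adj[OF H] register_adj[OF R] register_in[OF H]
          t.lift_adj lift_I)
    fix b assume b: "b \<in> bounded_op D"
    show "I (\<lambda>x\<in>D. a x + b x) = (\<lambda>y\<in>C. I a y + I b y)"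
      by (rule I_eqI)
        (simp_all add: a b bounded_op_plus C D I_in register_plus[OF H] register_plus[OF R]
          register_in[OF H] t.lift_plus lift_I)
    show "I (compose D a b) = compose C (I a) (I b)"
      by (rule I_eqI)
        (simp_all add: a b bounded_op_compose C D I_in register_compose[OF H] register_compose[OF R]
          register_in[OF H] t.lift_compose lift_I)
  next
    show "I (\<lambda>x\<in>D. x) = (\<lambda>y\<in>C. y)"
      by (rule I_eqI) (simp_all add: bounded_op_id C D register_id[OF H] register_id[OF R] t.lift_id)
    have "continuous_map (weak_star_topology D) (weak_star_topology C) (t.compress e \<circ> (R \<circ> H))"
      by (intro continuous_map_compose[OF _ t.continuous_compress[OF e(1)]]
        continuous_map_compose[OF register_continuous[OF H] register_continuous[OF R]])
    then show "continuous_map (weak_star_topology D) (weak_star_topology C) I"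
      unfolding I_def[abs_def] comp_def .
  qed
  moreover have "G (I d) = H d" if "d \<in> bounded_op D" for d
    using P_lift[OF I_in[OF that]] PR[OF register_in[OF H that]] by (simp add: lift_I that)
  ultimately show "\<exists>I. register D C I \<and> (\<forall>d\<in>bounded_op D. G (I d) = H d)" by blast
qed

text \<open>Factoring each complement through the other gives \<open>I\<close> and \<open>J\<close>
  with \<open>G (I (J c)) = H (J c) = G c\<close>, and symmetrically for \<open>H\<close>;
  injectivity of \<open>G\<close> and \<open>H\<close> makes them mutually inverse.\<close>

lemma complements_equivalent:
  assumes A: "closed_csubspace A" "A \<noteq> {0}" and B: "closed_csubspace B"
    and C: "closed_csubspace C" and D: "closed_csubspace D"
    and FG: "complements A C B F G" and FH: "complements A D B F H"
  shows "equivalent_registers C D G H"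
proof -
  have cG: "compatible A C B F G" and cH: "compatible A D B F H"
    using FG FH by (auto simp: complements_def)
  note G_inj = inj_onD[OF complement_factor(1)[OF A B C D FG cH]]
  note H_inj = inj_onD[OF complement_factor(1)[OF A B D C FH cG]]
  obtain I where I: "register D C I" "\<And>d. d \<in> bounded_op D \<Longrightarrow> G (I d) = H d"
    using complement_factor(2)[OF A B C D FG cH] by blast
  obtain J where J: "register C D J" "\<And>c. c \<in> bounded_op C \<Longrightarrow> H (J c) = G c"
    using complement_factor(2)[OF A B D C FH cG] by blast
  have "I (J c) = c" if c: "c \<in> bounded_op C" for c
    by (rule G_inj) (simp_all add: c I J register_in[OF I(1)] register_in[OF J(1)])
  moreover have "J (I d) = d" if d: "d \<in> bounded_op D" for d
    by (rule H_inj) (simp_all add: d I J register_in[OF I(1)] register_in[OF J(1)])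
  ultimately show ?thesis
    unfolding equivalent_registers_def iso_register_def using I J by blast
qed

text \<open>The premise \<open>A \<noteq> {0}\<close> in the second part excludes a genuine
  exception: for \<open>A = {0}\<close> a register forces \<open>B = {0}\<close>, and then every
  Hilbert space, of whatever dimension, carries a complement of \<open>F\<close>.\<close>

theorem theorem4:
  fixes A :: "'a::chilbert_space set" and B :: "'b::chilbert_space set"
  assumes "closed_csubspace A" and "closed_csubspace B"
  shows "(\<forall>F. register A B F \<longrightarrow>
            (\<exists>(C :: 'b set) G. closed_csubspace C \<and> register C B G \<and> complements A C B F G)) \<and>
         (\<forall>(C :: 'c::chilbert_space set) (D :: 'd::chilbert_space set) F G H.
            A \<noteq> {0} \<longrightarrow> closed_csubspace C \<longrightarrow> closed_csubspace D \<longrightarrow>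
            register A B F \<longrightarrow> register C B G \<longrightarrow> register D B H \<longrightarrow>
            complements A C B F G \<longrightarrow> complements A D B F H \<longrightarrow>
            equivalent_registers C D G H)"
proof (intro conjI allI impI)
  fix F assume "register A B F"
  then show "\<exists>(C :: 'b set) G. closed_csubspace C \<and> register C B G \<and> complements A C B F G"
    by (rule complement_exists[OF assms])
next
  fix C :: "'c set" and D :: "'d set" and F G H
  assume "A \<noteq> {0}" "closed_csubspace C" "closed_csubspace D"
    and "complements A C B F G" "complements A D B F H"
  then show "equivalent_registers C D G H"
    by (rule complements_equivalent[OF assms(1) _ assms(2)])
qed

end
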